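(* Assume the Riemann Hypothesis. Let $a,b$ be positive integers with $b<a<2b$. Let $\alpha(a,b)$ be a real number with $0<\alpha(a,b)<\frac1{a+b}$ such that $\Delta(a,b;x)\ll x^{\alpha(a,b)+\varepsilon}$ for every $\varepsilon>0$, and suppose $\alpha(a,b)<\frac1{2b}$. Then for every $\varepsilon>0$, $$\sum_{n\le x}f_{(a,b)}(n)=\frac{\zeta(\frac ab)}{\zeta(2)}x^{\frac1b}+\frac{\zeta(\frac ba)}{\zeta(\frac{2b}a)}x^{\frac1a}+O\!\left(x^{\frac{1-b\alpha(a,b)}{3b-4b^2\alpha(a,b)}+\varepsilon}\right).$$
   Context: $\zeta$ is the Riemann zeta-function. $R_{a,b}$ is the set of all positive integers $n$ such that each exponent in the prime factorization of $n$ is either a multiple of $a$ or of the form $at+b$ with an integer $t\ge0$ (with $1\in R_{a,b}$), and $f_{(a,b)}$ is the characteristic function of $R_{a,b}$ (generalized square-full integers). Let $d(a,b;n)$ be the number of pairs of positive integers $(m_1,m_2)$ with $m_1^am_2^b=n$; the error term $\Delta(a,b;x)$ is defined by $\sum_{n\le x}d(a,b;n)=\zeta(b/a)x^{1/a}+\zeta(a/b)x^{1/b}+\Delta(a,b;x)$. Implied constants depend only on $a,b,\alpha(a,b),\varepsilon$. *)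

theory Defs
  imports
    "HOL-Complex_Analysis.Complex_Analysis"
    "HOL-Library.Landau_Symbols"
begin

section \<open>The Riemann zeta function\<close>

text \<open>
  The analytic continuation of the Dirichlet series to the complex plane without 1. Existence is
  \<open>zeta_continuation_exists\<close>, uniqueness away from 1 is \<open>zeta_unique\<close>; the value at the pole 1 is
  unspecified.
\<close>

definition zeta :: "complex \<Rightarrow> complex" where
  "zeta = (SOME f. f holomorphic_on (- {1}) \<and>
                   (\<forall>s. Re s > 1 \<longrightarrow> (\<lambda>n. of_nat (Suc n) powr (- s)) sums f s))"

definition riemann_hypothesis :: bool where
  "riemann_hypothesis \<longleftrightarrow> (\<forall>s. zeta s = 0 \<and> 0 < Re s \<and> Re s < 1 \<longrightarrow> Re s = 1 / 2)"


subsection \<open>Existence and uniqueness of the continuation\<close>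

lemma holomorphic_suminf_powr_bound:
  fixes f :: "nat \<Rightarrow> complex \<Rightarrow> complex" and c :: real
  defines "S \<equiv> {s. Re s > 1 - c}"
  assumes holo: "\<And>n. f n holomorphic_on S"
    and cont: "continuous_on S C"
    and bound: "\<And>n s. s \<in> S \<Longrightarrow> norm (f n s) \<le> C s * real (Suc n) powr (- (Re s + c))"
  shows "(\<lambda>s. \<Sum>n. f n s) holomorphic_on S" and "\<And>s. s \<in> S \<Longrightarrow> summable (\<lambda>n. f n s)"
proof -
  have "open S"
    unfolding S_def by (simp add: open_halfspace_Re_gt)
  have loc: "\<exists>d>0. cball x d \<subseteq> S \<and> uniform_limit (cball x d) (\<lambda>N s. \<Sum>n<N. f n s) (\<lambda>s. \<Sum>n. f n s) sequentially"
    if x: "x \<in> S" for x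
  proof -
    define d where "d = (Re x + c - 1) / 2"
    have d: "d > 0"
      using x by (simp add: d_def S_def)
    have Re: "Re y + c \<ge> 1 + d" if "y \<in> cball x d" for y
    proof -
      have "\<bar>Re x - Re y\<bar> \<le> d"
        using that abs_Re_le_cmod[of "x - y"] by (simp add: dist_norm)
      moreover have "Re x + c = 1 + 2 * d" by (simp add: d_def field_simps)
      ultimately show ?thesis by linarith
    qed
    have sub: "cball x d \<subseteq> S"
      using Re d by (force simp: S_def)
    have "compact (C ` cball x d)"
      by (intro compact_continuous_image continuous_on_subset[OF cont sub] compact_cball)
    then obtain B where B: "\<And>y. y \<in> cball x d \<Longrightarrow> \<bar>C y\<bar> \<le> B"
      using compact_imp_bounded[THEN iffD1[OF bounded_iff]] by force
    have B0: "B \<ge> 0"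
      using B[of x] d by force
    have "uniform_limit (cball x d) (\<lambda>N s. \<Sum>n<N. f n s) (\<lambda>s. \<Sum>n. f n s) sequentially"
    proof (rule Weierstrass_m_test)
      fix n y assume y: "y \<in> cball x d"
      have "norm (f n y) \<le> C y * real (Suc n) powr (- (Re y + c))"
        using bound y sub by blast
      also have "\<dots> \<le> B * real (Suc n) powr (- (1 + d))"
        using B[OF y] B0 Re[OF y] by (intro mult_mono powr_mono) auto
      finally show "norm (f n y) \<le> B * real (Suc n) powr (- (1 + d))" .
    next
      have "summable (\<lambda>n. real n powr (- (1 + d)))"
        using d by (simp add: summable_real_powr_iff)
      then have "summable (\<lambda>n. real (Suc n) powr (- (1 + d)))"
        by (subst summable_Suc_iff)
      then show "summable (\<lambda>n. B * real (Suc n) powr (- (1 + d)))"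
        by (rule summable_mult)
    qed
    with d sub show ?thesis by blast
  qed
  show "(\<lambda>s. \<Sum>n. f n s) holomorphic_on S"
  proof (rule holomorphic_uniform_sequence[OF \<open>open S\<close>, where f = "\<lambda>N s. \<Sum>n<N. f n s"])
    show "(\<lambda>s. \<Sum>n<N. f n s) holomorphic_on S" for N
      by (intro holomorphic_intros holo)
  qed (use loc in blast)
  show "summable (\<lambda>n. f n s)" if s: "s \<in> S" for s
  proof -
    obtain d where d: "d > 0"
      and u: "uniform_limit (cball s d) (\<lambda>N s. \<Sum>n<N. f n s) (\<lambda>s. \<Sum>n. f n s) sequentially"
      using loc[OF s] by blast
    have "(\<lambda>N. \<Sum>n<N. f n s) \<longlonglongrightarrow> (\<Sum>n. f n s)"
      by (rule tendsto_uniform_limitI[OF u]) (use d in auto)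
    then show ?thesis
      by (auto simp: sums_def summable_def)
  qed
qed

lemma norm_of_nat_Suc_powr: "norm ((of_nat (Suc n) :: complex) powr s) = real (Suc n) powr Re s"
  by (subst norm_powr_real_powr) (simp_all del: of_nat_Suc)

lemma dirichlet_one:
  shows holomorphic_dirichlet_one:
      "(\<lambda>s. \<Sum>n. of_nat (Suc n) powr (- s) :: complex) holomorphic_on {s. Re s > 1}"
    and summable_dirichlet_one:
      "\<And>s. Re s > 1 \<Longrightarrow> summable (\<lambda>n. of_nat (Suc n) powr (- s) :: complex)"
proof -
  have *: "norm ((of_nat (Suc n) :: complex) powr (- s)) \<le> 1 * real (Suc n) powr (- (Re s + 0))" for n s
    by (subst norm_of_nat_Suc_powr) simp
  have h: "(\<lambda>s. (of_nat (Suc n) :: complex) powr (- s)) holomorphic_on {s. Re s > 1 - 0}" for n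
    by (intro holomorphic_intros) (simp del: of_nat_Suc)
  note L = holomorphic_suminf_powr_bound[of "\<lambda>n s. of_nat (Suc n) powr (- s)" 0 "\<lambda>_. 1", OF h _ *]
  show "(\<lambda>s. \<Sum>n. of_nat (Suc n) powr (- s) :: complex) holomorphic_on {s. Re s > 1}"
    using L(1) by simp
  show "summable (\<lambda>n. of_nat (Suc n) powr (- s) :: complex)" if "Re s > 1" for s
    using L(2)[of s] that by (simp del: of_nat_Suc)
qed

lemma powr_Taylor_remainder:
  fixes w :: complex
  assumes "Re w \<le> real K + 1"
  shows "norm (of_nat (Suc (Suc n)) powr w - (\<Sum>i\<le>K. (w gchoose i) * of_nat (Suc n) powr (w - of_nat i)))
           \<le> norm (\<Prod>i<Suc K. w - of_nat i) / fact K * real (Suc n) powr (Re w - real K - 1)"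
proof -
  define a :: complex where "a = of_nat (Suc n)"
  define b :: complex where "b = of_nat (Suc (Suc n))"
  define S where "S = complex_of_real ` {real (Suc n)..real (Suc (Suc n))}"
  define f where "f = (\<lambda>i z. (\<Prod>l<i. w - of_nat l) * z powr (w - of_nat i))"
  have S: "convex S"
    unfolding S_def by (intro convex_linear_image) (auto intro: bounded_linear.linear bounded_linear_of_real)
  have "norm (f 0 b - (\<Sum>i\<le>K. f i a * (b - a) ^ i / fact i))
          \<le> norm (\<Prod>i<Suc K. w - of_nat i) * real (Suc n) powr (Re w - real K - 1)
              * norm (b - a) ^ Suc K / fact K"
  proof (rule field_Taylor[OF S])
    fix i x assume x: "x \<in> S"
    then have "x \<notin> \<real>\<^sub>\<le>\<^sub>0"
      by (auto simp: S_def)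
    then have "(f i has_field_derivative f (Suc i) x) (at x)"
      unfolding f_def
      by (auto intro!: derivative_eq_intros simp: algebra_simps)
    then show "(f i has_field_derivative f (Suc i) x) (at x within S)"
      by (rule has_field_derivative_at_within)
  next
    fix x assume "x \<in> S"
    then obtain t where t: "x = of_real t" "t \<ge> real (Suc n)"
      by (auto simp: S_def)
    have "norm (x powr (w - of_nat (Suc K))) = t powr (Re w - real K - 1)"
      unfolding t(1) using t(2) by (subst norm_powr_real_powr) (simp_all add: algebra_simps)
    also have "\<dots> \<le> real (Suc n) powr (Re w - real K - 1)"
      using t assms by (intro powr_mono2') auto
    finally show "norm (f (Suc K) x)
        \<le> norm (\<Prod>i<Suc K. w - of_nat i) * real (Suc n) powr (Re w - real K - 1)"
      unfolding f_def norm_mult by (rule mult_left_mono) simp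
  next
    have "a = of_real (real (Suc n))" "b = of_real (real (Suc (Suc n)))"
      by (simp_all add: a_def b_def)
    then show "a \<in> S" "b \<in> S"
      unfolding S_def by (metis atLeastAtMost_iff imageI le_SucI of_nat_le_iff order_refl)+
  qed
  moreover have "b - a = 1"
    by (simp add: a_def b_def)
  moreover have "f i a / fact i = (w gchoose i) * a powr (w - of_nat i)" for i
    by (simp add: f_def gbinomial_prod_rev atLeast0LessThan)
  ultimately show ?thesis
    by (simp add: f_def a_def b_def del: prod.lessThan_Suc)
qed

text \<open>
  The continuation proceeds strip by strip: summing the Taylor expansion of
  \<open>(n + 1) powr (1 - s) - n powr (1 - s)\<close> over \<open>n\<close> expresses \<open>(s - 1) \<zeta>(s)\<close> through values
  \<open>\<zeta>(s + j)\<close> with \<open>j \<ge> 1\<close>.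
\<close>

lemma zeta_step_identity:
  fixes s :: complex
  assumes s: "Re s > 1"
  defines "Z \<equiv> \<lambda>s. \<Sum>n. of_nat (Suc n) powr (- s) :: complex"
  shows "(s - 1) * Z s = 1 + (\<Sum>j=2..Suc k. ((1 - s) gchoose j) * Z (s + of_nat j - 1))
      + (\<Sum>n. of_nat (Suc (Suc n)) powr (1 - s) -
              (\<Sum>i\<le>Suc k. ((1 - s) gchoose i) * of_nat (Suc n) powr (1 - s - of_nat i)))"
proof -
  have Zs: "(\<lambda>n. of_nat (Suc n) powr (1 - s - of_nat i)) sums Z (s + of_nat i - 1)"
    if "i \<ge> 1" for i
  proof -
    have "Re (s + of_nat i - 1) > 1"
      using s that by simp
    then have "(\<lambda>n. of_nat (Suc n) powr (- (s + of_nat i - 1))) sums Z (s + of_nat i - 1)"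
      unfolding Z_def by (intro summable_sums summable_dirichlet_one)
    then show ?thesis
      by (simp add: algebra_simps)
  qed
  have lim: "(\<lambda>n. (of_nat (Suc n) :: complex) powr (1 - s)) \<longlonglongrightarrow> 0"
  proof (rule tendsto_norm_zero_cancel)
    have "(\<lambda>n. real n powr (1 - Re s)) \<longlonglongrightarrow> 0"
      using s by (intro tendsto_neg_powr filterlim_real_sequentially) auto
    then have "(\<lambda>n. real (Suc n) powr (1 - Re s)) \<longlonglongrightarrow> 0"
      by (rule LIMSEQ_Suc)
    then show "(\<lambda>n. norm ((of_nat (Suc n) :: complex) powr (1 - s))) \<longlonglongrightarrow> 0"
      by (simp add: norm_of_nat_Suc_powr del: of_nat_Suc)
  qed
  have tele: "(\<lambda>n. of_nat (Suc (Suc n)) powr (1 - s) - of_nat (Suc n) powr (1 - s)) sums (0 - (1::complex))"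
    using telescope_sums[OF lim] by simp
  have "(\<lambda>n. \<Sum>i=1..Suc k. ((1 - s) gchoose i) * of_nat (Suc n) powr (1 - s - of_nat i)) sums
        (\<Sum>i=1..Suc k. ((1 - s) gchoose i) * Z (s + of_nat i - 1))"
    by (intro sums_sum sums_mult Zs) auto
  from sums_diff[OF tele this]
  have "(\<lambda>n. of_nat (Suc (Suc n)) powr (1 - s) - of_nat (Suc n) powr (1 - s) -
          (\<Sum>i=1..Suc k. ((1 - s) gchoose i) * of_nat (Suc n) powr (1 - s - of_nat i))) sums
        (- 1 - (\<Sum>i=1..Suc k. ((1 - s) gchoose i) * Z (s + of_nat i - 1)))" by simp
  moreover have "(\<Sum>i\<le>Suc k. ((1 - s) gchoose i) * of_nat (Suc n) powr (1 - s - of_nat i)) =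
      of_nat (Suc n) powr (1 - s) + (\<Sum>i=1..Suc k. ((1 - s) gchoose i) * of_nat (Suc n) powr (1 - s - of_nat i))" for n
    unfolding atMost_atLeast0 by (subst sum.atLeast_Suc_atMost) (simp_all del: sum.cl_ivl_Suc of_nat_Suc)
  ultimately have "(\<lambda>n. of_nat (Suc (Suc n)) powr (1 - s) -
              (\<Sum>i\<le>Suc k. ((1 - s) gchoose i) * of_nat (Suc n) powr (1 - s - of_nat i))) sums
        (- 1 - (\<Sum>i=1..Suc k. ((1 - s) gchoose i) * Z (s + of_nat i - 1)))"
    by (simp add: algebra_simps del: sum.cl_ivl_Suc sum.atMost_Suc of_nat_Suc)
  note R = sums_unique[OF this]
  have "(\<Sum>i=1..Suc k. ((1 - s) gchoose i) * Z (s + of_nat i - 1)) =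
        (1 - s) * Z s + (\<Sum>i=2..Suc k. ((1 - s) gchoose i) * Z (s + of_nat i - 1))"
    by (subst sum.atLeast_Suc_atMost) (simp_all add: numeral_2_eq_2 del: sum.cl_ivl_Suc)
  then show ?thesis
    unfolding R[symmetric] by (simp add: algebra_simps del: sum.cl_ivl_Suc)
qed

lemma zeta_halfplane:
  "\<exists>g. g holomorphic_on {s. Re s > 1 - real k} \<and>
       (\<forall>s. Re s > 1 \<longrightarrow> g s = (s - 1) * (\<Sum>n. of_nat (Suc n) powr (- s)))"
proof (induction k)
  case 0
  show ?case
    by (rule exI[of _ "\<lambda>s. (s - 1) * (\<Sum>n. of_nat (Suc n) powr (- s))"])
       (auto simp del: of_nat_Suc intro!: holomorphic_intros holomorphic_dirichlet_one)
next
  case (Suc k)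
  then obtain g where g: "g holomorphic_on {s. Re s > 1 - real k}"
    and g_eq: "\<And>s. Re s > 1 \<Longrightarrow> g s = (s - 1) * (\<Sum>n. of_nat (Suc n) powr (- s))"
    by blast
  let ?S = "{s. Re s > 1 - real (Suc k)}"
  define R where "R = (\<lambda>n s. (of_nat (Suc (Suc n)) :: complex) powr (1 - s) -
              (\<Sum>i\<le>Suc k. ((1 - s) gchoose i) * of_nat (Suc n) powr (1 - s - of_nat i)))"
  have R_holo: "(\<lambda>s. \<Sum>n. R n s) holomorphic_on ?S"
  proof (rule holomorphic_suminf_powr_bound(1))
    show "R n holomorphic_on ?S" for n
      unfolding R_def gbinomial_prod_rev
      by (intro holomorphic_intros) (simp_all del: of_nat_Suc)
    show "continuous_on ?S (\<lambda>s. norm (\<Prod>i<Suc (Suc k). 1 - s - of_nat i) / fact (Suc k))"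
      by (intro continuous_intros) auto
    fix n s assume "s \<in> ?S"
    then have "Re (1 - s) \<le> real (Suc k) + 1"
      by simp
    note rem = powr_Taylor_remainder[OF this, of n]
    have "Re (1 - s) - real (Suc k) - 1 = - (Re s + real (Suc k))"
      by simp
    from rem[unfolded this]
    show "norm (R n s) \<le> norm (\<Prod>i<Suc (Suc k). 1 - s - of_nat i) / fact (Suc k)
            * real (Suc n) powr (- (Re s + real (Suc k)))"
      unfolding R_def .
  qed
  define G where "G = (\<lambda>s. 1 - (\<Sum>j=2..Suc k. ((1 - s) gchoose (j - 1)) / of_nat j * g (s + of_nat j - 1))
                        + (\<Sum>n. R n s))"
  have "G holomorphic_on ?S"
    unfolding G_def gbinomial_prod_rev
  proof (intro holomorphic_intros R_holo)
    fix j assume j: "j \<in> {2..Suc k}"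
    have "(g \<circ> (\<lambda>s. s + of_nat j - 1)) holomorphic_on ?S"
      by (rule holomorphic_on_compose_gen[OF _ g]) (use j in \<open>auto intro!: holomorphic_intros\<close>)
    then show "(\<lambda>s. g (s + of_nat j - 1)) holomorphic_on ?S"
      by (simp add: o_def)
  qed auto
  moreover have "G s = (s - 1) * (\<Sum>n. of_nat (Suc n) powr (- s))" if s: "Re s > 1" for s
  proof -
    have "((1 - s) gchoose (j - 1)) / of_nat j * g (s + of_nat j - 1)
        = - (((1 - s) gchoose j) * (\<Sum>n. of_nat (Suc n) powr (- (s + of_nat j - 1))))"
      if j: "j \<in> {2..Suc k}" for j
    proof -
      obtain i where i: "j = Suc i" "i \<ge> 1"
        using j by (cases j) auto
      have "Re (s + of_nat j - 1) > 1"
        using s j by auto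
      note gj = g_eq[OF this]
      have choose: "(1 - s) gchoose j = ((1 - s) gchoose i) * (1 - s - of_nat i) / of_nat j"
        unfolding i gbinomial_prod_rev by (simp add: field_simps)
      show ?thesis
        unfolding gj choose by (simp add: i algebra_simps add_divide_distrib diff_divide_distrib)
    qed
    then have "G s = 1 + (\<Sum>j=2..Suc k. ((1 - s) gchoose j) * (\<Sum>n. of_nat (Suc n) powr (- (s + of_nat j - 1))))
         + (\<Sum>n. R n s)"
      unfolding G_def by (simp add: sum_negf del: sum.cl_ivl_Suc of_nat_Suc)
    also have "\<dots> = (s - 1) * (\<Sum>n. of_nat (Suc n) powr (- s))"
      unfolding R_def by (rule zeta_step_identity[OF s, symmetric])
    finally show ?thesis .
  qed
  ultimately show ?case by blast
qed

lemma zeta_continuation_exists: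
  "\<exists>f. f holomorphic_on (- {1}) \<and>
       (\<forall>s. Re s > 1 \<longrightarrow> (\<lambda>n. of_nat (Suc n) powr (- s)) sums f s)"
proof -
  obtain g where g: "\<And>k. g k holomorphic_on {s. Re s > 1 - real k}"
    and g_eq: "\<And>k s. Re s > 1 \<Longrightarrow> g k s = (s - 1) * (\<Sum>n. of_nat (Suc n) powr (- s))"
    using zeta_halfplane by metis
  have agree: "g k s = g l s" if "k \<le> l" "Re s > 1 - real k" for k l s
  proof (rule analytic_continuation_open[of "{s. Re s > 1}" "{s. Re s > 1 - real k}" "g k" "g l"])
    show "{s. 1 < Re s} \<noteq> {}"
      by (auto intro!: exI[of _ 2])
    show "connected {s. 1 - real k < Re s}"
      by (intro convex_connected convex_halfspace_Re_gt)
    show "g l holomorphic_on {s. 1 - real k < Re s}"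
      by (rule holomorphic_on_subset[OF g[of l]]) (use that in auto)
  qed (use that g g_eq in \<open>auto simp: open_halfspace_Re_gt\<close>)
  define m where "m = (\<lambda>s. nat (\<lfloor>\<bar>Re s\<bar>\<rfloor> + 2))"
  have m: "Re s > 1 - real (m s)" for s
    unfolding m_def by linarith
  define G where "G = (\<lambda>s. g (m s) s)"
  have G_eq: "G s = g k s" if "Re s > 1 - real k" for s k
    unfolding G_def by (metis agree linear m that)
  have "G holomorphic_on (\<Union>k. {s. Re s > 1 - real k})"
  proof (rule holomorphic_on_UN_open)
    show "G holomorphic_on {s. Re s > 1 - real k}" for k
      by (rule holomorphic_transform[OF g[of k]]) (use G_eq in auto)
  qed (auto simp: open_halfspace_Re_gt)
  then have "G holomorphic_on (- {1})"
    by (rule holomorphic_on_subset) (use m in auto)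
  then have "(\<lambda>s. G s / (s - 1)) holomorphic_on (- {1})"
    by (intro holomorphic_intros) auto
  moreover have "(\<lambda>n. of_nat (Suc n) powr (- s)) sums (G s / (s - 1))" if "Re s > 1" for s
  proof -
    have "G s / (s - 1) = (\<Sum>n. of_nat (Suc n) powr (- s))"
      using g_eq[OF that] that unfolding G_def by (auto simp del: of_nat_Suc)
    then show ?thesis
      using summable_dirichlet_one[OF that] by (metis summable_sums)
  qed
  ultimately show ?thesis by blast
qed

lemma holomorphic_zeta: "zeta holomorphic_on (- {1})"
  and sums_zeta: "\<And>s. Re s > 1 \<Longrightarrow> (\<lambda>n. of_nat (Suc n) powr (- s)) sums zeta s"
  using someI_ex[OF zeta_continuation_exists] unfolding zeta_def by blast+

lemma zeta_unique:
  assumes "f holomorphic_on (- {1})"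
    and "\<And>s. Re s > 1 \<Longrightarrow> (\<lambda>n. of_nat (Suc n) powr (- s)) sums f s"
    and "s \<noteq> 1"
  shows "f s = zeta s"
proof (rule analytic_continuation_open[of "{s. Re s > 1}" "- {1}" f zeta])
  show "{s. 1 < Re s} \<noteq> {}"
    by (auto intro!: exI[of _ 2])
  show "connected (- {1 :: complex})"
    by (rule connected_punctured_universe) simp
  show "f z = zeta z" if "z \<in> {s. Re s > 1}" for z
    using assms(2)[of z] sums_zeta[of z] that sums_unique2 by blast
qed (use assms holomorphic_zeta in \<open>auto simp: open_halfspace_Re_gt\<close>)


section \<open>Generalized square-full integers and the divisor problem\<close>

definition gen_squarefull :: "nat \<Rightarrow> nat \<Rightarrow> nat set" where
  "gen_squarefull a b =
     {n. n > 0 \<and> (\<forall>p\<in>prime_factors n. a dvd multiplicity p n \<or> (\<exists>t. multiplicity p n = a * t + b))}"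

definition gen_divisor :: "nat \<Rightarrow> nat \<Rightarrow> nat \<Rightarrow> nat" where
  "gen_divisor a b n = card {(m\<^sub>1, m\<^sub>2). m\<^sub>1 > 0 \<and> m\<^sub>2 > 0 \<and> m\<^sub>1 ^ a * m\<^sub>2 ^ b = n}"

text \<open>Complex-valued because \<open>zeta\<close> is; it agrees with the real error term.\<close>

definition divisor_error :: "nat \<Rightarrow> nat \<Rightarrow> real \<Rightarrow> complex" where
  "divisor_error a b x =
     of_nat (\<Sum>n | 0 < n \<and> real n \<le> x. gen_divisor a b n)
     - (zeta (of_nat b / of_nat a) * of_real (x powr (1 / real a))
      + zeta (of_nat a / of_nat b) * of_real (x powr (1 / real b)))"

end

(*
  The exponent pattern at or at + b means that every n in R_(a,b) is uniquely k^a l^b with l squarefree.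
  Detecting squarefree l by a sum of mu(m) over m^2 | l turns the count into the sum of mu(m) over triples
  with i^a j^b m^(2b) <= x, which is split at m = Y.

  For m <= Y the hypothesis on the divisor problem gives an error x^alpha Y^(1 - 2 b alpha). For m > Y the
  generating function is zeta(as) zeta(bs) g(2bs) with g(w) the sum of mu(m) m^(-w) over m > Y, and Perron's
  formula is shifted to Re s close to 1/(2b). There RH makes both zeta factors O(|t|^eps) and
  g = O(Y^(-1/2 + eps) |t|^eps), so the error is x^(1/(2b)) Y^(-1/2). The two errors agree for
  Y = x^((1 - 2 b alpha) / (b (3 - 4 b alpha))).
*)
theory Submission
  imports Defs "HOL-Computational_Algebra.Squarefree"
begin

section \<open>The Moebius function and generalized square-full integers\<close>

text \<open>The shifted line works because of where the arguments fall. For Re s slightly above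
  1/(2b), b s lies just right of the critical line, a s lies further right since b < a, and 2 b s
  lies just right of 1, where square root cancellation bounds the tail g. As a < 2b, the poles 1/a
  and 1/b stay to the right of the line. The cut at Y creates spurious terms. The part m <= Y gives
  only partial sums of 1/zeta(2) and 1/zeta(2b/a), and the residues of the part m > Y carry the
  missing tails. They cancel up to the bounded difference between x^(1/k) and the number of k-th
  powers up to x. Two obstacles shape the analysis. A sharp Perron cutoff converges only
  conditionally; it is written as a difference of two weighted cutoffs at consecutive integers,
  which converges absolutely, and interpolating between two bounds of the kernel costs only a small
  power of N. Moreover RH speaks of zeros, while growth bounds are needed for zeta and for its
  inverse; compactness of a normal family provides both at once.\<close>

definition mobius :: "nat \<Rightarrow> complex" where
  "mobius n = (if squarefree n then (-1) ^ card (prime_factors n) else 0)"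

lemma norm_mobius_le: "norm (mobius n) \<le> 1"
  by (simp add: mobius_def norm_power)

lemma mobius_prime_mult:
  assumes "prime p" "\<not> p dvd d" "squarefree d"
  shows "squarefree (p * d)" "mobius (p * d) = - mobius d"
proof -
  have d: "d \<noteq> 0"
    using assms(2) by (metis dvd_0_right)
  have cop: "coprime p d"
    using assms by (simp add: prime_imp_coprime)
  then show sq: "squarefree (p * d)"
    by (rule squarefree_mult_coprime[OF _ squarefree_prime[OF assms(1)] assms(3)])
  have "prime_factors (p * d) = insert p (prime_factors d)"
    using d assms prime_gt_0_nat[OF assms(1)] by (simp add: prime_factors_product prime_prime_factors)
  moreover have "p \<notin> prime_factors d"
    using assms by auto
  ultimately show "mobius (p * d) = - mobius d"
    using sq assms by (simp add: mobius_def)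
qed

text \<open>Only squarefree divisors count. For a fixed prime \<open>p\<close> dividing
  \<open>n\<close> they pair off as \<open>d\<close> and \<open>p * d\<close> with \<open>d\<close>
  prime to \<open>p\<close>, and the two members of a pair have opposite signs.\<close>

lemma sum_mobius_dvd:
  assumes "n > 0"
  shows "(\<Sum>d | d dvd n. mobius d) = (if n = 1 then 1 else 0)"
proof (cases "n = 1")
  case True
  then show ?thesis by (simp add: mobius_def)
next
  case False
  then obtain p where p: "prime p" "p dvd n"
    using prime_factor_nat by blast
  define D where "D = {d. d dvd n \<and> squarefree d}"
  define D0 where "D0 = {d\<in>D. \<not> p dvd d}"
  have fin: "finite {d. d dvd n}"
    using assms by simp
  have finD: "finite D0" "finite ((*) p ` D0)"
    unfolding D0_def D_def using finite_subset[OF _ fin] by auto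
  have D: "D = D0 \<union> (*) p ` D0"
  proof
    show "D \<subseteq> D0 \<union> (*) p ` D0"
    proof
      fix d assume d: "d \<in> D"
      show "d \<in> D0 \<union> (*) p ` D0"
      proof (cases "p dvd d")
        case True
        then obtain e where e: "d = p * e" by (elim dvdE)
        have "\<not> p dvd e"
        proof
          assume "p dvd e"
          then have "p ^ 2 dvd d"
            by (simp add: e power2_eq_square)
          then have "p dvd 1"
            using d squarefreeD unfolding D_def by blast
          then show False using p by simp
        qed
        moreover have "squarefree e" "e dvd n"
          using d squarefree_multD(2)[of p e] dvd_mult_right[of p e n] by (auto simp: D_def e)
        ultimately show ?thesis
          by (auto simp: D0_def D_def e)
      qed (use d in \<open>auto simp: D0_def\<close>)
    qed
    show "D0 \<union> (*) p ` D0 \<subseteq> D"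
    proof
      fix d assume "d \<in> D0 \<union> (*) p ` D0"
      then show "d \<in> D"
      proof
        assume "d \<in> (*) p ` D0"
        then obtain e where e: "d = p * e" "e \<in> D0" by auto
        then have "coprime p e"
          using p by (simp add: D0_def prime_imp_coprime)
        then have "p * e dvd n"
          using p e by (intro divides_mult) (auto simp: D0_def D_def)
        then show "d \<in> D"
          using e mobius_prime_mult(1)[OF p(1), of e] by (auto simp: D0_def D_def)
      qed (auto simp: D0_def)
    qed
  qed
  have inj: "inj_on ((*) p) D0"
    using prime_gt_0_nat[OF p(1)] by (auto simp: inj_on_def)
  have "(\<Sum>d | d dvd n. mobius d) = sum mobius D"
    using fin by (intro sum.mono_neutral_right) (auto simp: D_def mobius_def)
  also have "\<dots> = sum mobius D0 + sum mobius ((*) p ` D0)"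
    unfolding D using finD by (intro sum.union_disjoint) (auto simp: D0_def)
  also have "sum mobius ((*) p ` D0) = (\<Sum>d\<in>D0. - mobius d)"
    by (subst sum.reindex[OF inj]) (auto intro!: sum.cong mobius_prime_mult(2) p simp: D0_def D_def)
  finally show ?thesis
    using False by (simp add: sum_negf)
qed

text \<open>\<open>m ^ 2 dvd l\<close> holds exactly when \<open>m\<close> divides
  \<open>square_part l\<close>. The sum is thus a full divisor sum of \<open>mobius\<close>, which
  detects \<open>square_part l = 1\<close>, that is, \<open>l\<close> squarefree.\<close>

lemma sum_mobius_square_dvd:
  assumes "l > 0"
  shows "(\<Sum>m | m ^ 2 dvd l. mobius m) = (if squarefree l then 1 else 0)"
proof -
  have pos: "square_part l > 0"
    using assms square_part_0_iff[of l] by linarith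
  have sq: "square_part l = 1 \<longleftrightarrow> squarefree l"
  proof
    assume "square_part l = 1"
    then have "x dvd 1" if "x ^ 2 dvd l" for x
      using that dvd_square_part_iff[of x l] by simp
    then show "squarefree l"
      by (rule squarefreeI)
  next
    assume "squarefree l"
    then have "square_part l dvd 1"
      using square_part_square_dvd by (rule squarefreeD)
    then show "square_part l = 1"
      by simp
  qed
  have "(\<Sum>m | m ^ 2 dvd l. mobius m) = (\<Sum>m | m dvd square_part l. mobius m)"
    by (simp only: dvd_square_part_iff)
  also have "\<dots> = (if square_part l = 1 then 1 else 0)"
    by (rule sum_mobius_dvd[OF pos])
  finally show ?thesis
    by (simp only: sq)
qed

lemma multiplicity_squarefree_power_product:
  assumes "prime p" "k > 0" "squarefree (l::nat)"
  shows "multiplicity p (k ^ a * l ^ b) = a * multiplicity p k + (if p dvd l then b else 0)"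
proof -
  have l: "l > 0"
    using assms by (cases "l = 0") auto
  have "multiplicity p l = (if p dvd l then 1 else 0)"
  proof (cases "p dvd l")
    case True
    have "multiplicity p l \<le> 1"
      using assms(1,3) squarefree_factorial_semiring'[of l] l True
      by (cases "p \<in> prime_factors l") (auto simp: in_prime_factors_iff)
    moreover have "multiplicity p l > 0"
      using True assms(1) l by (simp add: prime_multiplicity_gt_zero_iff)
    ultimately show ?thesis using True by simp
  qed (simp add: not_dvd_imp_multiplicity_0)
  moreover have "multiplicity p (k ^ a * l ^ b) = a * multiplicity p k + b * multiplicity p l"
    using assms l by (simp add: prime_elem_multiplicity_mult_distrib prime_elem_multiplicity_power_distrib)
  ultimately show ?thesis by simp
qed

text \<open>Since 0 < b < a, an exponent is 0 or \<open>b\<close> modulo \<open>a\<close> and these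
  residues differ, so the exponents of k^a l^b show which primes divide \<open>l\<close>; the
  exponents of \<open>k\<close> then follow. Surjectivity inverts this prime by prime.\<close>

lemma bij_betw_gen_squarefull:
  assumes ab: "0 < b" "b < a"
  shows "bij_betw (\<lambda>(k, l). k ^ a * l ^ b) {(k, l). k > 0 \<and> squarefree l} (gen_squarefull a b)"
proof (rule bij_betwI')
  have inj: "k = k' \<and> l = l'"
    if k: "k > 0" "k' > 0" and l: "squarefree l" "squarefree l'" and eq: "k ^ a * l ^ b = k' ^ a * l' ^ b"
    for k l k' l' :: nat
  proof -
  have ll: "l > 0" "l' > 0"
    using l by (auto intro: Nat.gr0I)
  have *: "a * multiplicity p k + (if p dvd l then b else 0) = a * multiplicity p k' + (if p dvd l' then b else 0)"
    if "prime p" for p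
    using arg_cong[OF eq, of "multiplicity p"] that k l by (simp only: multiplicity_squarefree_power_product)
  have "(a * multiplicity p k + (if p dvd l then b else 0)) mod a = (if p dvd l then b else 0)" for p k l :: nat
    using ab by auto
  from this[of _ k l] this[of _ k' l'] have dvd: "p dvd l \<longleftrightarrow> p dvd l'" if "prime p" for p
    using *[OF that] ab by (metis less_numeral_extra(3))
  have mk: "multiplicity p k = multiplicity p k'" if "prime p" for p
    using *[OF that] dvd[OF that] ab by auto
  have "k = k'"
    by (rule multiplicity_eq_nat[OF k mk])
  moreover have "l ^ b = l' ^ b"
    using eq k \<open>k = k'\<close> by simp
  then have "l = l'"
    using ab by (simp add: power_eq_iff_eq_base)
  ultimately show "k = k' \<and> l = l'" by simp
  qed
  fix p q :: "nat \<times> nat" assume "p \<in> {(k, l). k > 0 \<and> squarefree l}" "q \<in> {(k, l). k > 0 \<and> squarefree (l::nat)}"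
  then show "((case p of (k, l) \<Rightarrow> k ^ a * l ^ b) = (case q of (k, l) \<Rightarrow> k ^ a * l ^ b)) = (p = q)"
    by (cases p; cases q) (use inj in auto)
next
  fix p :: "nat \<times> nat" assume "p \<in> {(k, l). k > 0 \<and> squarefree (l::nat)}"
  then obtain k l :: nat where p: "p = (k, l)" and k: "k > 0" and l: "squarefree l"
    by auto
  have "l > 0" using l by (auto intro: Nat.gr0I)
  then have "k ^ a * l ^ b > 0" using k by simp
  moreover have "a dvd multiplicity p (k ^ a * l ^ b) \<or> (\<exists>t. multiplicity p (k ^ a * l ^ b) = a * t + b)"
    if "prime p" for p
    using multiplicity_squarefree_power_product[OF that k l, of a b] by auto
  ultimately show "(case p of (k, l) \<Rightarrow> k ^ a * l ^ b) \<in> gen_squarefull a b"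
    by (auto simp: gen_squarefull_def p)
next
  fix n assume n: "n \<in> gen_squarefull a b"
  let ?P = "prime_factors n"
  \<comment> \<open>The preimage of \<open>n\<close>: \<open>k\<close> takes the quotients of the
    exponents by \<open>a\<close>, which is \<open>t\<close> for an exponent
    \<open>a * t + b\<close> because b < a; \<open>l\<close> collects the primes whose exponent is
    not a multiple of \<open>a\<close>.\<close>
  define k where "k = (\<Prod>p\<in>?P. p ^ (multiplicity p n div a))"
  define l where "l = (\<Prod>p\<in>?P. if a dvd multiplicity p n then 1 else p)"
  have n0: "n > 0" using n by (simp add: gen_squarefull_def)
  have "k > 0"
    unfolding k_def by (intro prod_pos zero_less_power prime_gt_0_nat) (rule in_prime_factors_imp_prime)
  moreover have "squarefree l"
    unfolding l_def
  proof (rule squarefree_prod_coprime)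
    fix p q assume "p \<in> ?P" "q \<in> ?P" "p \<noteq> q"
    then show "coprime (if a dvd multiplicity p n then 1 else p) (if a dvd multiplicity q n then 1 else q)"
      using primes_coprime[of p q] by (simp add: in_prime_factors_iff)
  next
    fix p assume "p \<in> ?P"
    then show "squarefree (if a dvd multiplicity p n then 1 else p)"
      using squarefree_prime[of p] by (simp add: in_prime_factors_iff)
  qed
  moreover have "k ^ a * l ^ b = n"
  proof -
    have "k ^ a * l ^ b = (\<Prod>p\<in>?P. (p ^ (multiplicity p n div a)) ^ a * (if a dvd multiplicity p n then 1 else p) ^ b)"
      by (simp add: k_def l_def prod_power_distrib prod.distrib)
    also have "\<dots> = (\<Prod>p\<in>?P. p ^ multiplicity p n)"
    proof (rule prod.cong)
      fix p assume p: "p \<in> ?P"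
      show "(p ^ (multiplicity p n div a)) ^ a * (if a dvd multiplicity p n then 1 else p) ^ b = p ^ multiplicity p n"
      proof (cases "a dvd multiplicity p n")
        case True
        then show ?thesis by (simp flip: power_mult)
      next
        case False
        then obtain t where t: "multiplicity p n = a * t + b"
          using n p unfolding gen_squarefull_def by blast
        then have "multiplicity p n div a = t"
          using ab by simp
        then show ?thesis
          using False by (simp add: power_add power_mult[symmetric] mult.commute t)
      qed
    qed auto
    also have "\<dots> = n"
      using n0 by (subst prod_prime_factors) auto
    finally show ?thesis .
  qed
  ultimately show "\<exists>p\<in>{(k, l). k > 0 \<and> squarefree l}. n = (case p of (k, l) \<Rightarrow> k ^ a * l ^ b)"
    by (intro bexI[of _ "(k, l)"]) auto
qed

section \<open>Counting pairs and triples with weighted product at most x\<close>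

lemma le_of_power_product_le:
  fixes i j :: nat
  assumes "a > 0" "i > 0" "j > 0" "real (i ^ a * j) \<le> x"
  shows "i \<le> nat \<lfloor>x\<rfloor>" "j \<le> nat \<lfloor>x\<rfloor>"
proof -
  have i: "i \<le> i ^ a"
    using assms self_le_power[of i a] by simp
  have "i \<le> i ^ a * j" "j \<le> i ^ a * j"
    using assms i order_trans[OF i, of "i ^ a * j"] by auto
  then have "real i \<le> x" "real j \<le> x"
    using assms(4) by (meson of_nat_le_iff order_trans)+
  then show "i \<le> nat \<lfloor>x\<rfloor>" "j \<le> nat \<lfloor>x\<rfloor>"
    by (simp_all add: le_nat_floor)
qed

lemma finite_power_pairs:
  assumes "a > 0" "b > 0"
  shows "finite {(i, j). 0 < i \<and> 0 < j \<and> real (i ^ a * j ^ b) \<le> x}"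
proof (rule finite_subset)
  show "{(i, j). 0 < i \<and> 0 < j \<and> real (i ^ a * j ^ b) \<le> x} \<subseteq> {..nat \<lfloor>x\<rfloor>} \<times> {..nat \<lfloor>x\<rfloor>}"
  proof clarify
    fix i j :: nat assume *: "0 < i" "0 < j" "real (i ^ a * j ^ b) \<le> x"
    have "real (j ^ b * i ^ a) \<le> x"
      using * by (simp add: mult.commute)
    with * assms show "i \<in> {..nat \<lfloor>x\<rfloor>} \<and> j \<in> {..nat \<lfloor>x\<rfloor>}"
      using le_of_power_product_le(1)[of a i "j ^ b" x] le_of_power_product_le(1)[of b j "i ^ a" x] by auto
  qed
qed auto

lemma finite_power_triples:
  assumes "a > 0" "b > 0"
  shows "finite {(i, j, m). 0 < i \<and> 0 < j \<and> 0 < m \<and> real (i ^ a * j ^ b * m ^ (2 * b)) \<le> x}"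
proof (rule finite_subset)
  show "{(i, j, m). 0 < i \<and> 0 < j \<and> 0 < m \<and> real (i ^ a * j ^ b * m ^ (2 * b)) \<le> x} \<subseteq>
      {..nat \<lfloor>x\<rfloor>} \<times> {..nat \<lfloor>x\<rfloor>} \<times> {..nat \<lfloor>x\<rfloor>}"
  proof clarify
    fix i j m :: nat assume *: "0 < i" "0 < j" "0 < m" "real (i ^ a * j ^ b * m ^ (2 * b)) \<le> x"
    have "real (i ^ a * (j ^ b * m ^ (2 * b))) \<le> x" "real (j ^ b * (i ^ a * m ^ (2 * b))) \<le> x"
      "real (m ^ (2 * b) * (i ^ a * j ^ b)) \<le> x"
      using * by (simp_all add: mult_ac)
    with * assms show "i \<in> {..nat \<lfloor>x\<rfloor>} \<and> (j, m) \<in> {..nat \<lfloor>x\<rfloor>} \<times> {..nat \<lfloor>x\<rfloor>}"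
      using le_of_power_product_le(1)[of a i "j ^ b * m ^ (2 * b)" x]
        le_of_power_product_le(1)[of b j "i ^ a * m ^ (2 * b)" x]
        le_of_power_product_le(1)[of "2 * b" m "i ^ a * j ^ b" x] by auto
  qed
qed auto

text \<open>Turns the summatory function inside \<open>divisor_error\<close> into a lattice point
  count, the form in which it appears once \<open>m\<close> is fixed in the triple sum.\<close>

lemma sum_gen_divisor:
  assumes "a > 0" "b > 0"
  shows "(\<Sum>n | 0 < n \<and> real n \<le> x. gen_divisor a b n) = card {(i, j). 0 < i \<and> 0 < j \<and> real (i ^ a * j ^ b) \<le> x}"
proof -
  let ?f = "\<lambda>n. {(i, j). 0 < i \<and> 0 < j \<and> i ^ a * j ^ b = n}"
  let ?A = "{n. 0 < n \<and> real n \<le> x}"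
  have fin: "finite ?A"
    by (rule finite_subset[of _ "{..nat \<lfloor>x\<rfloor>}"]) (auto simp: le_nat_floor)
  have U: "{(i, j). 0 < i \<and> 0 < j \<and> real (i ^ a * j ^ b) \<le> x} = (\<Union>n\<in>?A. ?f n)"
    by auto
  have "finite (?f n)" if "n \<in> ?A" for n
    by (rule finite_subset[OF _ finite_power_pairs[OF assms, of x]]) (use that in auto)
  then have "card (\<Union>n\<in>?A. ?f n) = (\<Sum>n\<in>?A. card (?f n))"
    using fin by (intro card_UN_disjoint) auto
  then show ?thesis
    unfolding U gen_divisor_def by (simp add: conj_commute)
qed

text \<open>Writing l = j m^2 for each \<open>m\<close> whose square divides \<open>l\<close> turns
  k^a l^b into k^a j^b m^(2b); this is the origin of the exponent 2b.\<close>

lemma sum_indicator_gen_squarefull: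
  fixes x :: real
  assumes ab: "0 < b" "b < a"
  shows "(\<Sum>n | 0 < n \<and> real n \<le> x. indicator (gen_squarefull a b) n) =
     (\<Sum>(i, j, m) | 0 < i \<and> 0 < j \<and> 0 < m \<and> real (i ^ a * j ^ b * m ^ (2 * b)) \<le> x. mobius m)"
proof -
  let ?A = "{n. 0 < n \<and> real n \<le> x}"
  let ?g = "\<lambda>(k, l). k ^ a * l ^ b"
  let ?L = "{(k, l). 0 < k \<and> 0 < l \<and> real (k ^ a * l ^ b) \<le> x}"
  let ?T = "{(i, j, m). 0 < i \<and> 0 < j \<and> 0 < m \<and> real (i ^ a * j ^ b * m ^ (2 * b)) \<le> x}"
  have fin: "finite ?A"
    by (rule finite_subset[of _ "{..nat \<lfloor>x\<rfloor>}"]) (auto simp: le_nat_floor)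
  have finL: "finite ?L"
    using ab by (intro finite_power_pairs) auto
  have bij: "bij_betw ?g {(k, l). k > 0 \<and> squarefree l} (gen_squarefull a b)"
    by (rule bij_betw_gen_squarefull[OF ab])
  have bij': "bij_betw ?g {(k, l)\<in>?L. squarefree l} (gen_squarefull a b \<inter> ?A)"
  proof (rule bij_betw_subset[OF bij])
    show "?g ` {(k, l)\<in>?L. squarefree l} = gen_squarefull a b \<inter> ?A"
    proof -
      have "gen_squarefull a b \<inter> ?A = ?g ` {(k, l). k > 0 \<and> squarefree l} \<inter> ?A"
        using bij by (simp add: bij_betw_def)
      also have "\<dots> = ?g ` {(k, l)\<in>?L. squarefree l}"
        by (auto intro!: image_eqI[of _ _ "(_, _)"] intro: Nat.gr0I)
      finally show ?thesis by simp
    qed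
  qed auto
  have "(\<Sum>n\<in>?A. indicator (gen_squarefull a b) n :: complex) = (\<Sum>n\<in>gen_squarefull a b \<inter> ?A. 1)"
    using fin by (simp add: indicator_def sum.If_cases Int_commute)
  also have "\<dots> = (\<Sum>(k, l)\<in>{(k, l)\<in>?L. squarefree l}. 1)"
    using sum.reindex_bij_betw[OF bij', of "\<lambda>_. 1 :: complex"] by (simp add: case_prod_unfold)
  also have "\<dots> = (\<Sum>(k, l)\<in>?L. if squarefree l then 1 else 0)"
    using finL by (intro sum.mono_neutral_cong_left) (auto split: if_splits)
  also have "\<dots> = (\<Sum>p\<in>?L. \<Sum>m | m ^ 2 dvd snd p. mobius m)"
    by (intro sum.cong) (auto simp: sum_mobius_square_dvd)
  also have "\<dots> = (\<Sum>(p, m)\<in>(SIGMA p:?L. {m. m ^ 2 dvd snd p}). mobius m)"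
    using finL
  proof (intro sum.Sigma ballI)
    fix p assume "p \<in> ?L"
    then have "snd p > 0" by auto
    then show "finite {m. m ^ 2 dvd snd p}"
      by (intro finite_subset[OF _ finite_divisors_nat[of "snd p"]]) (auto simp: power2_eq_square dest: dvd_mult_left)
  qed
  also have "\<dots> = (\<Sum>(i, j, m)\<in>?T. mobius m)"
  proof -
    \<comment> \<open>\<open>I\<close> inserts l = j m^2 and \<open>J\<close> divides the square out
      again; the division is exact on the index set.\<close>
    define I :: "nat \<times> nat \<times> nat \<Rightarrow> (nat \<times> nat) \<times> nat" where "I = (\<lambda>(i, j, m). ((i, j * m ^ 2), m))"
    define J :: "(nat \<times> nat) \<times> nat \<Rightarrow> nat \<times> nat \<times> nat" where "J = (\<lambda>((k, l), m). (k, l div m ^ 2, m))"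
    show ?thesis
    proof (rule sum.reindex_bij_witness[of _ I J])
      fix q assume q: "q \<in> (SIGMA p:?L. {m. m ^ 2 dvd snd p})"
      obtain k l m where qq: "q = ((k, l), m)"
        by (cases q) auto
      obtain j where j: "l = m ^ 2 * j"
        using q unfolding qq by auto
      have m: "m > 0" "j > 0"
        using q unfolding qq j by auto
      show "I (J q) = q"
        using m by (simp add: I_def J_def qq j mult.commute)
      have "k ^ a * (m ^ 2 * j) ^ b = k ^ a * j ^ b * m ^ (2 * b)"
        by (simp add: power_mult_distrib power_mult)
      then have "real (k ^ a * j ^ b * m ^ (2 * b)) \<le> x" "k > 0"
        using q unfolding qq j by (simp_all only: mem_Sigma_iff mem_Collect_eq prod.case)
      then show "J q \<in> ?T"
        using m by (simp add: J_def qq j)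
      show "(case J q of (i, j, m) \<Rightarrow> mobius m) = (case q of (p, m) \<Rightarrow> mobius m)"
        by (simp add: J_def qq)
    next
      fix t assume t: "t \<in> ?T"
      obtain i j m where tt: "t = (i, j, m)"
        by (cases t) auto
      show "J (I t) = t"
        using t by (simp add: I_def J_def tt)
      have "i ^ a * (j * m ^ 2) ^ b = i ^ a * j ^ b * m ^ (2 * b)"
        by (simp add: power_mult_distrib power_mult)
      then have "real (i ^ a * (j * m ^ 2) ^ b) \<le> x"
        using t unfolding tt by (simp only: mem_Collect_eq prod.case)
      then show "I t \<in> (SIGMA p:?L. {m. m ^ 2 dvd snd p})"
        using t by (simp add: I_def tt)
    qed
  qed
  finally show ?thesis .
qed

section \<open>Dirichlet series of the zeta function\<close>

lemma abs_summable_on_complex: "(f has_sum (S::complex)) A \<Longrightarrow> (\<lambda>x. norm (f x)) summable_on A"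
  using has_sum_imp_summable summable_on_iff_abs_summable_on_complex by blast

text \<open>\<open>has_sum\<close> is unconditional summation, which for complex values amounts to
  absolute summability. So the norms of the product family are summable, and this licenses
  evaluating its sum as an iterated sum.\<close>

lemma has_sum_mult_Times:
  fixes f :: "'a \<Rightarrow> complex" and g :: "'b \<Rightarrow> complex"
  assumes f: "(f has_sum F) A" and g: "(g has_sum G) B"
  shows "((\<lambda>(x, y). f x * g y) has_sum F * G) (A \<times> B)"
proof (rule has_sum_SigmaI)
  show "((\<lambda>y. case (x, y) of (x, y) \<Rightarrow> f x * g y) has_sum f x * G) B" for x
    by (simp add: has_sum_cmult_right[OF g])
  show "((\<lambda>x. f x * G) has_sum F * G) A"
    by (rule has_sum_cmult_left[OF f])
  have "(\<lambda>p. norm ((\<lambda>(x, y). f x * g y) p)) summable_on (A \<times> B)"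
    unfolding Infinite_Sum.abs_summable_on_Sigma_iff
    using abs_summable_on_complex[OF f] abs_summable_on_complex[OF g]
    by (auto simp: norm_mult infsum_cmult_right' abs_mult intro!: summable_on_cmult_right summable_on_cmult_left infsum_nonneg)
  then show "(\<lambda>(x, y). f x * g y) summable_on (A \<times> B)"
    by (rule abs_summable_summable)
qed

lemma of_nat_mult_powr:
  "(of_nat (m * k) :: complex) powr s = of_nat m powr s * of_nat k powr s"
proof (cases "m = 0 \<or> k = 0")
  case False
  then have "exp (s * of_real (ln (real m) + ln (real k))) = exp (s * of_real (ln (real m))) * exp (s * of_real (ln (real k)))"
    by (simp add: ring_distribs exp_add)
  moreover have "ln (real (m * k)) = ln (real m) + ln (real k)"
    using False by (simp add: ln_mult)
  ultimately show ?thesis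
    using False Ln_of_nat[of "m * k"] by (simp add: powr_def Ln_of_nat del: of_nat_mult)
qed auto

lemma of_nat_power_powr:
  "(of_nat (m ^ k) :: complex) powr s = of_nat m powr (of_nat k * s)" if "m > 0"
proof -
  have "Ln (of_nat (m ^ k)) = of_nat k * (of_real (ln (real m)) :: complex)"
  proof -
    have "ln (real (m ^ k)) = real k * ln (real m)"
      using that by (simp add: ln_realpow)
    then show ?thesis
      using that Ln_of_nat[of "m ^ k"] by (simp del: of_nat_power)
  qed
  then show ?thesis
    using that by (simp add: powr_def Ln_of_nat mult_ac del: of_nat_power)
qed

lemma norm_of_nat_powr: "n > 0 \<Longrightarrow> norm ((of_nat n :: complex) powr s) = real n powr Re s"
  using norm_of_nat_Suc_powr[of "n - 1" s] by simp

lemma zeta_has_sum: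
  assumes "Re s > 1"
  shows "((\<lambda>n. of_nat n powr (- s)) has_sum zeta s) {1..}"
proof -
  have "summable (\<lambda>n. real n powr (- Re s))"
    using assms by (simp add: summable_real_powr_iff)
  then have "summable (\<lambda>n. real (Suc n) powr (- Re s))"
    by (subst summable_Suc_iff)
  then have "((\<lambda>n. of_nat (Suc n) powr (- s)) has_sum zeta s) UNIV"
    using sums_zeta[OF assms] by (intro norm_summable_imp_has_sum) (simp_all add: norm_of_nat_Suc_powr del: of_nat_Suc)
  moreover have "bij_betw Suc UNIV {1..}"
    by (rule bij_betwI[of _ _ _ "\<lambda>n. n - 1"]) auto
  ultimately show ?thesis
    by (simp only: has_sum_reindex_bij_betw[of Suc UNIV "{1..}" "\<lambda>n. of_nat n powr (- s)"])
qed

lemma summable_on_powr: "x > 1 \<Longrightarrow> (\<lambda>n. real n powr (- x)) summable_on {1..}"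
  using abs_summable_on_complex[OF zeta_has_sum[of "of_real x"]]
  by (subst summable_on_cong[of _ _ "\<lambda>n. norm ((of_nat n :: complex) powr (- of_real x))"]) (auto simp: norm_of_nat_powr)

lemma mobius_summable:
  assumes "Re s > 1"
  shows "(\<lambda>n. norm (mobius n * of_nat n powr (- s))) summable_on {1..}"
proof (rule Infinite_Sum.abs_summable_on_comparison_test)
  show "(\<lambda>n. norm ((of_nat n :: complex) powr (- s))) summable_on {1..}"
    by (rule abs_summable_on_complex[OF zeta_has_sum[OF assms]])
  show "norm (mobius n * of_nat n powr (- s)) \<le> norm ((of_nat n :: complex) powr (- s))" for n
    using mult_right_mono[OF norm_mobius_le] by (simp add: norm_mult)
qed

text \<open>The product of the two absolutely convergent Dirichlet series is regrouped by n = m k;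
  the inner sum of \<open>mobius\<close> over the divisors of n leaves only n = 1. That the product
  is 1 also rules out zeros with Re s > 1.\<close>

lemma mobius_has_sum:
  assumes s: "Re s > 1"
  shows "((\<lambda>n. mobius n * of_nat n powr (- s)) has_sum 1 / zeta s) {1..}" and "zeta s \<noteq> 0"
proof -
  let ?f = "\<lambda>n. mobius n * of_nat n powr (- s)"
  obtain M where M: "(?f has_sum M) {1..}"
    using abs_summable_summable[OF mobius_summable[OF s]] by (auto simp: summable_on_def)
  have "((\<lambda>(m, k). ?f m * of_nat k powr (- s)) has_sum M * zeta s) ({1..} \<times> {1..})"
    by (rule has_sum_mult_Times[OF M zeta_has_sum[OF s]])
  also have "?this \<longleftrightarrow> ((\<lambda>(n, d). mobius d * of_nat n powr (- s)) has_sum M * zeta s) (SIGMA n:{1..}. {d. d dvd n})"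
    by (rule has_sum_reindex_bij_witness[of _ "\<lambda>(n, d). (d, n div d)" "\<lambda>(m, k). (m * k, m)"])
      (auto simp: of_nat_mult_powr dvd_div_eq_0_iff Suc_le_eq intro: Nat.gr0I simp del: of_nat_mult)
  finally have "((\<lambda>n. \<Sum>d | d dvd n. mobius d * of_nat n powr (- s)) has_sum M * zeta s) {1..}"
    by (rule has_sum_SigmaD) (auto intro!: has_sum_finite)
  also have "?this \<longleftrightarrow> ((\<lambda>n::nat. if n = 1 then 1 else 0) has_sum M * zeta s) {1..}"
    by (intro has_sum_cong) (simp add: sum_mobius_dvd flip: sum_distrib_right)
  also have "\<dots> \<longleftrightarrow> ((\<lambda>n. 1) has_sum M * zeta s) {1::nat}"
    by (intro has_sum_cong_neutral) auto
  finally have "M * zeta s = 1"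
    using has_sum_unique[OF has_sum_finite[of "{1::nat}" "\<lambda>_. 1 :: complex"]] by simp
  then show nz: "zeta s \<noteq> 0"
    by auto
  with \<open>M * zeta s = 1\<close> have "M = 1 / zeta s"
    by (simp add: eq_divide_eq)
  with M show "(?f has_sum 1 / zeta s) {1..}"
    by (simp only:)
qed

section \<open>Euler product and the 3-4-1 inequality\<close>

text \<open>Sieving prime by prime: for the next prime \<open>q\<close>, the multiples of
  \<open>q\<close> among the remaining integers are \<open>q\<close> times those integers, so
  removing them subtracts q^(-s) times the same sum and contributes the factor 1 - q^(-s).\<close>

lemma sieved_zeta_has_sum:
  assumes s: "Re s > 1"
  shows "((\<lambda>n. of_nat n powr (- s)) has_sum zeta s * (\<Prod>p | prime p \<and> p \<le> P. 1 - of_nat p powr (- s)))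
           {n. n \<ge> 1 \<and> (\<forall>p. prime p \<and> p \<le> P \<longrightarrow> \<not> p dvd n)}"
proof (induction P)
  case 0
  have "{p. prime p \<and> p \<le> (0::nat)} = {}"
    by auto
  moreover have "{n. n \<ge> 1 \<and> (\<forall>p. prime p \<and> p \<le> 0 \<longrightarrow> \<not> p dvd n)} = {1::nat..}"
    by auto
  ultimately show ?case
    using zeta_has_sum[OF s] by simp
next
  case (Suc P)
  let ?S = "\<lambda>P. {n::nat. n \<ge> 1 \<and> (\<forall>p. prime p \<and> p \<le> P \<longrightarrow> \<not> p dvd n)}"
  let ?Q = "\<lambda>P. {p::nat. prime p \<and> p \<le> P}"
  let ?f = "\<lambda>n. (of_nat n :: complex) powr (- s)"
  define X where "X = zeta s * (\<Prod>p\<in>?Q P. 1 - ?f p)"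
  show ?case
  proof (cases "prime (Suc P)")
    case False
    then have "p \<le> Suc P \<longleftrightarrow> p \<le> P" if "prime p" for p
      using that le_Suc_eq by auto
    then have "?S (Suc P) = ?S P" "?Q (Suc P) = ?Q P"
      by auto
    then show ?thesis
      using Suc by simp
  next
    case True
    define q where "q = Suc P"
    have q: "prime q" "q > 0" using True by (auto simp: q_def)
    have im: "(*) q ` ?S P \<subseteq> ?S P"
    proof clarify
      fix n assume n: "n \<ge> 1" "\<forall>p. prime p \<and> p \<le> P \<longrightarrow> \<not> p dvd n"
      have "\<not> p dvd q * n" if "prime p" "p \<le> P" for p
      proof
        assume "p dvd q * n"
        then have "p dvd q"
          using n that by (auto simp: prime_dvd_mult_iff)
        then have "p = q"
          using that q primes_dvd_imp_eq by blast
        then show False using that by (simp add: q_def)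
      qed
      then show "q * n \<ge> 1 \<and> (\<forall>p. prime p \<and> p \<le> P \<longrightarrow> \<not> p dvd q * n)"
        using n q by auto
    qed
    have diff: "?S P - (*) q ` ?S P = ?S (Suc P)"
    proof (intro equalityI subsetI)
      fix n assume n: "n \<in> ?S P - (*) q ` ?S P"
      have "\<not> q dvd n"
      proof
        assume "q dvd n"
        then obtain k where k: "n = q * k" by (elim dvdE)
        have "k \<in> ?S P"
          using n k by auto
        then show False
          using n k by blast
      qed
      then show "n \<in> ?S (Suc P)"
        using n by (auto simp: le_Suc_eq q_def)
    next
      fix n assume n: "n \<in> ?S (Suc P)"
      then have "\<not> q dvd n"
        using q by (auto simp: q_def)
      then show "n \<in> ?S P - (*) q ` ?S P"
        using n by auto
    qed
    have inj: "inj_on ((*) q) (?S P)"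
      using q by (auto simp: inj_on_def)
    have "((\<lambda>n. ?f q * ?f n) has_sum ?f q * X) (?S P)"
      unfolding X_def by (rule has_sum_cmult_right[OF Suc])
    then have "(?f has_sum ?f q * X) ((*) q ` ?S P)"
      by (subst has_sum_reindex[OF inj]) (simp add: o_def of_nat_mult_powr del: of_nat_mult)
    from has_sum_Diff[OF Suc this im]
    have "(?f has_sum X - ?f q * X) (?S (Suc P))"
      unfolding diff X_def .
    moreover have "?Q (Suc P) = insert q (?Q P)"
      using q by (auto simp: q_def le_Suc_eq)
    then have prod: "(\<Prod>p\<in>?Q (Suc P). 1 - ?f p) = (1 - ?f q) * (\<Prod>p\<in>?Q P. 1 - ?f p)"
      by (simp add: q_def)
    have "zeta s * (\<Prod>p\<in>?Q (Suc P). 1 - ?f p) = X - ?f q * X"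
      unfolding prod X_def by (simp add: algebra_simps)
    ultimately show ?thesis by simp
  qed
qed

text \<open>What survives the sieve up to \<open>P\<close> is 1 and integers larger than
  \<open>P\<close>, so the distance to 1 is at most a tail of the series of norms. Keeping
  \<open>zeta s\<close> as a factor needs neither an infinite product nor a division.\<close>

lemma euler_product_zeta:
  assumes s: "Re s > 1"
  shows "(\<lambda>P. zeta s * (\<Prod>p | prime p \<and> p \<le> P. 1 - of_nat p powr (- s))) \<longlonglongrightarrow> 1"
proof -
  let ?f = "\<lambda>n. (of_nat n :: complex) powr (- s)"
  let ?S = "\<lambda>P. {n::nat. n \<ge> 1 \<and> (\<forall>p. prime p \<and> p \<le> P \<longrightarrow> \<not> p dvd n)}"
  define Z where "Z = (\<lambda>P. zeta s * (\<Prod>p | prime p \<and> p \<le> P. 1 - ?f p))"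
  define W where "W = (\<Sum>\<^sub>\<infinity>n\<in>{1..}. norm (?f n))"
  have abs: "((\<lambda>n. norm (?f n)) has_sum W) {1..}"
    unfolding W_def using abs_summable_on_complex[OF zeta_has_sum[OF s]] by simp
  have bd: "norm (Z P - 1) \<le> W - (\<Sum>n\<in>{1..<Suc P}. norm (?f n))" if "P \<ge> 1" for P
  proof -
    have in1: "{1} \<subseteq> ?S P"
      by auto
    have "(?f has_sum 1) {1}"
      using has_sum_finite[of "{1::nat}" ?f] by simp
    from has_sum_Diff[OF sieved_zeta_has_sum[OF s] this in1]
    have Z: "(?f has_sum Z P - 1) (?S P - {1})"
      unfolding Z_def .
    have sub: "?S P - {1} \<subseteq> {1..} - {1..<Suc P}"
    proof
      fix n assume "n \<in> ?S P - {1}"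
      then have n: "n \<ge> 1" "\<forall>p. prime p \<and> p \<le> P \<longrightarrow> \<not> p dvd n" "n \<noteq> 1"
        by auto
      obtain p where p: "prime p" "p dvd n"
        using prime_factor_nat[OF n(3)] by blast
      have "\<not> p \<le> P"
        using n(2) p by blast
      moreover have "p \<le> n"
        using p n(1) by (intro dvd_imp_le) auto
      ultimately show "n \<in> {1..} - {1..<Suc P}"
        using n by simp
    qed
    have tail: "((\<lambda>n. norm (?f n)) has_sum W - (\<Sum>n\<in>{1..<Suc P}. norm (?f n))) ({1..} - {1..<Suc P})"
      by (rule has_sum_Diff[OF abs has_sum_finite]) auto
    have nS: "(\<lambda>n. norm (?f n)) summable_on (?S P - {1})"
      by (rule abs_summable_on_complex[OF Z])
    have "norm (Z P - 1) \<le> (\<Sum>\<^sub>\<infinity>n\<in>?S P - {1}. norm (?f n))"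
      by (rule norm_has_sum_bound[OF has_sum_infsum[OF nS] Z])
    also have "\<dots> \<le> W - (\<Sum>n\<in>{1..<Suc P}. norm (?f n))"
      by (rule has_sum_mono2[OF has_sum_infsum[OF nS] tail sub]) auto
    finally show ?thesis .
  qed
  have "(\<lambda>P. \<Sum>n\<in>{1..<Suc P}. norm (?f n)) \<longlonglongrightarrow> W"
  proof -
    have "((\<lambda>n. norm (?f n)) has_sum 0 + W) ({0} \<union> {1..})"
      by (intro has_sum_Un_disjoint abs) (use has_sum_finite[of "{0::nat}" "\<lambda>n. norm (?f n)"] in auto)
    moreover have "{0} \<union> {1..} = (UNIV :: nat set)"
      by auto
    ultimately have "(\<lambda>n. norm (?f n)) sums W"
      by (intro has_sum_imp_sums) simp
    then have "(\<lambda>P. \<Sum>n<Suc P. norm (?f n)) \<longlonglongrightarrow> W"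
      unfolding sums_def by (rule LIMSEQ_Suc)
    moreover have "(\<Sum>n<Suc P. norm (?f n)) = (\<Sum>n\<in>{1..<Suc P}. norm (?f n))" for P
      by (intro sum.mono_neutral_right) auto
    ultimately show ?thesis by simp
  qed
  then have "(\<lambda>P. W - (\<Sum>n\<in>{1..<Suc P}. norm (?f n))) \<longlonglongrightarrow> W - W"
    by (intro tendsto_intros)
  then have lim0: "(\<lambda>P. W - (\<Sum>n\<in>{1..<Suc P}. norm (?f n))) \<longlonglongrightarrow> 0"
    by simp
  have "\<forall>\<^sub>F P in sequentially. norm (Z P - 1) \<le> W - (\<Sum>n\<in>{1..<Suc P}. norm (?f n))"
    using eventually_ge_at_top[of 1] by eventually_elim (rule bd)
  then have "(\<lambda>P. Z P - 1) \<longlonglongrightarrow> 0"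
    by (rule Lim_null_comparison[OF _ lim0])
  then show ?thesis
    unfolding Z_def by (rule LIM_zero_cancel)
qed

text \<open>A single Euler factor of the 3-4-1 inequality, to be used with r = p^(-sigma) and w =
  p^(-i t). The logarithm of |1 - u| is the series of -Re (u^n) / n, taken at u = r, r w and r
  w^2.\<close>

lemma three_four_one_factor:
  fixes r :: real and w :: complex
  assumes r: "0 < r" "r < 1" and w: "norm w = 1"
  shows "norm (1 - of_real r :: complex) ^ 3 * norm (1 - of_real r * w) ^ 4 * norm (1 - of_real r * w ^ 2) \<le> 1"
proof -
  let ?P = "norm (1 - of_real r :: complex) ^ 3 * norm (1 - of_real r * w) ^ 4 * norm (1 - of_real r * w ^ 2)"
  let ?L = "3 * ln (norm (1 - of_real r :: complex)) + 4 * ln (norm (1 - of_real r * w)) + ln (norm (1 - of_real r * w ^ 2))"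
  let ?t = "\<lambda>n. 3 * (- Re (of_real r ^ n) / real n) + 4 * (- Re ((of_real r * w) ^ n) / real n) + (- Re ((of_real r * w ^ 2) ^ n) / real n)"
  have S: "(\<lambda>n. - Re (u ^ n) / real n) sums ln (norm (1 - u))" if u: "norm u < 1" for u :: complex
  proof -
    have "(\<lambda>n. - ((- (- u)) ^ n) / of_nat n) sums ln (1 + - u)"
      by (rule Ln_series') (use u in auto)
    then have "(\<lambda>n. Re (- ((- (- u)) ^ n) / of_nat n)) sums Re (ln (1 + - u))"
      by (rule sums_Re)
    moreover have "1 - u \<noteq> 0"
      using u by auto
    ultimately show ?thesis
      by (simp add: Re_Ln)
  qed
  have n1: "norm (of_real r :: complex) < 1" "norm (of_real r * w) < 1" "norm (of_real r * w ^ 2) < 1"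
    using r w by (auto simp: norm_mult norm_power)
  have nz: "norm (1 - u) > 0" if "norm u < 1" for u :: complex
    using that by auto
  have "?L \<le> 0"
  proof (rule sums_le[OF _ _ sums_zero])
    show "?t
       sums ?L"
      by (intro sums_add sums_mult S n1)
    fix n
    txt \<open>This is \<open>3 + 4 cos \<phi> + cos (2 \<phi>) = 2 (1 + cos \<phi>)\<^sup>2 \<ge> 0\<close> with \<open>c = cos \<phi>\<close>.\<close>
    define c where "c = Re (w ^ n)"
    have "Re (w ^ n) ^ 2 + Im (w ^ n) ^ 2 = 1"
      using w by (simp add: norm_power flip: cmod_power2)
    moreover have "(w ^ 2) ^ n = (w ^ n) ^ 2"
      by (metis power_mult mult.commute)
    ultimately have "Re ((w ^ 2) ^ n) = 2 * c ^ 2 - 1"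
      by (simp add: c_def Re_power2)
    then have "Re ((of_real r * w ^ 2) ^ n) = r ^ n * (2 * c ^ 2 - 1)"
      by (simp only: power_mult_distrib of_real_power[symmetric] Re_complex_of_real Im_complex_of_real times_complex.sel)
    moreover have "Re ((of_real r * w) ^ n) = r ^ n * c" "Re (of_real r ^ n) = r ^ n"
      by (simp_all only: power_mult_distrib of_real_power[symmetric] Re_complex_of_real Im_complex_of_real times_complex.sel c_def)
    ultimately have "3 * Re (of_real r ^ n) + 4 * Re ((of_real r * w) ^ n) + Re ((of_real r * w ^ 2) ^ n) = r ^ n * (2 * (1 + c) ^ 2)"
      by (simp only:) (simp add: power2_eq_square algebra_simps)
    then have "?t n
       = - (r ^ n * (2 * (1 + c) ^ 2)) / real n"
      by (simp add: field_simps flip: add_divide_distrib)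
    also have "\<dots> \<le> 0"
      using r by (simp add: divide_nonneg_nonneg)
    finally show "?t n \<le> 0" .
  qed
  moreover have "ln ?P
     = ?L"
    using n1[THEN nz] by (simp add: ln_mult ln_realpow)
  moreover have "?P > 0"
    using n1[THEN nz] by (intro mult_pos_pos zero_less_power)
  ultimately show ?thesis
    by (metis ln_le_zero_iff)
qed

text \<open>The inequality for single primes bounds the combined finite Euler products by 1.
  Multiplied by the zeta values they tend to 1 as the range of primes grows, which leaves the lower
  bound.\<close>

lemma three_four_one_zeta:
  assumes \<sigma>: "\<sigma> > 1"
  shows "1 \<le> norm (zeta (of_real \<sigma>)) ^ 3 * norm (zeta (Complex \<sigma> t)) ^ 4 * norm (zeta (Complex \<sigma> (2 * t)))"
proof -
  define s0 s1 s2 where "s0 = complex_of_real \<sigma>" and "s1 = Complex \<sigma> t" and "s2 = Complex \<sigma> (2 * t)"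
  let ?p = "\<lambda>s P. \<Prod>p | prime p \<and> p \<le> P. 1 - of_nat p powr (- s) :: complex"
  define L where "L = norm (zeta s0) ^ 3 * norm (zeta s1) ^ 4 * norm (zeta s2)"
  have lim: "(\<lambda>P. zeta s * ?p s P) \<longlonglongrightarrow> 1" if "s \<in> {s0, s1, s2}" for s
    using that \<sigma> by (intro euler_product_zeta) (auto simp: s0_def s1_def s2_def)
  have "(\<lambda>P. norm (zeta s0 * ?p s0 P) ^ 3 * norm (zeta s1 * ?p s1 P) ^ 4 * norm (zeta s2 * ?p s2 P)) \<longlonglongrightarrow> norm (1::complex) ^ 3 * norm (1::complex) ^ 4 * norm (1::complex)"
    by (intro tendsto_intros lim) auto
  moreover have "norm (zeta s0 * ?p s0 P) ^ 3 * norm (zeta s1 * ?p s1 P) ^ 4 * norm (zeta s2 * ?p s2 P) \<le> L" for P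
  proof -
    have "norm (?p s0 P) ^ 3 * norm (?p s1 P) ^ 4 * norm (?p s2 P) =
       (\<Prod>p | prime p \<and> p \<le> P. norm (1 - of_nat p powr (- s0) :: complex) ^ 3 * norm (1 - of_nat p powr (- s1) :: complex) ^ 4 * norm (1 - of_nat p powr (- s2) :: complex))"
      by (simp only: prod_norm[symmetric] prod_power_distrib prod.distrib)
    also have "\<dots> \<le> 1"
    proof (rule prod_le_1, rule conjI)
      fix p assume "p \<in> {p. prime p \<and> p \<le> P}"
      then have p: "prime p" "p > 1" using prime_gt_1_nat by auto
      define r where "r = real p powr (- \<sigma>)"
      define w where "w = (of_nat p :: complex) powr (- (\<i> * of_real t))"
      have "(of_real (real p) :: complex) powr of_real (- \<sigma>) = of_real (real p powr (- \<sigma>))"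
        by (rule powr_of_real) auto
      then have e0: "of_nat p powr (- s0) = (of_real r :: complex)"
        by (simp add: r_def s0_def)
      moreover have e1: "(of_nat p :: complex) powr (- s1) = of_real r * w"
      proof -
        have "- s1 = - s0 + (- (\<i> * of_real t))"
          by (simp add: s1_def s0_def complex_eq_iff)
        then show ?thesis
          by (simp only: w_def powr_add e0)
      qed
      moreover have "(of_nat p :: complex) powr (- s2) = of_real r * w ^ 2"
      proof -
        have "- s2 = - s1 + (- (\<i> * of_real t))"
          by (simp add: s1_def s2_def complex_eq_iff)
        then show ?thesis
          by (simp only: w_def[symmetric] powr_add e1) (simp add: power2_eq_square)
      qed
      moreover have "norm w = 1"
        using p by (simp add: w_def norm_of_nat_powr)
      moreover have "0 < r" "r < 1"
        using p \<sigma> by (auto simp: r_def powr_less_one)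
      ultimately show "norm (1 - of_nat p powr (- s0) :: complex) ^ 3 * norm (1 - of_nat p powr (- s1) :: complex) ^ 4 * norm (1 - of_nat p powr (- s2) :: complex) \<le> 1"
        using three_four_one_factor[of r w] by simp
    qed auto
    finally have "norm (?p s0 P) ^ 3 * norm (?p s1 P) ^ 4 * norm (?p s2 P) \<le> 1" .
    then have "L * (norm (?p s0 P) ^ 3 * norm (?p s1 P) ^ 4 * norm (?p s2 P)) \<le> L * 1"
      by (rule mult_left_mono) (simp add: L_def)
    then show ?thesis
      by (simp add: L_def norm_mult power_mult_distrib mult_ac)
  qed
  ultimately have "norm (1::complex) ^ 3 * norm (1::complex) ^ 4 * norm (1::complex) \<le> L"
    by (intro LIMSEQ_le_const2) auto
  then show ?thesis
    by (simp add: L_def s0_def s1_def s2_def)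
qed

text \<open>Since \<open>zeta 1\<close> is unspecified, the values of \<open>(s - 1) \<zeta>(s)\<close> and \<open>1 / \<zeta>(s)\<close> at 1 are the limits.\<close>

definition zeta_reg :: "complex \<Rightarrow> complex" where
  "zeta_reg s = (if s = 1 then 1 else (s - 1) * zeta s)"

definition zeta_inv :: "complex \<Rightarrow> complex" where
  "zeta_inv s = (s - 1) / zeta_reg s"

lemma zeta_inv_eq: "s \<noteq> 1 \<Longrightarrow> zeta_inv s = 1 / zeta s"
  by (simp add: zeta_inv_def zeta_reg_def)

section \<open>The pole at 1 and the absence of zeros with Re s > 1/2\<close>

text \<open>Both claims come from the continuation step with the linear Taylor polynomial: (s - 1)
  zeta(s) is 1 plus the sum of the remainders, originally for Re s > 1 and by continuation for Re s
  > 0. Each remainder is bounded with the factor |s (s - 1)|; this factor is kept in the estimate so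
  that division by s - 1 leaves just the simple pole.\<close>

lemma
  shows holomorphic_zeta_reg: "zeta_reg holomorphic_on {s. Re s > 0}"
    and norm_zeta_reg_le: "\<exists>C>0. \<forall>s. Re s \<ge> 1 / 2 \<longrightarrow> norm (zeta_reg s - 1) \<le> C * norm s * norm (s - 1)"
proof -
  let ?S = "{s. Re s > 1 - 1}"
  define R where "R = (\<lambda>n s. (of_nat (Suc (Suc n)) :: complex) powr (1 - s) -
              (\<Sum>i\<le>Suc 0. ((1 - s) gchoose i) * of_nat (Suc n) powr (1 - s - of_nat i)))"
  define G where "G = (\<lambda>s. 1 + (\<Sum>n. R n s))"
  have holR: "R n holomorphic_on ?S" for n
    unfolding R_def gbinomial_prod_rev by (intro holomorphic_intros) (simp_all del: of_nat_Suc)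
  have bound: "norm (R n s) \<le> norm (\<Prod>i<Suc (Suc 0). 1 - s - of_nat i) / fact (Suc 0) * real (Suc n) powr (- (Re s + 1))"
    if "s \<in> ?S" for n s
  proof -
    have "Re (1 - s) \<le> real (Suc 0) + 1" and e: "Re (1 - s) - real (Suc 0) - 1 = - (Re s + 1)"
      using that by simp_all
    from powr_Taylor_remainder[OF this(1), of n, unfolded e] show ?thesis
      unfolding R_def .
  qed
  have cont: "continuous_on ?S (\<lambda>s. norm (\<Prod>i<Suc (Suc 0). 1 - s - of_nat i) / fact (Suc 0))"
    by (intro continuous_intros) auto
  note L = holomorphic_suminf_powr_bound[OF holR cont bound]
  have holG: "G holomorphic_on {s. Re s > 0}"
    unfolding G_def using L(1) by (intro holomorphic_intros) simp
  have G1: "G s = zeta_reg s" if s: "Re s > 1" for s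
  proof -
    have "zeta s = (\<Sum>n. of_nat (Suc n) powr (- s))"
      by (rule sums_unique[OF sums_zeta[OF s]])
    moreover have "s \<noteq> 1" using s by auto
    ultimately show ?thesis
      using zeta_step_identity[OF s, of 0] by (simp add: G_def R_def zeta_reg_def del: of_nat_Suc sum.atMost_Suc)
  qed
  have G2: "G s = zeta_reg s" if s: "Re s > 0" for s
  proof (cases "s = 1")
    case True
    have "R n 1 = 0" for n
      by (simp add: R_def del: of_nat_Suc)
    then show ?thesis
      using True by (simp add: G_def zeta_reg_def)
  next
    case False
    have "G s = (s - 1) * zeta s"
    proof (rule analytic_continuation_open[of "{s. Re s > 1}" "{s. Re s > 0} - {1}" G "\<lambda>s. (s - 1) * zeta s"])
      show "open ({s. Re s > 0} - {1})"
        by (intro open_Diff open_halfspace_Re_gt) auto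
      show "{s. 1 < Re s} \<noteq> {}"
        by (auto intro!: exI[of _ 2])
      show "connected ({s. Re s > 0} - {1 :: complex})"
        by (intro connected_open_delete open_halfspace_Re_gt convex_connected convex_halfspace_Re_gt) simp
      show "G holomorphic_on {s. Re s > 0} - {1}"
        by (rule holomorphic_on_subset[OF holG]) auto
      show "(\<lambda>s. (s - 1) * zeta s) holomorphic_on {s. Re s > 0} - {1}"
        by (intro holomorphic_intros holomorphic_on_subset[OF holomorphic_zeta]) auto
      show "G z = (z - 1) * zeta z" if "z \<in> {s. Re s > 1}" for z
        using G1[of z] that by (auto simp: zeta_reg_def)
    qed (use s False in \<open>auto simp: open_halfspace_Re_gt\<close>)
    then show ?thesis
      using False by (simp add: zeta_reg_def)
  qed
  show "zeta_reg holomorphic_on {s. Re s > 0}"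
    by (rule holomorphic_transform[OF holG]) (use G2 in auto)
  have summ: "summable (\<lambda>n. real (Suc n) powr (- (3 / 2)))"
    by (subst summable_Suc_iff) (simp add: summable_real_powr_iff)
  \<comment> \<open>The exponent 3/2 is that of the remainder bound at Re s = 1/2, the worst
    case.\<close>
  define C where "C = (\<Sum>n. real (Suc n) powr (- (3 / 2)))"
  have "norm (zeta_reg s - 1) \<le> (C + 1) * norm s * norm (s - 1)" if s: "Re s \<ge> 1 / 2" for s
  proof -
    let ?M = "norm (s - 1) * norm s"
    have s': "s \<in> ?S" using s by simp
    have M: "norm (\<Prod>i<Suc (Suc 0). 1 - s - of_nat i) / fact (Suc 0) = ?M"
      by (simp add: norm_mult norm_minus_commute)
    have le: "norm (R n s) \<le> ?M * real (Suc n) powr (- (3 / 2))" for n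
    proof -
      have "norm (R n s) \<le> ?M * real (Suc n) powr (- (Re s + 1))"
        using bound[OF s', of n] unfolding M .
      also have "\<dots> \<le> ?M * real (Suc n) powr (- (3 / 2))"
        using s by (intro mult_left_mono powr_mono) auto
      finally show ?thesis .
    qed
    have "zeta_reg s = G s"
      using G2[of s] s by simp
    then have "zeta_reg s - 1 = (\<Sum>n. R n s)"
      unfolding G_def by simp
    also have "norm (\<Sum>n. R n s) \<le> (\<Sum>n. ?M * real (Suc n) powr (- (3 / 2)))"
      by (rule norm_suminf_le[OF le summable_mult[OF summ]])
    also have "\<dots> = ?M * C"
      unfolding C_def by (rule suminf_mult[OF summ])
    also have "\<dots> \<le> ?M * (C + 1)"
      by (intro mult_left_mono) auto
    finally show ?thesis by (simp add: mult_ac)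
  qed
  moreover have "C + 1 > 0"
    unfolding C_def using suminf_nonneg[OF summ] by simp
  ultimately show "\<exists>C>0. \<forall>s. Re s \<ge> 1 / 2 \<longrightarrow> norm (zeta_reg s - 1) \<le> C * norm s * norm (s - 1)"
    by blast
qed

lemma norm_zeta_le:
  "\<exists>C>0. \<forall>s. Re s \<ge> 1 / 2 \<and> s \<noteq> 1 \<longrightarrow> norm (zeta s) \<le> 1 / norm (s - 1) + C * norm s"
proof -
  obtain C where C: "C > 0" "\<And>s. Re s \<ge> 1 / 2 \<Longrightarrow> norm (zeta_reg s - 1) \<le> C * norm s * norm (s - 1)"
    using norm_zeta_reg_le by blast
  have "norm (zeta s) \<le> 1 / norm (s - 1) + C * norm s" if s: "Re s \<ge> 1 / 2" "s \<noteq> 1" for s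
  proof -
    have "norm (zeta_reg s) \<le> norm (zeta_reg s - 1) + norm (1 :: complex)"
      by norm
    also have "\<dots> \<le> 1 + C * norm s * norm (s - 1)"
      using C(2)[OF s(1)] by simp
    finally have "norm (s - 1) * norm (zeta s) \<le> 1 + C * norm s * norm (s - 1)"
      using s by (simp add: zeta_reg_def norm_mult)
    then have "norm (zeta s) \<le> (1 + C * norm s * norm (s - 1)) / norm (s - 1)"
      using s by (simp add: pos_le_divide_eq mult.commute)
    also have "\<dots> = 1 / norm (s - 1) + C * norm s"
      using s by (simp add: add_divide_distrib)
    finally show ?thesis .
  qed
  with C(1) show ?thesis by blast
qed

text \<open>If zeta vanished at 1 + i t, then for sigma decreasing to 1 the 3-4-1 product would have
  a pole of order 3 against a zero of order at least 4, the last factor being finite as 1 + 2 i t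
  differs from 1. It would tend to 0, although it is at least 1.\<close>

lemma zeta_nonzero_Re_eq_1:
  assumes t: "t \<noteq> 0"
  shows "zeta (Complex 1 t) \<noteq> 0"
proof
  assume z0: "zeta (Complex 1 t) = 0"
  let ?s = "Complex 1 t"
  \<comment> \<open>The 3-4-1 product with convergent factors: three powers of sigma - 1 clear the
    pole and give \<open>zeta_reg\<close>, four are pulled out of the vanishing value as difference
    quotients, and one power is left over.\<close>
  define F where "F = (\<lambda>\<sigma>. norm (zeta_reg (of_real \<sigma>)) ^ 3 * norm ((zeta (Complex \<sigma> t) - zeta ?s) / (Complex \<sigma> t - ?s)) ^ 4
     * norm (zeta (Complex \<sigma> (2 * t))) * (\<sigma> - 1))"
  have ne: "?s \<noteq> 1" "Complex 1 (2 * t) \<noteq> 1"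
    using t by (auto simp: complex_eq_iff)
  have fd: "zeta field_differentiable at s" if "s \<noteq> 1" for s
    using holomorphic_zeta that by (intro holomorphic_on_imp_differentiable_at[of _ "- {1}"]) auto
  obtain D where D: "((\<lambda>z. (zeta z - zeta ?s) / (z - ?s)) \<longlongrightarrow> D) (at ?s)"
    using fd[OF ne(1)] unfolding field_differentiable_def has_field_derivative_iff by blast
  have C: "((\<lambda>\<sigma>. Complex \<sigma> u) \<longlongrightarrow> Complex 1 u) (at_right 1)" for u
    by (intro tendsto_intros)
  have "filterlim (\<lambda>\<sigma>. Complex \<sigma> t) (at ?s) (at_right 1)"
    unfolding filterlim_at using C[of t] eventually_at_right_less[of 1]
    by (auto elim!: eventually_mono)
  from filterlim_compose[OF D this]
  have l1: "((\<lambda>\<sigma>. (zeta (Complex \<sigma> t) - zeta ?s) / (Complex \<sigma> t - ?s)) \<longlongrightarrow> D) (at_right 1)" .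
  have "isCont zeta (Complex 1 (2 * t))"
    by (intro field_differentiable_imp_continuous_at fd ne)
  then have l2: "((\<lambda>\<sigma>. zeta (Complex \<sigma> (2 * t))) \<longlongrightarrow> zeta (Complex 1 (2 * t))) (at_right 1)"
    by (rule isCont_tendsto_compose[OF _ C])
  have "zeta_reg field_differentiable at 1"
    by (rule holomorphic_on_imp_differentiable_at[OF holomorphic_zeta_reg]) (auto simp: open_halfspace_Re_gt)
  then have "isCont zeta_reg 1"
    by (rule field_differentiable_imp_continuous_at)
  moreover have "((\<lambda>\<sigma>. complex_of_real \<sigma>) \<longlongrightarrow> 1) (at_right 1)"
    by (rule tendsto_eq_intros refl)+ simp
  ultimately have l0: "((\<lambda>\<sigma>. zeta_reg (of_real \<sigma>)) \<longlongrightarrow> zeta_reg 1) (at_right 1)"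
    by (rule isCont_tendsto_compose)
  have "(F \<longlongrightarrow> norm (zeta_reg 1) ^ 3 * norm D ^ 4 * norm (zeta (Complex 1 (2 * t))) * (1 - 1)) (at_right 1)"
    unfolding F_def by (intro tendsto_intros l0 l1 l2)
  then have "(F \<longlongrightarrow> 0) (at_right 1)"
    by simp
  moreover have "1 \<le> F \<sigma>" if \<sigma>: "\<sigma> > 1" for \<sigma>
  proof -
    have "Complex \<sigma> t - ?s = of_real (\<sigma> - 1)"
      by (simp add: complex_eq_iff)
    then have n: "norm (Complex \<sigma> t - ?s) = \<sigma> - 1"
      using \<sigma> by (simp only: norm_of_real)
    have "norm (zeta_reg (of_real \<sigma>)) = (\<sigma> - 1) * norm (zeta (of_real \<sigma>))"
    proof -
      have "norm (of_real \<sigma> - 1 :: complex) = \<sigma> - 1"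
        using \<sigma> by (metis abs_of_pos diff_gt_0_iff_gt norm_of_real of_real_1 of_real_diff)
      then show ?thesis
        using \<sigma> by (simp add: zeta_reg_def norm_mult)
    qed
    then have "F \<sigma> = ((\<sigma> - 1) ^ 4 / (\<sigma> - 1) ^ 4) * (norm (zeta (of_real \<sigma>)) ^ 3 * norm (zeta (Complex \<sigma> t)) ^ 4 * norm (zeta (Complex \<sigma> (2 * t))))"
      unfolding F_def z0 diff_0_right norm_divide n power_divide power_mult_distrib
      by (simp add: power_mult_distrib power4_eq_xxxx power3_eq_cube)
    then show ?thesis
      using three_four_one_zeta[OF \<sigma>, of t] \<sigma> by simp
  qed
  ultimately have "1 \<le> (0::real)"
    using eventually_at_right_less[of 1]
    by (intro tendsto_lowerbound[of F 0 "at_right 1"]) (auto elim!: eventually_mono)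
  then show False by simp
qed

text \<open>\<open>riemann_hypothesis\<close> speaks only of the open critical strip; the line Re s
  = 1 and the half plane of absolute convergence are covered unconditionally.\<close>

lemma zeta_nonzero_RH:
  assumes RH: riemann_hypothesis and s: "Re s > 1 / 2" "s \<noteq> 1"
  shows "zeta s \<noteq> 0"
proof -
  consider "Re s < 1" | "Re s = 1" | "Re s > 1" by linarith
  then show ?thesis
  proof cases
    case 1
    then show ?thesis
      using RH s unfolding riemann_hypothesis_def by force
  next
    case 2
    then have "s = Complex 1 (Im s)" "Im s \<noteq> 0"
      using s by (auto simp: complex_eq_iff)
    then show ?thesis
      using zeta_nonzero_Re_eq_1[of "Im s"] by metis
  next
    case 3
    then show ?thesis by (rule mobius_has_sum(2))
  qed
qed

lemma zeta_reg_nonzero_RH: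
  assumes riemann_hypothesis and "Re s > 1 / 2"
  shows "zeta_reg s \<noteq> 0"
  using zeta_nonzero_RH[OF assms] by (simp add: zeta_reg_def)

lemma holomorphic_zeta_inv_RH:
  assumes riemann_hypothesis
  shows "zeta_inv holomorphic_on {s. Re s > 1 / 2}"
  unfolding zeta_inv_def
  by (intro holomorphic_intros holomorphic_on_subset[OF holomorphic_zeta_reg])
    (use zeta_reg_nonzero_RH[OF assms] in auto)

text \<open>zeta(s) and 1 / zeta(s) are Dirichlet series with coefficients of modulus at most 1, so
  both are dominated by the same sum \<open>Z\<close>, which is zeta(2). The two-sided bound keeps
  the logarithm of |zeta| bounded.\<close>

lemma norm_zeta_Re_ge_2:
  assumes "Re s \<ge> 2"
  defines "Z \<equiv> \<Sum>\<^sub>\<infinity>n\<in>{1..}. real n powr (- 2)"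
  shows "norm (zeta s) \<le> Z" "1 / Z \<le> norm (zeta s)" "Z \<ge> 1"
proof -
  have summ: "(\<lambda>n. real n powr (- 2)) summable_on {1..}"
    by (rule summable_on_powr) simp
  have le: "norm a \<le> Z" if "((\<lambda>n. c n * of_nat n powr (- s)) has_sum a) {1..}" "\<And>n. norm (c n) \<le> 1" for a c
  proof -
    note abs = abs_summable_on_complex[OF that(1)]
    have "norm a \<le> (\<Sum>\<^sub>\<infinity>n\<in>{1..}. norm (c n * of_nat n powr (- s)))"
      by (rule norm_has_sum_bound[OF has_sum_infsum[OF abs] that(1)])
    also have "\<dots> \<le> Z"
      unfolding Z_def
    proof (rule infsum_mono[OF abs summ])
      fix n :: nat assume n: "n \<in> {1..}"
      have "norm (c n * of_nat n powr (- s)) \<le> 1 * real n powr (- Re s)"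
        unfolding norm_mult using n that(2) by (intro mult_mono) (auto simp: norm_of_nat_powr)
      also have "\<dots> \<le> real n powr (- 2)"
        using n assms(1) by (simp add: powr_mono)
      finally show "norm (c n * of_nat n powr (- s)) \<le> real n powr (- 2)" .
    qed
    finally show ?thesis .
  qed
  have s1: "Re s > 1" using assms(1) by simp
  show "norm (zeta s) \<le> Z"
    using le[of "\<lambda>_. 1" "zeta s"] zeta_has_sum[OF s1] by simp
  show Z1: "Z \<ge> 1"
    unfolding Z_def using finite_sum_le_infsum[OF summ, of "{1}"] by simp
  have "norm (1 / zeta s) \<le> Z"
    using le[OF mobius_has_sum(1)[OF s1] norm_mobius_le] .
  then show "1 / Z \<le> norm (zeta s)"
    using Z1 mobius_has_sum(2)[OF s1] by (simp add: norm_divide field_simps)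
qed

section \<open>Growth of the zeta function under the Riemann hypothesis\<close>

text \<open>Translates closeness of exp (log f / log t) to 1 into bounds by small powers of
  \<open>t\<close>. The radius 1 - exp(-eps) is exact on the lower side and sufficient on the upper
  one, since exp(eps) - 1 >= 1 - exp(-eps).\<close>

lemma powr_close_imp:
  fixes f t \<epsilon> :: real
  assumes f: "f > 0" and t: "t > 1" and \<epsilon>: "\<epsilon> > 0"
    and close: "\<bar>exp (ln f / ln t) - 1\<bar> < 1 - exp (- \<epsilon>)"
  shows "t powr (- \<epsilon>) \<le> f" "f \<le> t powr \<epsilon>"
proof -
  have lt: "ln t > 0" using t by simp
  have "exp (- \<epsilon>) < exp (ln f / ln t)"
    using close by linarith
  then have "- \<epsilon> < ln f / ln t"
    by simp
  then have "- \<epsilon> * ln t \<le> ln f"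
    using lt by (simp add: field_simps)
  then have "exp (- \<epsilon> * ln t) \<le> exp (ln f)"
    by simp
  then show "t powr (- \<epsilon>) \<le> f"
    using f t by (simp add: powr_def)
  have "exp \<epsilon> + exp (- \<epsilon>) \<ge> 2"
  proof -
    have "(exp (\<epsilon> / 2) - exp (- \<epsilon> / 2)) ^ 2 = exp \<epsilon> + exp (- \<epsilon>) - 2"
      by (simp add: power2_eq_square algebra_simps flip: exp_add)
    then show ?thesis
      using zero_le_power2[of "exp (\<epsilon> / 2) - exp (- \<epsilon> / 2)"] by linarith
  qed
  then have "exp (ln f / ln t) < exp \<epsilon>"
    using close by linarith
  then have "ln f / ln t < \<epsilon>"
    by simp
  then have "ln f \<le> \<epsilon> * ln t"
    using lt by (simp add: field_simps)
  then have "exp (ln f) \<le> exp (\<epsilon> * ln t)"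
    by simp
  then show "f \<le> t powr \<epsilon>"
    using f t by (simp add: powr_def)
qed

text \<open>A linear bound is enough for normality: after taking logarithms and dividing by log |t|,
  any power of |t| becomes a constant. The condition |t| >= 3 keeps the shifted box away from the
  pole.\<close>

lemma norm_zeta_strip_le:
  obtains M where "M \<ge> 1" "\<And>z t. 1 / 2 < Re z \<Longrightarrow> Re z < 5 \<Longrightarrow> \<bar>Im z\<bar> < 1 \<Longrightarrow> \<bar>t\<bar> \<ge> 3 \<Longrightarrow>
    norm (zeta (z + \<i> * of_real t)) \<le> M * \<bar>t\<bar>"
proof -
  obtain C where C: "C > 0" "\<And>s. Re s \<ge> 1 / 2 \<Longrightarrow> s \<noteq> 1 \<Longrightarrow> norm (zeta s) \<le> 1 / norm (s - 1) + C * norm s"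
    using norm_zeta_le by blast
  have "norm (zeta (z + \<i> * of_real t)) \<le> (1 + 3 * C) * \<bar>t\<bar>"
    if z: "1 / 2 < Re z" "Re z < 5" "\<bar>Im z\<bar> < 1" and t: "\<bar>t\<bar> \<ge> 3" for z t
  proof -
    let ?s = "z + \<i> * of_real t"
    have im: "\<bar>Im (?s - 1)\<bar> \<ge> 2" "Im ?s \<noteq> 0"
      using z t by auto
    have n: "norm (?s - 1) \<ge> 2"
      using im abs_Im_le_cmod[of "?s - 1"] by linarith
    then have "?s \<noteq> 1"
      by auto
    note n = n this
    have "norm ?s \<le> \<bar>Re ?s\<bar> + \<bar>Im ?s\<bar>"
      by (rule cmod_le)
    also have "\<dots> \<le> 3 * \<bar>t\<bar>"
      using z t by simp
    finally have "C * norm ?s \<le> C * (3 * \<bar>t\<bar>)"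
      using C(1) by simp
    moreover have "1 / norm (?s - 1) \<le> 1 / 2"
      using n by (intro divide_left_mono) auto
    moreover have "norm (zeta ?s) \<le> 1 / norm (?s - 1) + C * norm ?s"
      using z n by (intro C) auto
    ultimately have "norm (zeta ?s) \<le> 1 + C * (3 * \<bar>t\<bar>)"
      by linarith
    also have "\<dots> \<le> (1 + 3 * C) * \<bar>t\<bar>"
      using t by (simp add: algebra_simps)
    finally show ?thesis .
  qed
  then show ?thesis
    using that[of "1 + 3 * C"] C(1) by simp
qed

text \<open>
  The functions \<open>exp (log \<zeta>(z + i t) / log |t|)\<close> are locally bounded, and their modulus tends to 1 on
  \<open>Re z > 2\<close>. So by Montel's theorem and the maximum principle every limit function has modulus 1.
\<close>

lemma zeta_Lindelof_strip:
  assumes RH: riemann_hypothesis and \<eta>: "\<eta> > 0" and \<epsilon>: "\<epsilon> > 0"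
  shows "\<exists>T. \<forall>x t. 1 / 2 + \<eta> \<le> x \<and> x \<le> 3 \<and> \<bar>t\<bar> \<ge> T \<longrightarrow>
           \<bar>t\<bar> powr (- \<epsilon>) \<le> norm (zeta (Complex x t)) \<and> norm (zeta (Complex x t)) \<le> \<bar>t\<bar> powr \<epsilon>"
proof (rule ccontr)
  define bad where "bad = (\<lambda>x t. 1 / 2 + \<eta> \<le> x \<and> x \<le> 3 \<and>
    \<not> (\<bar>t\<bar> powr (- \<epsilon>) \<le> norm (zeta (Complex x t)) \<and> norm (zeta (Complex x t)) \<le> \<bar>t\<bar> powr \<epsilon>))"
  assume "\<not> ?thesis"
  then have "\<exists>x t. \<bar>t\<bar> \<ge> T \<and> bad x t" for T
    unfolding bad_def by blast
  then have "\<exists>x t. \<bar>t\<bar> \<ge> real n + 3 \<and> bad x t" for n :: nat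
    by blast
  then obtain x t where t: "\<And>n. \<bar>t n\<bar> \<ge> real n + 3" and bad: "\<And>n. bad (x n) (t n)"
    by metis
  have t3: "\<bar>t n\<bar> \<ge> 3" for n
    using t[of n] by linarith
  have lt1: "ln \<bar>t n\<bar> \<ge> 1" for n
  proof -
    have "ln (exp 1) \<le> ln \<bar>t n\<bar>"
      using exp_le t3[of n] by (subst ln_le_cancel_iff) auto
    then show ?thesis by simp
  qed
  \<comment> \<open>The box is convex, so a zero-free holomorphic function on it has a logarithm. It
    contains the segment from 1/2 + eta to 3, and also an open piece of Re z > 2, from which the
    maximum principle starts.\<close>
  define S where "S = {z. Re z > 1 / 2} \<inter> {z. Re z < 5} \<inter> {z. Im z > -1} \<inter> {z. Im z < 1}"
  have S: "convex S" "open S"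
    unfolding S_def by (intro convex_Int open_Int convex_halfspace_Re_gt convex_halfspace_Re_lt convex_halfspace_Im_gt
      convex_halfspace_Im_lt open_halfspace_Re_gt open_halfspace_Re_lt open_halfspace_Im_gt open_halfspace_Im_lt)+
  have S3: "3 \<in> S"
    by (simp add: S_def)
  define f where "f = (\<lambda>n z. zeta (z + \<i> * of_real (t n)))"
  have ne1: "z + \<i> * of_real (t n) \<noteq> 1" if "z \<in> S" for z n
    using that t3[of n] by (auto simp: S_def complex_eq_iff)
  have fnz: "f n z \<noteq> 0" if "z \<in> S" for n z
    unfolding f_def using that ne1[OF that] by (intro zeta_nonzero_RH[OF RH]) (auto simp: S_def)
  have fhol: "f n holomorphic_on S" for n
  proof -
    have "(zeta \<circ> (\<lambda>z. z + \<i> * of_real (t n))) holomorphic_on S"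
      by (rule holomorphic_on_compose_gen[OF _ holomorphic_zeta]) (use ne1 in \<open>auto intro!: holomorphic_intros\<close>)
    then show ?thesis
      by (simp add: f_def o_def)
  qed
  have "\<exists>g. g holomorphic_on S \<and> (\<forall>z\<in>S. exp (g z) = f n z)" for n
    using holomorphic_logarithm_exists[OF S fhol fnz S3] by metis
  then obtain g where g: "\<And>n. g n holomorphic_on S" "\<And>n z. z \<in> S \<Longrightarrow> exp (g n z) = f n z"
    by metis
  \<comment> \<open>The choice of the branch \<open>g n\<close> affects only the argument of
    \<open>P n\<close>, so its modulus is governed by log |zeta| alone. Montel's theorem needs just
    an upper bound for this modulus.\<close>
  define P where "P = (\<lambda>n z. exp (g n z / of_real (ln \<bar>t n\<bar>)))"
  have Phol: "P n holomorphic_on S" for n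
    unfolding P_def using lt1[of n] by (intro holomorphic_intros g) auto
  have Pnorm: "norm (P n z) = exp (ln (norm (f n z)) / ln \<bar>t n\<bar>)" if "z \<in> S" for n z
  proof -
    have "norm (f n z) = exp (Re (g n z))"
      using g(2)[OF that, of n] by (metis norm_exp_eq_Re)
    then show ?thesis
      by (simp add: P_def)
  qed
  obtain M where M: "M \<ge> 1" "\<And>z t. 1 / 2 < Re z \<Longrightarrow> Re z < 5 \<Longrightarrow> \<bar>Im z\<bar> < 1 \<Longrightarrow> \<bar>t\<bar> \<ge> 3 \<Longrightarrow>
    norm (zeta (z + \<i> * of_real t)) \<le> M * \<bar>t\<bar>"
    by (rule norm_zeta_strip_le) blast
  have Pbd: "norm (P n z) \<le> exp (ln M + 1)" if z: "z \<in> S" for n z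
  proof -
    have "norm (f n z) \<le> M * \<bar>t n\<bar>"
      unfolding f_def using z t3 by (intro M) (auto simp: S_def)
    then have "ln (norm (f n z)) \<le> ln (M * \<bar>t n\<bar>)"
      using fnz[OF z, of n] by (subst ln_le_cancel_iff) (use M(1) t3[of n] in \<open>auto intro!: mult_pos_pos\<close>)
    also have "\<dots> = ln M + ln \<bar>t n\<bar>"
      using M(1) t3[of n] by (intro ln_mult_pos) auto
    finally have "ln (norm (f n z)) / ln \<bar>t n\<bar> \<le> (ln M + ln \<bar>t n\<bar>) / ln \<bar>t n\<bar>"
      using lt1[of n] by (intro divide_right_mono) auto
    also have "\<dots> = ln M / ln \<bar>t n\<bar> + 1"
      using lt1[of n] by (simp add: add_divide_distrib)
    also have "\<dots> \<le> ln M + 1"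
    proof -
      have "ln M / ln \<bar>t n\<bar> \<le> ln M / 1"
        using lt1[of n] M(1) by (intro divide_left_mono) auto
      then show ?thesis by simp
    qed
    finally show ?thesis
      unfolding Pnorm[OF z] by simp
  qed
  obtain h r where h: "h holomorphic_on S" and r: "strict_mono (r :: nat \<Rightarrow> nat)"
    and ptw: "\<And>z. z \<in> S \<Longrightarrow> ((\<lambda>n. P (r n) z) \<longlongrightarrow> h z) sequentially"
    and unif: "\<And>K. compact K \<Longrightarrow> K \<subseteq> S \<Longrightarrow> uniform_limit K (P \<circ> r) h sequentially"
  proof (rule Montel[OF S(2), of "range P" P])
    show "\<And>h. h \<in> range P \<Longrightarrow> h holomorphic_on S"
      using Phol by auto
    show "\<exists>B. \<forall>h\<in>range P. \<forall>z\<in>K. norm (h z) \<le> B" if "compact K" "K \<subseteq> S" for K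
      using Pbd that by (intro exI[of _ "exp (ln M + 1)"]) auto
  qed auto
  have h1: "norm (h z) = 1" if z: "z \<in> S" "Re z > 2" for z
  proof -
    define Z where "Z = (\<Sum>\<^sub>\<infinity>n\<in>{1..}. real n powr (- 2))"
    have lnbd: "\<bar>ln (norm (f n z))\<bar> \<le> ln Z" for n
    proof -
      have "Re (z + \<i> * of_real (t n)) \<ge> 2"
        using z by simp
      note Zb = norm_zeta_Re_ge_2[OF this, folded Z_def f_def]
      have fz: "norm (zeta (z + \<i> * of_real (t n))) > 0"
        using fnz[OF z(1), of n] by (simp add: f_def)
      have "ln (norm (zeta (z + \<i> * of_real (t n)))) \<le> ln Z"
        using Zb fz by (subst ln_le_cancel_iff) auto
      moreover have "ln (1 / Z) \<le> ln (norm (zeta (z + \<i> * of_real (t n))))"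
        using Zb fz by (subst ln_le_cancel_iff) auto
      moreover have "ln (1 / Z) = - ln Z"
        using Zb by (simp add: ln_div)
      ultimately show ?thesis
        by (simp add: f_def)
    qed
    have tt: "filterlim (\<lambda>n. ln \<bar>t (r n)\<bar>) at_top sequentially"
    proof (rule filterlim_compose[OF ln_at_top], rule filterlim_at_top_mono[OF filterlim_real_sequentially])
      show "\<forall>\<^sub>F n in sequentially. real n \<le> \<bar>t (r n)\<bar>"
      proof (rule always_eventually, rule allI)
        fix n
        have "real n \<le> real (r n)"
          using seq_suble[OF r, of n] by simp
        then show "real n \<le> \<bar>t (r n)\<bar>"
          using t[of "r n"] by linarith
      qed
    qed
    have "(\<lambda>n. ln (norm (f (r n) z)) / ln \<bar>t (r n)\<bar>) \<longlonglongrightarrow> 0"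
    proof (rule Lim_null_comparison)
      show "(\<lambda>n. ln Z / ln \<bar>t (r n)\<bar>) \<longlonglongrightarrow> 0"
        by (rule tendsto_divide_0[OF tendsto_const filterlim_at_top_imp_at_infinity[OF tt]])
      show "\<forall>\<^sub>F n in sequentially. norm (ln (norm (f (r n) z)) / ln \<bar>t (r n)\<bar>) \<le> ln Z / ln \<bar>t (r n)\<bar>"
      proof (rule always_eventually, rule allI)
        fix n
        have "\<bar>ln (norm (f (r n) z))\<bar> / ln \<bar>t (r n)\<bar> \<le> ln Z / ln \<bar>t (r n)\<bar>"
          using lnbd[of "r n"] lt1[of "r n"] by (intro divide_right_mono) auto
        then show "norm (ln (norm (f (r n) z)) / ln \<bar>t (r n)\<bar>) \<le> ln Z / ln \<bar>t (r n)\<bar>"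
          using lt1[of "r n"] by (simp add: abs_divide)
      qed
    qed
    then have "(\<lambda>n. exp (ln (norm (f (r n) z)) / ln \<bar>t (r n)\<bar>)) \<longlonglongrightarrow> exp 0"
      by (intro tendsto_intros)
    then have "(\<lambda>n. norm (P (r n) z)) \<longlonglongrightarrow> 1"
      by (simp add: Pnorm[OF z(1)])
    moreover have "(\<lambda>n. norm (P (r n) z)) \<longlonglongrightarrow> norm (h z)"
      by (intro tendsto_intros ptw z)
    ultimately show ?thesis
      using LIMSEQ_unique by blast
  qed
  \<comment> \<open>|h| is 1 on the open part Re z > 2, so 3 is an interior maximum point there.
    Constancy carries modulus 1 to the whole box, including the region left of 1 where no direct
    lower bound for zeta is available.\<close>
  have "h constant_on S"
  proof (rule maximum_modulus_principle[OF h S(2), of "S \<inter> {z. Re z > 2}" 3])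
    show "connected S" using S by (simp add: convex_connected)
    show "open (S \<inter> {z. Re z > 2})" using S by (intro open_Int open_halfspace_Re_gt)
    show "3 \<in> S \<inter> {z. Re z > 2}" using S3 by simp
    show "norm (h z) \<le> norm (h 3)" if "z \<in> S \<inter> {z. Re z > 2}" for z
      using h1[of z] h1[of 3] that S3 by auto
  qed auto
  then have hS: "norm (h z) = 1" if "z \<in> S" for z
    using h1[of 3] S3 that unfolding constant_on_def by auto
  \<comment> \<open>Uniform convergence on this compact segment is what allows an evaluation at the
    abscissa \<open>x (r n)\<close>, which moves with \<open>n\<close>.\<close>
  define K where "K = complex_of_real ` {1 / 2 + \<eta>..3}"
  have K: "compact K" "K \<subseteq> S"
    using \<eta> by (auto simp: K_def S_def intro!: compact_continuous_image continuous_intros)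
  have "1 - exp (- \<epsilon>) > 0"
    using \<epsilon> by simp
  from uniform_limitD[OF unif[OF K] this]
  obtain n where n: "\<forall>z\<in>K. dist ((P \<circ> r) n z) (h z) < 1 - exp (- \<epsilon>)"
    unfolding eventually_sequentially by blast
  define z where "z = complex_of_real (x (r n))"
  have zK: "z \<in> K"
    using bad[of "r n"] by (auto simp: z_def K_def bad_def)
  have zS: "z \<in> S" using zK K by blast
  have fz: "f (r n) z = zeta (Complex (x (r n)) (t (r n)))"
    by (simp add: f_def z_def Complex_eq)
  have "\<bar>norm (P (r n) z) - norm (h z)\<bar> \<le> norm (P (r n) z - h z)"
    by (rule norm_triangle_ineq3)
  also have "\<dots> < 1 - exp (- \<epsilon>)"
    using n zK by (simp add: dist_norm)
  finally have "\<bar>exp (ln (norm (f (r n) z)) / ln \<bar>t (r n)\<bar>) - 1\<bar> < 1 - exp (- \<epsilon>)"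
    by (simp add: Pnorm[OF zS] hS[OF zS])
  moreover have "norm (f (r n) z) > 0" "\<bar>t (r n)\<bar> > 1"
    using fnz[OF zS] t3[of "r n"] by auto
  ultimately have "\<not> bad (x (r n)) (t (r n))"
    using powr_close_imp[of "norm (f (r n) z)" "\<bar>t (r n)\<bar>" \<epsilon>] \<epsilon> unfolding bad_def fz by blast
  then show False
    using bad by blast
qed

lemma one_le_powr_one_plus_abs: "\<epsilon> > 0 \<Longrightarrow> 1 \<le> (1 + \<bar>t\<bar>) powr (\<epsilon>::real)"
  by (intro ge_one_powr_ge_zero) auto

lemma le_mult_one_plus_abs_powr:
  fixes x :: real
  assumes "x \<le> K" "K \<ge> 0" "\<epsilon> > 0"
  shows "x \<le> K * (1 + \<bar>t\<bar>) powr \<epsilon>"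
  using mult_left_mono[OF one_le_powr_one_plus_abs[OF assms(3), of t] assms(2)] assms(1) by simp

text \<open>For Re s >= 3 zeta is bounded, for large |Im s| the strip estimate applies, and in the
  bounded region that remains the elementary bound is used; there \<open>\<rho>\<close> caps the
  contribution of the pole.\<close>

lemma zeta_Lindelof:
  assumes RH: riemann_hypothesis and \<eta>: "\<eta> > 0" and \<rho>: "\<rho> > 0" and \<epsilon>: "\<epsilon> > 0"
  shows "\<exists>K>0. \<forall>s. Re s \<ge> 1 / 2 + \<eta> \<and> norm (s - 1) \<ge> \<rho> \<longrightarrow> norm (zeta s) \<le> K * (1 + \<bar>Im s\<bar>) powr \<epsilon>"
proof -
  obtain T where T: "\<And>x t. 1 / 2 + \<eta> \<le> x \<Longrightarrow> x \<le> 3 \<Longrightarrow> \<bar>t\<bar> \<ge> T \<Longrightarrow> norm (zeta (Complex x t)) \<le> \<bar>t\<bar> powr \<epsilon>"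
    using zeta_Lindelof_strip[OF RH \<eta> \<epsilon>] by blast
  obtain C where C: "C > 0" "\<And>s. Re s \<ge> 1 / 2 \<Longrightarrow> s \<noteq> 1 \<Longrightarrow> norm (zeta s) \<le> 1 / norm (s - 1) + C * norm s"
    using norm_zeta_le by blast
  define Z where "Z = (\<Sum>\<^sub>\<infinity>n\<in>{1..}. real n powr (- 2))"
  have Z1: "Z \<ge> 1"
    unfolding Z_def by (rule norm_zeta_Re_ge_2(3)[of 2]) simp
  define K where "K = Z + 1 + (1 / \<rho> + C * (3 + \<bar>T\<bar>))"
  have K: "K \<ge> Z" "K \<ge> 1" "K \<ge> 1 / \<rho> + C * (3 + \<bar>T\<bar>)" "K > 0"
  proof -
    have "0 \<le> 1 / \<rho> + C * (3 + \<bar>T\<bar>)"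
      using \<rho> C(1) by (intro add_nonneg_nonneg mult_nonneg_nonneg) auto
    then show "K \<ge> Z" "K \<ge> 1" "K \<ge> 1 / \<rho> + C * (3 + \<bar>T\<bar>)" "K > 0"
      using Z1 unfolding K_def by linarith+
  qed
  note const = le_mult_one_plus_abs_powr[OF _ less_imp_le[OF K(4)] \<epsilon>]
  have "norm (zeta s) \<le> K * (1 + \<bar>Im s\<bar>) powr \<epsilon>" if s: "Re s \<ge> 1 / 2 + \<eta>" "norm (s - 1) \<ge> \<rho>" for s
  proof -
    consider "Re s \<ge> 3" | "Re s \<le> 3" "\<bar>Im s\<bar> \<ge> T" | "Re s \<le> 3" "\<bar>Im s\<bar> \<le> T"
      by linarith
    then show ?thesis
    proof cases
      case 1
      then have "norm (zeta s) \<le> Z"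
        unfolding Z_def by (intro norm_zeta_Re_ge_2(1)) simp
      then show ?thesis using K by (intro const) linarith
    next
      case 2
      then have "norm (zeta s) \<le> \<bar>Im s\<bar> powr \<epsilon>"
        using T[of "Re s" "Im s"] s by simp
      also have "\<dots> \<le> (1 + \<bar>Im s\<bar>) powr \<epsilon>"
        using \<epsilon> by (intro powr_mono2) auto
      also have "\<dots> \<le> K * (1 + \<bar>Im s\<bar>) powr \<epsilon>"
        using K(2) mult_right_mono[of 1 K "(1 + \<bar>Im s\<bar>) powr \<epsilon>"] by simp
      finally show ?thesis .
    next
      case 3
      have "norm s \<le> \<bar>Re s\<bar> + \<bar>Im s\<bar>"
        by (rule cmod_le)
      then have "C * norm s \<le> C * (3 + \<bar>T\<bar>)"
        using 3 s \<eta> C(1) by (intro mult_left_mono) auto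
      moreover have "1 / norm (s - 1) \<le> 1 / \<rho>"
        using s \<rho> by (intro frac_le) auto
      moreover have "norm (zeta s) \<le> 1 / norm (s - 1) + C * norm s"
        using s \<eta> \<rho> by (intro C) auto
      ultimately show ?thesis
        using K(3) by (intro const) linarith
    qed
  qed
  with K(4) show ?thesis by blast
qed

text \<open>The counterpart with the lower strip estimate. No distance from 1 is required:
  \<open>zeta_inv\<close> is holomorphic there too, so compactness settles the bounded
  region.\<close>

lemma zeta_inv_bound:
  assumes RH: riemann_hypothesis and \<eta>: "\<eta> > 0" and \<epsilon>: "\<epsilon> > 0"
  shows "\<exists>K>0. \<forall>s. Re s \<ge> 1 / 2 + \<eta> \<longrightarrow> norm (zeta_inv s) \<le> K * (1 + \<bar>Im s\<bar>) powr \<epsilon>"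
proof -
  obtain T where T: "\<And>x t. 1 / 2 + \<eta> \<le> x \<Longrightarrow> x \<le> 3 \<Longrightarrow> \<bar>t\<bar> \<ge> T \<Longrightarrow> \<bar>t\<bar> powr (- \<epsilon>) \<le> norm (zeta (Complex x t))"
    using zeta_Lindelof_strip[OF RH \<eta> \<epsilon>] by blast
  \<comment> \<open>\<open>T1\<close> is at least 1 so that s differs from 1 in the range of large
    |Im s|, where \<open>zeta_inv\<close> is read as 1 / zeta.\<close>
  define T1 where "T1 = max T 1"
  define B where "B = cbox (Complex (1 / 2 + \<eta>) (- T1)) (Complex 3 T1)"
  have "zeta_inv holomorphic_on B"
    by (rule holomorphic_on_subset[OF holomorphic_zeta_inv_RH[OF RH]]) (use \<eta> in \<open>auto simp: B_def in_cbox_complex_iff\<close>)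
  then have "compact (zeta_inv ` B)"
    by (intro compact_continuous_image holomorphic_on_imp_continuous_on) (auto simp: B_def)
  then have "bounded (zeta_inv ` B)"
    by (rule compact_imp_bounded)
  then obtain C where "\<forall>x\<in>zeta_inv ` B. norm x \<le> C"
    by (auto simp: bounded_iff)
  then have C: "norm (zeta_inv s) \<le> C" if "s \<in> B" for s
    using that by blast
  define Z where "Z = (\<Sum>\<^sub>\<infinity>n\<in>{1..}. real n powr (- 2))"
  have Z1: "Z \<ge> 1"
    unfolding Z_def by (rule norm_zeta_Re_ge_2(3)[of 2]) simp
  define K where "K = Z + \<bar>C\<bar>"
  have K: "K \<ge> Z" "K \<ge> C" "K \<ge> 1"
    using Z1 by (auto simp: K_def)
  have "K \<ge> 0" using K(3) by simp
  note const = le_mult_one_plus_abs_powr[OF _ this \<epsilon>]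
  have "norm (zeta_inv s) \<le> K * (1 + \<bar>Im s\<bar>) powr \<epsilon>" if s: "Re s \<ge> 1 / 2 + \<eta>" for s
  proof -
    consider "Re s \<ge> 3" | "Re s \<le> 3" "\<bar>Im s\<bar> \<ge> T1" | "Re s \<le> 3" "\<bar>Im s\<bar> \<le> T1"
      by linarith
    then show ?thesis
    proof cases
      case 1
      then have "1 / Z \<le> norm (zeta s)"
        unfolding Z_def by (intro norm_zeta_Re_ge_2(2)) simp
      then have "1 / norm (zeta s) \<le> 1 / (1 / Z)"
        using Z1 by (intro divide_left_mono mult_pos_pos) (auto intro: less_le_trans[of _ "1 / Z"])
      moreover have "s \<noteq> 1" using 1 by auto
      ultimately have "norm (zeta_inv s) \<le> Z"
        by (simp add: zeta_inv_eq norm_divide)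
      then show ?thesis using K by (intro const) linarith
    next
      case 2
      have t: "\<bar>Im s\<bar> \<ge> 1" "\<bar>Im s\<bar> \<ge> T" using 2 by (auto simp: T1_def)
      have "\<bar>Im s\<bar> powr (- \<epsilon>) \<le> norm (zeta s)"
        using T[of "Re s" "Im s"] s 2 t by simp
      moreover have "\<bar>Im s\<bar> powr (- \<epsilon>) > 0"
        using t by simp
      ultimately have "1 / norm (zeta s) \<le> 1 / \<bar>Im s\<bar> powr (- \<epsilon>)"
        by (intro divide_left_mono mult_pos_pos) auto
      also have "\<dots> = \<bar>Im s\<bar> powr \<epsilon>"
        by (simp add: powr_minus field_simps)
      also have "\<dots> \<le> (1 + \<bar>Im s\<bar>) powr \<epsilon>"
        using \<epsilon> by (intro powr_mono2) auto
      also have "\<dots> \<le> K * (1 + \<bar>Im s\<bar>) powr \<epsilon>"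
        using K(3) mult_right_mono[of 1 K "(1 + \<bar>Im s\<bar>) powr \<epsilon>"] by simp
      finally show ?thesis
        using t by (subst zeta_inv_eq) (auto simp: norm_divide)
    next
      case 3
      then have "s \<in> B"
        using s by (auto simp: B_def in_cbox_complex_iff)
      then show ?thesis
        using C K by (intro const) force
    qed
  qed
  moreover have "K > 0" using K by simp
  ultimately show ?thesis by blast
qed

section \<open>Perron's formula\<close>

text \<open>The segment is replaced by the other three sides of a rectangle to its right. No pole
  lies there, and |y^s| <= y^c because y <= 1. The sides have total length 4T and the integrand is
  at most y^c / T^2; the constant 8 only matches the case y >= 1.\<close>

lemma perron_kernel_le_one:
  fixes y c T :: real
  assumes y: "0 < y" "y \<le> 1" and c: "0 < c" and T: "T \<ge> 2"
  shows "norm (contour_integral (linepath (Complex c (-T)) (Complex c T))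
            (\<lambda>s. of_real y powr s / (s * (s + 1)))) \<le> 8 * y powr c / T"
proof -
  let ?f = "\<lambda>s. of_real y powr s / (s * (s + 1)) :: complex"
  define S where "S = {s. Re s > 0}"
  have hol: "?f holomorphic_on S"
  proof -
    have "s * (s + 1) \<noteq> 0" if "s \<in> S" for s
      using that by (auto simp: S_def dest: arg_cong[of _ _ Re])
    then show ?thesis
      using y by (intro holomorphic_intros) auto
  qed
  have "convex S" "open S"
    by (auto simp: S_def convex_halfspace_Re_gt open_halfspace_Re_gt)
  obtain g where g: "\<And>x. x \<in> S \<Longrightarrow> (g has_field_derivative ?f x) (at x within S)"
    using holomorphic_convex_primitive'[OF \<open>convex S\<close> \<open>open S\<close> hol] by blast
  have prim: "(?f has_contour_integral (g q - g p)) (linepath p q)" if "p \<in> S" "q \<in> S" for p q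
  proof -
    have "path_image (linepath p q) \<subseteq> S"
      using that \<open>convex S\<close> by (simp add: closed_segment_subset)
    from contour_integral_primitive[OF g _ this] show ?thesis by simp
  qed
  define p1 p2 p3 p4 where "p1 = Complex c (-T)" and "p2 = Complex (c + T) (-T)"
    and "p3 = Complex (c + T) T" and "p4 = Complex c T"
  have pS: "p1 \<in> S" "p2 \<in> S" "p3 \<in> S" "p4 \<in> S"
    using c T by (auto simp: S_def p1_def p2_def p3_def p4_def)
  have bd: "norm (?f s) \<le> y powr c * (1 / T^2)"
    if s: "Re s \<ge> c" "norm s \<ge> T" "norm (s + 1) \<ge> T" for s
  proof -
    have "norm (of_real y powr s) \<le> y powr c"
      using y s by (subst norm_powr_real_powr) (auto intro!: powr_mono')
    moreover have "T^2 \<le> norm (s * (s + 1))"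
      unfolding norm_mult power2_eq_square using s T by (intro mult_mono) auto
    ultimately have "norm (of_real y powr s) / norm (s * (s + 1)) \<le> y powr c / T^2"
      using T by (intro frac_le) auto
    then show ?thesis
      by (simp add: norm_divide)
  qed
  have seg: "norm (g q - g p) \<le> y powr c * (1 / T^2) * norm (q - p)"
    if "p \<in> S" "q \<in> S" "\<And>s. s \<in> closed_segment p q \<Longrightarrow> Re s \<ge> c \<and> norm s \<ge> T \<and> norm (s + 1) \<ge> T" for p q
  proof (rule has_contour_integral_bound_linepath[OF prim[OF that(1,2)]])
    show "norm (?f s) \<le> y powr c * (1 / T^2)" if "s \<in> closed_segment p q" for s
      using \<open>\<And>s. s \<in> closed_segment p q \<Longrightarrow> _\<close>[OF that] by (intro bd) auto
  qed auto
  have n1: "norm s \<ge> T \<and> norm (s + 1) \<ge> T" if "\<bar>Im s\<bar> = T \<or> Re s \<ge> T" for s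
    using that abs_Im_le_cmod[of s] abs_Im_le_cmod[of "s+1"] abs_Re_le_cmod[of s] abs_Re_le_cmod[of "s+1"] T
    by auto
  have e1: "norm (g p2 - g p1) \<le> y powr c * (1 / T^2) * T"
  proof -
    have "Re s \<ge> c \<and> norm s \<ge> T \<and> norm (s + 1) \<ge> T" if "s \<in> closed_segment p1 p2" for s
      using that T n1[of s] by (auto simp: p1_def p2_def closed_segment_same_Im closed_segment_eq_real_ivl split: if_splits)
    then have "norm (g p2 - g p1) \<le> y powr c * (1 / T^2) * norm (p2 - p1)"
      by (intro seg pS) blast
    moreover have "norm (p2 - p1) = \<bar>Re (p2 - p1)\<bar>"
      by (rule cmod_eq_Re) (simp add: p1_def p2_def)
    ultimately show ?thesis
      using T by (simp add: p1_def p2_def)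
  qed
  have e2: "norm (g p3 - g p2) \<le> y powr c * (1 / T^2) * (2 * T)"
  proof -
    have "Re s \<ge> c \<and> norm s \<ge> T \<and> norm (s + 1) \<ge> T" if "s \<in> closed_segment p2 p3" for s
      using that T c n1[of s] by (auto simp: p2_def p3_def closed_segment_same_Re closed_segment_eq_real_ivl split: if_splits)
    then have "norm (g p3 - g p2) \<le> y powr c * (1 / T^2) * norm (p3 - p2)"
      by (intro seg pS) blast
    moreover have "norm (p3 - p2) = \<bar>Im (p3 - p2)\<bar>"
      by (rule cmod_eq_Im) (simp add: p2_def p3_def)
    ultimately show ?thesis
      using T by (simp add: p2_def p3_def)
  qed
  have e3: "norm (g p4 - g p3) \<le> y powr c * (1 / T^2) * T"
  proof -
    have "Re s \<ge> c \<and> norm s \<ge> T \<and> norm (s + 1) \<ge> T" if "s \<in> closed_segment p3 p4" for s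
      using that T n1[of s] by (auto simp: p3_def p4_def closed_segment_same_Im closed_segment_eq_real_ivl split: if_splits)
    then have "norm (g p4 - g p3) \<le> y powr c * (1 / T^2) * norm (p4 - p3)"
      by (intro seg pS) blast
    moreover have "norm (p4 - p3) = \<bar>Re (p4 - p3)\<bar>"
      by (rule cmod_eq_Re) (simp add: p3_def p4_def)
    ultimately show ?thesis
      using T by (simp add: p3_def p4_def)
  qed
  have "contour_integral (linepath p1 p4) ?f = g p4 - g p1"
    by (rule contour_integral_unique[OF prim[OF pS(1,4)]])
  also have "norm \<dots> \<le> norm (g p2 - g p1) + norm (g p3 - g p2) + norm (g p4 - g p3)"
    by norm
  also have "\<dots> \<le> y powr c * (1 / T^2) * T + y powr c * (1 / T^2) * (2 * T) + y powr c * (1 / T^2) * T"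
    by (intro add_mono e1 e2 e3)
  also have "\<dots> = 4 * y powr c / T"
    using T by (simp add: divide_simps power2_eq_square)
  also have "\<dots> \<le> 8 * y powr c / T"
    using T by (intro divide_right_mono) auto
  finally show ?thesis
    by (simp add: p1_def p4_def)
qed

text \<open>Now y^s is small on the left, so the contour is closed at Re s = -T. The residues 1 at 0
  and -1/y at -1 give the main term. The horizontal sides contribute 2 each to the constant 8 and
  the left side 4, since only |s + 1| >= T/2 holds on it; this is where T >= 2 enters.\<close>

lemma perron_kernel_ge_one:
  fixes y c T :: real
  assumes y: "y \<ge> 1" and c: "0 < c" "c \<le> T" and T: "T \<ge> 2"
  shows "norm (contour_integral (linepath (Complex c (-T)) (Complex c T))
            (\<lambda>s. of_real y powr s / (s * (s + 1))) - 2 * of_real pi * \<i> * of_real (1 - 1 / y)) \<le> 8 * y powr c / T"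
proof -
  let ?f = "\<lambda>s. of_real y powr s / (s * (s + 1)) :: complex"
  define p1 p2 p3 p4 where "p1 = Complex (-T) (-T)" and "p2 = Complex c (-T)"
    and "p3 = Complex c T" and "p4 = Complex (-T) T"
  have n1: "norm s \<ge> T \<and> norm (s + 1) \<ge> T / 2" if "\<bar>Im s\<bar> = T \<or> Re s = -T" for s
    using that abs_Im_le_cmod[of s] abs_Im_le_cmod[of "s+1"] abs_Re_le_cmod[of s] abs_Re_le_cmod[of "s+1"] T
    by auto
  have n2: "norm (s + 1) \<ge> T" if "\<bar>Im s\<bar> = T" for s
    using that abs_Im_le_cmod[of "s+1"] by auto
  have yb: "norm (of_real y powr s) \<le> y powr c" if "Re s \<le> c" for s :: complex
    using y that by (subst norm_powr_real_powr) (auto intro!: powr_mono)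
  have cont: "continuous_on X ?f" if "0 \<notin> X" "-1 \<notin> X" for X
  proof -
    have "s * (s + 1) \<noteq> 0" if "s \<in> X" for s
      using that \<open>0 \<notin> X\<close> \<open>-1 \<notin> X\<close> by (metis add.commute add_eq_0_iff mult_eq_0_iff)
    then show ?thesis
      using y by (intro continuous_intros) auto
  qed
  have hor: "norm (contour_integral (linepath p q) ?f) \<le> y powr c / T^2 * (2 * T)"
    if pq: "Im p = Im q" "\<bar>Im p\<bar> = T" "{Re p, Re q} = {-T, c}" for p q
  proof -
    have s: "Re s \<le> c \<and> \<bar>Im s\<bar> = T" if "s \<in> closed_segment p q" for s
      using that pq T c
      by (auto simp: closed_segment_same_Im doubleton_eq_iff closed_segment_eq_real_ivl split: if_splits)
    have "norm (contour_integral (linepath p q) ?f) \<le> y powr c / T^2 * norm (q - p)"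
    proof (rule contour_integral_bound_linepath)
      show "?f contour_integrable_on linepath p q"
        using s T by (intro contour_integrable_continuous_linepath cont) force+
      fix z assume "z \<in> closed_segment p q"
      note sz = s[OF this]
      have "T^2 \<le> norm (z * (z + 1))"
        unfolding norm_mult power2_eq_square using n1[of z] n2[of z] sz T by (intro mult_mono) auto
      then show "norm (?f z) \<le> y powr c / T^2"
        unfolding norm_divide using yb[of z] sz T by (intro frac_le) auto
    qed (use T in auto)
    also have "\<dots> \<le> y powr c / T^2 * (2 * T)"
    proof (rule mult_left_mono)
      have "norm (q - p) = \<bar>Re (q - p)\<bar>"
        by (rule cmod_eq_Re) (simp add: pq)
      then show "norm (q - p) \<le> 2 * T"
        using c T pq(3) by (auto simp: doubleton_eq_iff)
    qed auto
    finally show ?thesis .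
  qed
  have e1: "norm (contour_integral (linepath p1 p2) ?f) \<le> y powr c / T^2 * (2 * T)"
    and e3: "norm (contour_integral (linepath p3 p4) ?f) \<le> y powr c / T^2 * (2 * T)"
    using T by (intro hor; auto simp: p1_def p2_def p3_def p4_def)+
  have e4: "norm (contour_integral (linepath p4 p1) ?f) \<le> y powr c / (T^2 / 2) * (2 * T)"
  proof -
    have s: "Re s = -T" if "s \<in> closed_segment p4 p1" for s
      using that T c by (auto simp: p1_def p4_def closed_segment_same_Re)
    have "norm (contour_integral (linepath p4 p1) ?f) \<le> y powr c / (T^2 / 2) * norm (p1 - p4)"
    proof (rule contour_integral_bound_linepath)
      show "?f contour_integrable_on linepath p4 p1"
        using s T by (intro contour_integrable_continuous_linepath cont) force+
      fix z assume "z \<in> closed_segment p4 p1"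
      note sz = s[OF this]
      have "T * (T / 2) \<le> norm (z * (z + 1))"
        unfolding norm_mult using n1[of z] sz T by (intro mult_mono) auto
      then show "norm (?f z) \<le> y powr c / (T^2 / 2)"
        unfolding norm_divide using yb[of z] sz T c by (intro frac_le) (auto simp: power2_eq_square)
    qed (use T in auto)
    also have "norm (p1 - p4) = 2 * T"
      using T by (subst cmod_eq_Im) (simp_all add: p1_def p4_def)
    finally show ?thesis by simp
  qed
  have tri: "norm (- a - b - d) \<le> norm a + norm b + norm d" for a b d :: complex
    by norm
  have res: "contour_integral (rectpath p1 p3) ?f = 2 * pi * \<i> * (\<Sum>p\<in>{0,-1}. winding_number (rectpath p1 p3) p * residue ?f p)"
  proof (rule Residue_theorem)
    show "open (UNIV :: complex set)" "connected (UNIV :: complex set)" by auto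
    show "?f holomorphic_on UNIV - {0,-1}"
      using y by (intro holomorphic_intros) (auto simp: add_eq_0_iff2)
    show "path_image (rectpath p1 p3) \<subseteq> UNIV - {0,-1}"
      using c T by (subst path_image_rectpath_cbox_minus_box)
        (auto simp: p1_def p3_def in_box_complex_iff)
  qed auto
  have w: "winding_number (rectpath p1 p3) 0 = 1" "winding_number (rectpath p1 p3) (-1) = 1"
    using c T by (auto intro!: winding_number_rectpath simp: in_box_complex_iff p1_def p3_def)
  have r0: "residue ?f 0 = 1"
  proof -
    have "residue (\<lambda>s. (of_real y powr s / (s + 1)) / (s - 0)) 0 = of_real y powr 0 / (0 + 1)"
      using y by (intro residue_simple[of "{s. Re s > -1}"] holomorphic_intros)
        (auto simp: open_halfspace_Re_gt complex_eq_iff)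
    then show ?thesis using y by (simp add: field_simps)
  qed
  have r1: "residue ?f (-1) = - of_real (1 / y)"
  proof -
    have "residue (\<lambda>s. (of_real y powr s / s) / (s - (-1))) (-1) = of_real y powr (-1) / (-1)"
      using y by (intro residue_simple[of "{s. Re s < 0}"] holomorphic_intros)
        (auto simp: open_halfspace_Re_lt)
    then show ?thesis using y by (simp add: field_simps powr_minus)
  qed
  have rect: "contour_integral (rectpath p1 p3) ?f =
      contour_integral (linepath p1 p2) ?f + contour_integral (linepath p2 p3) ?f +
      contour_integral (linepath p3 p4) ?f + contour_integral (linepath p4 p1) ?f"
  proof -
    have i: "?f contour_integrable_on linepath p1 p2" "?f contour_integrable_on linepath p2 p3"
      "?f contour_integrable_on linepath p3 p4" "?f contour_integrable_on linepath p4 p1"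
      using c T
      by (auto intro!: contour_integrable_continuous_linepath cont
          simp: p1_def p2_def p3_def p4_def closed_segment_same_Re closed_segment_same_Im)
    have "rectpath p1 p3 = linepath p1 p2 +++ linepath p2 p3 +++ linepath p3 p4 +++ linepath p4 p1"
      by (simp add: rectpath_def Let_def p1_def p2_def p3_def p4_def)
    then show ?thesis using i by (simp add: contour_integrable_joinI)
  qed
  have diff: "contour_integral (linepath p2 p3) ?f - 2 * of_real pi * \<i> * of_real (1 - 1 / y) =
     - contour_integral (linepath p1 p2) ?f - contour_integral (linepath p3 p4) ?f - contour_integral (linepath p4 p1) ?f"
  proof -
    have key: "b - r = - a - c - d" if "a + b + c + d = r" for a b c d r :: complex
      unfolding that[symmetric] by simp
    have sum: "(\<Sum>p\<in>{0,-1}. winding_number (rectpath p1 p3) p * residue ?f p) = 1 - of_real (1 / y)"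
      using r0 r1 w by simp
    show ?thesis
      using key[OF trans[OF rect[symmetric] res]]
      unfolding sum of_real_diff of_real_1 of_real_mult of_real_numeral .
  qed
  have "norm (contour_integral (linepath p2 p3) ?f - 2 * of_real pi * \<i> * of_real (1 - 1 / y))
      \<le> norm (contour_integral (linepath p1 p2) ?f) + norm (contour_integral (linepath p3 p4) ?f)
       + norm (contour_integral (linepath p4 p1) ?f)"
    unfolding diff by (rule tri)
  also have "\<dots> \<le> y powr c / T^2 * (2 * T) + y powr c / T^2 * (2 * T) + y powr c / (T^2 / 2) * (2 * T)"
    by (intro add_mono e1 e3 e4)
  also have "\<dots> = 8 * y powr c / T"
    using T by (simp add: divide_simps power2_eq_square)
  finally show ?thesis
    unfolding p2_def p3_def .
qed

text \<open>
  Integrating a Dirichlet series against \<open>u powr (s + 1) / (s * (s + 1))\<close> gives the weights \<open>max 0 (u - n)\<close>.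
  The difference of the cases \<open>u = N + 1\<close> and \<open>u = N\<close> cuts off sharply at \<open>n \<le> N\<close>, while the
  integral converges absolutely.
\<close>

definition perron_kernel :: "nat \<Rightarrow> complex \<Rightarrow> complex" where
  "perron_kernel N s = (of_nat (Suc N) powr (s + 1) - of_nat N powr (s + 1)) / (s * (s + 1))"

abbreviation vline :: "real \<Rightarrow> real \<Rightarrow> real \<Rightarrow> complex" where
  "vline c T \<equiv> linepath (Complex c (-T)) (Complex c T)"

lemma Re_closed_segment_vline: "s \<in> closed_segment (Complex c (-T)) (Complex c T) \<Longrightarrow> Re s = c"
  by (auto simp: closed_segment_same_Re)

lemma continuous_on_perron_kernel:
  assumes "N \<ge> 1" "\<And>s. s \<in> S \<Longrightarrow> Re s > 0"
  shows "continuous_on S (perron_kernel N)"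
proof -
  have "s * (s + 1) \<noteq> 0" if "s \<in> S" for s
    using assms(2)[OF that] by (auto dest: arg_cong[of _ _ Re])
  then show ?thesis
    unfolding perron_kernel_def using assms(1)
    by (intro continuous_intros) (auto simp: complex_nonpos_Reals_iff simp flip: of_nat_Suc)
qed

lemma holomorphic_perron_kernel:
  assumes "N \<ge> 1" "\<And>s. s \<in> S \<Longrightarrow> Re s > 0"
  shows "perron_kernel N holomorphic_on S"
proof -
  have "s * (s + 1) \<noteq> 0" if "s \<in> S" for s
    using assms(2)[OF that] by (auto dest: arg_cong[of _ _ Re])
  then show ?thesis
    unfolding perron_kernel_def using assms(1)
    by (intro holomorphic_intros) (auto simp: complex_nonpos_Reals_iff simp flip: of_nat_Suc)
qed

lemma of_real_divide_powr:
  fixes u w :: real and s :: complex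
  assumes "u > 0" "w > 0"
  shows "of_real (u / w) powr s = of_real u powr s * of_real w powr (- s)"
proof -
  define y where "y = u / w"
  have y: "y > 0" "ln y = ln u - ln w"
    using assms by (auto simp: y_def ln_div)
  have "of_real y powr s = exp (s * of_real (ln y))"
    using y(1) by (simp add: powr_def Ln_of_real)
  also have "\<dots> = exp (s * of_real (ln u) + - s * of_real (ln w))"
    unfolding y(2) by (simp add: algebra_simps)
  also have "\<dots> = of_real u powr s * of_real w powr (- s)"
    using assms unfolding exp_add by (simp add: powr_def Ln_of_real)
  finally show ?thesis
    by (simp only: y_def)
qed

text \<open>As u^(s+1) n^(-s) = u (u/n)^s, the kernel estimates apply with y = u/n. Both cases are
  expressed by the single weight u max(0, 1 - 1/y) = max(0, u - n).\<close>

lemma perron_kernel_integral: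
  fixes u c T :: real and n :: nat
  assumes u: "u > 0" and n: "n \<ge> 1" and c: "0 < c" "c \<le> T" and T: "T \<ge> 2"
  shows "(\<lambda>s. of_nat n powr (- s) * (of_real u powr (s + 1) / (s * (s + 1)))) contour_integrable_on vline c T"
    and "norm (contour_integral (vline c T) (\<lambda>s. of_nat n powr (- s) * (of_real u powr (s + 1) / (s * (s + 1))))
          - 2 * of_real pi * \<i> * of_real (max 0 (u - real n))) \<le> u * (8 * (u / real n) powr c / T)"
proof -
  let ?y = "u / real n"
  let ?f = "\<lambda>s. of_real ?y powr s / (s * (s + 1)) :: complex"
  have y: "?y > 0"
    using u n by simp
  have pos: "s * (s + 1) \<noteq> 0" if "s \<in> closed_segment (Complex c (-T)) (Complex c T)" for s
    using Re_closed_segment_vline[OF that] c by (auto dest: arg_cong[of _ _ Re])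
  have eq: "of_nat n powr (- s) * (of_real u powr (s + 1) / (s * (s + 1))) = of_real u * ?f s" for s :: complex
  proof -
    have "of_real ?y powr s = of_real u powr s * of_nat n powr (- s)"
      using of_real_divide_powr[of u "real n" s] u n by simp
    moreover have "of_real u powr (s + 1) = of_real u * of_real u powr s"
      using u by (simp add: powr_add)
    ultimately show ?thesis
      by simp
  qed
  have int: "?f contour_integrable_on vline c T"
    using pos y by (intro contour_integrable_continuous_linepath continuous_intros) auto
  then show "(\<lambda>s. of_nat n powr (- s) * (of_real u powr (s + 1) / (s * (s + 1)))) contour_integrable_on vline c T"
    unfolding eq by (rule contour_integrable_lmul)
  have val: "of_real u * (of_real (max 0 (1 - 1 / ?y)) :: complex) = of_real (max 0 (u - real n))"
  proof -
    have "u * max 0 (1 - 1 / ?y) = max 0 (u - real n)"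
      using u n by (auto simp: max_def field_simps)
    then show ?thesis
      by (metis of_real_mult)
  qed
  have "norm (contour_integral (vline c T) ?f - 2 * of_real pi * \<i> * of_real (max 0 (1 - 1 / ?y))) \<le> 8 * ?y powr c / T"
  proof (cases "?y \<le> 1")
    case True
    then have "1 / ?y \<ge> 1"
      using y by (simp only: le_divide_eq_1_pos)
    then have "max 0 (1 - 1 / ?y) = 0"
      by linarith
    then show ?thesis
      using perron_kernel_le_one[OF y True c(1) T] by simp
  next
    case False
    then have "1 / ?y \<le> 1"
      using y by (simp only: divide_le_eq_1_pos)
    then have "max 0 (1 - 1 / ?y) = 1 - 1 / ?y"
      by linarith
    then show ?thesis
      using perron_kernel_ge_one[of ?y c T] False c T by simp
  qed
  then have *: "u * norm (contour_integral (vline c T) ?f - 2 * of_real pi * \<i> * of_real (max 0 (1 - 1 / ?y)))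
      \<le> u * (8 * ?y powr c / T)"
    using u by (intro mult_left_mono) auto
  have "contour_integral (vline c T) (\<lambda>s. of_real u * ?f s) - 2 * of_real pi * \<i> * of_real (max 0 (u - real n))
     = of_real u * (contour_integral (vline c T) ?f - 2 * of_real pi * \<i> * of_real (max 0 (1 - 1 / ?y)))"
    unfolding contour_integral_lmul[OF int] val[symmetric] by (simp only: algebra_simps)
  then have "norm (contour_integral (vline c T) (\<lambda>s. of_real u * ?f s) - 2 * of_real pi * \<i> * of_real (max 0 (u - real n)))
     = u * norm (contour_integral (vline c T) ?f - 2 * of_real pi * \<i> * of_real (max 0 (1 - 1 / ?y)))"
    using u by (simp only: norm_mult norm_of_real abs_of_pos)
  with * show "norm (contour_integral (vline c T) (\<lambda>s. of_nat n powr (- s) * (of_real u powr (s + 1) / (s * (s + 1))))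
          - 2 * of_real pi * \<i> * of_real (max 0 (u - real n))) \<le> u * (8 * ?y powr c / T)"
    unfolding eq by simp
qed

lemma perron_kernel_single:
  fixes c T :: real and n N :: nat
  assumes N: "N \<ge> 1" and n: "n \<ge> 1" and c: "0 < c" "c \<le> T" and T: "T \<ge> 2"
  shows "norm (contour_integral (vline c T) (\<lambda>s. of_nat n powr (- s) * perron_kernel N s)
          - 2 * of_real pi * \<i> * (if n \<le> N then 1 else 0)) \<le> 16 * real (Suc N) powr (c + 1) * real n powr (- c) / T"
proof -
  let ?I = "contour_integral (vline c T)"
  define f where "f = (\<lambda>u s. of_nat n powr (- s) * (of_real u powr (s + 1) / (s * (s + 1))) :: complex)"
  define m where "m = (\<lambda>u. 2 * of_real pi * \<i> * of_real (max 0 (u - real n)))"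
  have bd: "norm (?I (f u) - m u) \<le> 8 * real (Suc N) powr (c + 1) * real n powr (- c) / T"
    and int: "f u contour_integrable_on vline c T" if u: "u > 0" "u \<le> real (Suc N)" for u
  proof -
    note P = perron_kernel_integral[OF u(1) n c T]
    show "f u contour_integrable_on vline c T"
      unfolding f_def by (rule P(1))
    have "u * (8 * (u / real n) powr c / T) = 8 * u powr (c + 1) * real n powr (- c) / T"
      using u n by (simp add: powr_divide powr_add powr_minus divide_simps)
    also have "\<dots> \<le> 8 * real (Suc N) powr (c + 1) * real n powr (- c) / T"
      using u c T by (intro divide_right_mono mult_right_mono mult_left_mono powr_mono2) auto
    finally show "norm (?I (f u) - m u) \<le> 8 * real (Suc N) powr (c + 1) * real n powr (- c) / T"
      using P(2) unfolding f_def m_def by linarith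
  qed
  have "of_nat n powr (- s) * perron_kernel N s = f (real (Suc N)) s - f (real N) s" for s
    by (simp add: f_def perron_kernel_def diff_divide_distrib right_diff_distrib)
  then have I: "?I (\<lambda>s. of_nat n powr (- s) * perron_kernel N s) = ?I (f (real (Suc N))) - ?I (f (real N))"
    using N by (simp only:) (intro contour_integral_diff int; simp)
  \<comment> \<open>For n = N + 1 both weights are 0, and for n <= N they differ by exactly 1. Since
    \<open>n\<close> and \<open>N\<close> are integers no other case arises, so no term at the edge
    gets a fractional weight.\<close>
  have "max 0 (real (Suc N) - real n) - max 0 (real N - real n) = (if n \<le> N then 1 else 0)"
    by (auto simp: max_def)
  then have "of_real (max 0 (real (Suc N) - real n)) - of_real (max 0 (real N - real n)) = (if n \<le> N then 1 else 0 :: complex)"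
    by (metis of_real_0 of_real_1 of_real_diff)
  then have m: "m (real (Suc N)) - m (real N) = 2 * of_real pi * \<i> * (if n \<le> N then 1 else 0)"
    unfolding m_def right_diff_distrib[symmetric] by simp
  have tri: "norm ((a - b) - (c - d)) \<le> norm (a - c) + norm (b - d)" for a b c d :: complex
    by norm
  have "norm ((?I (f (real (Suc N))) - ?I (f (real N))) - (m (real (Suc N)) - m (real N)))
     \<le> 8 * real (Suc N) powr (c + 1) * real n powr (- c) / T + 8 * real (Suc N) powr (c + 1) * real n powr (- c) / T"
    using N by (intro order_trans[OF tri] add_mono bd) auto
  then show ?thesis
    unfolding I m by (rule order_trans) (simp add: mult_ac)
qed

text \<open>The index type is arbitrary, so a series over triples need not be grouped by the value
  \<open>v i\<close>. On a fixed segment the series converges uniformly and is integrated termwise;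
  the errors carry the factor \<open>v i\<close> to the power \<open>- c\<close> and therefore add
  up to O(1/T).\<close>

lemma perron_dirichlet:
  fixes v :: "'i \<Rightarrow> nat" and cf :: "'i \<Rightarrow> complex"
  assumes v: "\<And>i. i \<in> I \<Longrightarrow> v i \<ge> 1" and N: "N \<ge> 1" and c: "c > 0"
    and fin: "finite {i\<in>I. v i \<le> N}"
    and A: "\<And>s. Re s = c \<Longrightarrow> ((\<lambda>i. cf i * of_nat (v i) powr (- s)) has_sum A s) I"
  shows "((\<lambda>T. contour_integral (vline c T) (\<lambda>s. A s * perron_kernel N s))
            \<longlongrightarrow> 2 * of_real pi * \<i> * (\<Sum>i\<in>{i\<in>I. v i \<le> N}. cf i)) at_top"
proof -
  have "(\<lambda>i. norm (cf i * of_nat (v i) powr (- of_real c))) summable_on I"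
    by (rule abs_summable_on_complex[OF A]) simp
  also have "?this \<longleftrightarrow> (\<lambda>i. norm (cf i) * real (v i) powr (- c)) summable_on I"
  proof (rule summable_on_cong)
    fix i assume "i \<in> I"
    then have "v i > 0" using v by force
    then show "norm (cf i * of_nat (v i) powr (- of_real c)) = norm (cf i) * real (v i) powr (- c)"
      by (simp add: norm_mult norm_of_nat_powr)
  qed
  finally have summ: "(\<lambda>i. norm (cf i) * real (v i) powr (- c)) summable_on I" .
  define W where "W = (\<Sum>\<^sub>\<infinity>i\<in>I. norm (cf i) * real (v i) powr (- c))"
  define B where "B = 16 * real (Suc N) powr (c + 1) * W"
  let ?S = "\<Sum>i\<in>{i\<in>I. v i \<le> N}. cf i"
  have W0: "(\<Sum>i\<in>F. norm (cf i) * real (v i) powr (- c)) \<le> W" if "finite F" "F \<subseteq> I" for F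
    unfolding W_def by (rule finite_sum_le_infsum[OF summ that]) auto
  have main: "norm (contour_integral (vline c T) (\<lambda>s. A s * perron_kernel N s) - 2 * of_real pi * \<i> * ?S) \<le> B / T"
    if T: "T \<ge> 2" "T \<ge> c" for T
  proof -
    let ?I = "contour_integral (vline c T)"
    define P where "P = path_image (vline c T)"
    have ReP: "Re s = c" if "s \<in> P" for s
      using that Re_closed_segment_vline by (simp add: P_def)
    have ker: "continuous_on P (perron_kernel N)"
      using ReP c by (intro continuous_on_perron_kernel N) auto
    have "compact P"
      by (simp add: P_def)
    then obtain M where M: "\<And>s. s \<in> P \<Longrightarrow> norm (perron_kernel N s) \<le> M"
      using compact_imp_bounded[OF compact_continuous_image[OF ker]] unfolding bounded_iff by force
    have trm: "(\<lambda>s. of_nat n powr (- s) * perron_kernel N s) contour_integrable_on vline c T" if "n \<ge> 1" for n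
      using ker that unfolding P_def
      by (intro contour_integrable_continuous_linepath continuous_intros) auto
    define G where "G = (\<lambda>F s. \<Sum>i\<in>F. cf i * of_nat (v i) powr (- s) * perron_kernel N s)"
    have Gint: "G F contour_integrable_on vline c T" and
      GI: "?I (G F) = (\<Sum>i\<in>F. cf i * ?I (\<lambda>s. of_nat (v i) powr (- s) * perron_kernel N s))"
      if F: "finite F" "F \<subseteq> I" for F
    proof -
      have i: "(\<lambda>s. cf i * (of_nat (v i) powr (- s) * perron_kernel N s)) contour_integrable_on vline c T" if "i \<in> F" for i
        using trm v F that by (intro contour_integrable_lmul) auto
      show "G F contour_integrable_on vline c T"
        unfolding G_def using i F by (intro contour_integrable_sum) (auto simp: mult.assoc)
      have "?I (G F) = (\<Sum>i\<in>F. ?I (\<lambda>s. cf i * (of_nat (v i) powr (- s) * perron_kernel N s)))"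
        unfolding G_def mult.assoc using i F by (intro contour_integral_sum) auto
      then show "?I (G F) = (\<Sum>i\<in>F. cf i * ?I (\<lambda>s. of_nat (v i) powr (- s) * perron_kernel N s))"
        using F v by (simp only:) (intro sum.cong refl contour_integral_lmul trm; blast)
    qed
    have unif: "uniform_limit P G (\<lambda>s. A s * perron_kernel N s) (finite_subsets_at_top I)"
      unfolding G_def
    proof (rule Weierstrass_m_test_general')
      fix i s assume i: "i \<in> I" "s \<in> P"
      have "norm (of_nat (v i) powr (- s) :: complex) = real (v i) powr (- c)"
        using ReP[OF i(2)] v[OF i(1)] norm_powr_real_powr[of "of_nat (v i)" "-s"] by simp
      then show "norm (cf i * of_nat (v i) powr (- s) * perron_kernel N s) \<le> norm (cf i) * real (v i) powr (- c) * M"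
        using M[OF i(2)] by (simp add: norm_mult mult_left_mono)
    next
      show "((\<lambda>i. cf i * of_nat (v i) powr (- s) * perron_kernel N s) has_sum A s * perron_kernel N s) I" if "s \<in> P" for s
        by (intro has_sum_cmult_left A ReP that)
    qed (intro summable_on_cmult_left summ)
    have lim: "((\<lambda>F. ?I (G F)) \<longlongrightarrow> ?I (\<lambda>s. A s * perron_kernel N s)) (finite_subsets_at_top I)"
    proof (rule contour_integral_uniform_limit(2))
      show "\<forall>\<^sub>F F in finite_subsets_at_top I. G F contour_integrable_on vline c T"
        using Gint by (auto intro: eventually_finite_subsets_at_top_weakI)
      show "uniform_limit (path_image (vline c T)) G (\<lambda>s. A s * perron_kernel N s) (finite_subsets_at_top I)"
        using unif by (simp add: P_def)
      show "norm (vector_derivative (vline c T) (at t)) \<le> norm (Complex c T - Complex c (- T))" for t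
        by simp
    qed auto
    \<comment> \<open>Every finite \<open>F\<close> that contains all indices with value at most
      \<open>N\<close> has the full main term, and its error bound does not depend on
      \<open>F\<close>, so it survives the limit over \<open>F\<close>.\<close>
    have "norm (?I (G F) - 2 * of_real pi * \<i> * ?S) \<le> B / T" if F: "finite F" "{i\<in>I. v i \<le> N} \<subseteq> F" "F \<subseteq> I" for F
    proof -
      have S: "?S = (\<Sum>i\<in>F. cf i * (if v i \<le> N then 1 else 0))"
        using F by (intro sum.mono_neutral_cong_left) auto
      have "?I (G F) - 2 * of_real pi * \<i> * ?S =
          (\<Sum>i\<in>F. cf i * (?I (\<lambda>s. of_nat (v i) powr (- s) * perron_kernel N s) - 2 * of_real pi * \<i> * (if v i \<le> N then 1 else 0)))"
        unfolding GI[OF F(1,3)] S right_diff_distrib sum_subtractf sum_distrib_left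
        by (intro arg_cong2[of _ _ _ _ "(-)"] sum.cong) (auto simp: mult_ac)
      then have "norm (?I (G F) - 2 * of_real pi * \<i> * ?S) \<le>
          (\<Sum>i\<in>F. norm (cf i * (?I (\<lambda>s. of_nat (v i) powr (- s) * perron_kernel N s) - 2 * of_real pi * \<i> * (if v i \<le> N then 1 else 0))))"
        by (simp only: norm_sum)
      also have "\<dots> \<le> (\<Sum>i\<in>F. norm (cf i) * (16 * real (Suc N) powr (c + 1) * real (v i) powr (- c) / T))"
        unfolding norm_mult[of "cf _"] using F v c T
        by (intro sum_mono mult_left_mono perron_kernel_single N) auto
      also have "\<dots> = 16 * real (Suc N) powr (c + 1) * (\<Sum>i\<in>F. norm (cf i) * real (v i) powr (- c)) / T"
        by (simp add: sum_distrib_left sum_divide_distrib mult_ac)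
      also have "\<dots> \<le> B / T"
        unfolding B_def using T W0[OF F(1,3)] by (intro divide_right_mono mult_left_mono) auto
      finally show ?thesis .
    qed
    then have "\<forall>\<^sub>F F in finite_subsets_at_top I. norm (?I (G F) - 2 * of_real pi * \<i> * ?S) \<le> B / T"
      unfolding eventually_finite_subsets_at_top using fin by (intro exI[of _ "{i\<in>I. v i \<le> N}"]) auto
    then show ?thesis
      by (intro tendsto_upperbound[OF tendsto_norm[OF tendsto_diff[OF lim tendsto_const]]]) auto
  qed
  show ?thesis
  proof (rule Lim_null_comparison[THEN LIM_zero_cancel])
    show "\<forall>\<^sub>F T in at_top. norm (contour_integral (vline c T) (\<lambda>s. A s * perron_kernel N s) - 2 * of_real pi * \<i> * ?S) \<le> B / T"
      using eventually_ge_at_top[of "max 2 c"] by eventually_elim (use main in auto)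
    show "((\<lambda>T. B / T) \<longlongrightarrow> 0) at_top"
      by (intro tendsto_divide_0[OF tendsto_const] filterlim_at_top_imp_at_infinity filterlim_ident)
  qed
qed

section \<open>Shifting the line of integration\<close>

text \<open>Two bounds are interpolated geometrically with weight \<open>\<theta>\<close>. The mean
  value theorem over the unit step from N to N + 1 saves a power of N but decays only like 1/|s|;
  bounding both powers separately gives decay 1/|s|^2 at the cost of a factor N. A small positive
  \<open>\<theta>\<close> already makes the integral converge absolutely.\<close>

lemma norm_perron_kernel_le:
  assumes N: "N \<ge> 1" and s: "Re s > 0" and \<theta>: "0 \<le> \<theta>" "\<theta> \<le> 1"
  shows "norm (perron_kernel N s) \<le> 2 * real (Suc N) powr (Re s + \<theta>) * norm s powr (- (1 + \<theta>))"
proof -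
  define M where "M = real (Suc N)"
  define x where "x = norm (perron_kernel N s)"
  have M: "M \<ge> 1" "M \<ge> real N" "real N > 0"
    using N by (auto simp: M_def)
  have s0: "norm s > 0" "s \<noteq> 0" "s + 1 \<noteq> 0"
    using s by (auto dest: arg_cong[of _ _ Re])
  have le: "norm s \<le> norm (s + 1)"
    unfolding cmod_def using s by (intro real_sqrt_le_mono) (simp add: power2_eq_square algebra_simps)
  have x1: "x \<le> M powr Re s / norm s"
  proof -
    define S where "S = complex_of_real ` {real N..M}"
    have "convex S"
      unfolding S_def by (intro convex_linear_image) (auto intro: bounded_linear.linear bounded_linear_of_real)
    have "norm (of_real M powr (s + 1) - of_real (real N) powr (s + 1)) \<le> (norm (s + 1) * M powr Re s) * norm (of_real M - of_real (real N) :: complex)"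
    proof (rule field_differentiable_bound[OF \<open>convex S\<close>])
      fix z assume "z \<in> S"
      then obtain t where t: "z = of_real t" "t \<ge> real N" "t \<le> M"
        by (auto simp: S_def)
      then have "z \<notin> \<real>\<^sub>\<le>\<^sub>0"
        using M by auto
      then have "((\<lambda>z. z powr (s + 1)) has_field_derivative (s + 1) * z powr s) (at z)"
        by (auto intro!: derivative_eq_intros)
      then show "((\<lambda>z. z powr (s + 1)) has_field_derivative (s + 1) * z powr s) (at z within S)"
        by (rule has_field_derivative_at_within)
      have "norm (z powr s) = t powr Re s"
        unfolding t(1) using t(2) M by (subst norm_powr_real_powr) auto
      also have "\<dots> \<le> M powr Re s"
        using t M s by (intro powr_mono2) auto
      finally show "norm ((s + 1) * z powr s) \<le> norm (s + 1) * M powr Re s"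
        by (simp add: norm_mult mult_left_mono)
    next
      show "of_real M \<in> S" "of_real (real N) \<in> S"
        using M unfolding S_def by (intro imageI; simp)+
    qed
    moreover have "of_real M - of_real (real N) = (1 :: complex)"
      by (simp add: M_def)
    ultimately have "norm (of_real M powr (s + 1) - of_real (real N) powr (s + 1)) \<le> norm (s + 1) * M powr Re s"
      by simp
    moreover have "x = norm (of_real M powr (s + 1) - of_real (real N) powr (s + 1)) / (norm s * norm (s + 1))"
      by (simp add: x_def perron_kernel_def M_def norm_divide norm_mult)
    ultimately have "x \<le> (norm (s + 1) * M powr Re s) / (norm s * norm (s + 1))"
      using s0 by (simp only:) (intro divide_right_mono; simp)
    then show ?thesis
      using s0 by simp
  qed
  have x2: "x \<le> 2 * M powr (Re s + 1) / norm s ^ 2"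
  proof -
    have "norm (of_real M powr (s + 1)) = M powr (Re s + 1)"
      using M by (subst norm_powr_real_powr) auto
    moreover have "norm (of_real (real N) powr (s + 1)) = real N powr (Re s + 1)"
      using M by (subst norm_powr_real_powr) auto
    moreover have "real N powr (Re s + 1) \<le> M powr (Re s + 1)"
      using M s by (intro powr_mono2) auto
    ultimately have "norm (of_real M powr (s + 1) - of_real (real N) powr (s + 1)) \<le> 2 * M powr (Re s + 1)"
      using norm_triangle_ineq4[of "of_real M powr (s + 1)" "of_real (real N) powr (s + 1)"] by linarith
    moreover have "norm s ^ 2 \<le> norm s * norm (s + 1)"
      unfolding power2_eq_square using le by (intro mult_left_mono) auto
    moreover have "x = norm (of_real M powr (s + 1) - of_real (real N) powr (s + 1)) / (norm s * norm (s + 1))"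
      by (simp add: x_def perron_kernel_def M_def norm_divide norm_mult)
    ultimately show ?thesis
      using s0 by (auto intro!: frac_le)
  qed
  show ?thesis
  proof (cases "x = 0")
    case True
    then show ?thesis by (simp add: x_def)
  next
    case False
    then have "x > 0" by (simp add: x_def)
    then have "x = x powr (1 - \<theta>) * x powr \<theta>"
      by (simp flip: powr_add)
    also have "\<dots> \<le> (M powr Re s / norm s) powr (1 - \<theta>) * (2 * M powr (Re s + 1) / norm s ^ 2) powr \<theta>"
      using x1 x2 \<theta> \<open>x > 0\<close> by (intro mult_mono powr_mono2) auto
    also have "\<dots> = 2 powr \<theta> * (M powr (Re s * (1 - \<theta>)) * M powr ((Re s + 1) * \<theta>)) * (norm s powr (- (1 - \<theta>)) * norm s powr (- (2 * \<theta>)))"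
    proof -
      have "(M powr y / norm s) powr p = M powr (y * p) * norm s powr (- p)" for y p
        using M s0 by (simp add: powr_divide powr_powr powr_minus_divide)
      moreover have "(2 * M powr y / norm s ^ 2) powr p = 2 powr p * M powr (y * p) * norm s powr (- (2 * p))" for y p
        using M s0 by (simp add: powr_divide powr_mult powr_powr powr_minus_divide flip: powr_numeral)
      ultimately show ?thesis
        by (simp only: mult_ac)
    qed
    also have "\<dots> = 2 powr \<theta> * M powr (Re s + \<theta>) * norm s powr (- (1 + \<theta>))"
      by (simp add: algebra_simps flip: powr_add)
    also have "\<dots> \<le> 2 powr 1 * M powr (Re s + \<theta>) * norm s powr (- (1 + \<theta>))"
      using \<theta> by (intro mult_right_mono powr_mono) auto
    finally show ?thesis
      by (simp add: x_def M_def)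
  qed
qed

text \<open>The bound is uniform in \<open>T\<close>, so the shifted vertical integral can be
  estimated before \<open>T\<close> tends to infinity.\<close>

lemma integral_one_plus_abs_powr_le:
  fixes \<epsilon> T :: real
  assumes \<epsilon>: "\<epsilon> > 0" and T: "T > 0"
  shows "(\<lambda>x. (1 + \<bar>x\<bar>) powr (- 1 - \<epsilon>)) integrable_on {-T..T}"
    and "integral {-T..T} (\<lambda>x. (1 + \<bar>x\<bar>) powr (- 1 - \<epsilon>)) \<le> 2 / \<epsilon>"
proof -
  let ?f = "\<lambda>x. (1 + \<bar>x\<bar>) powr (- 1 - \<epsilon>)"
  have comm: "- \<epsilon> - 1 = - 1 - \<epsilon>" by simp
  have "((\<lambda>x. (1 + x) powr (- 1 - \<epsilon>)) has_integral (- ((1 + T) powr (-\<epsilon>) / \<epsilon>) - (- ((1 + 0) powr (-\<epsilon>) / \<epsilon>)))) {0..T}"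
    using \<epsilon> T by (intro fundamental_theorem_of_calculus)
      (auto intro!: derivative_eq_intros simp: algebra_simps comm simp flip: has_real_derivative_iff_has_vector_derivative)
  then have R: "(?f has_integral (1 - (1 + T) powr (-\<epsilon>)) / \<epsilon>) {0..T}"
    by (rule has_integral_eq_rhs[OF has_integral_eq[rotated]]) (use \<epsilon> in \<open>auto simp: field_simps\<close>)
  have "((\<lambda>x. (1 - x) powr (- 1 - \<epsilon>)) has_integral ((1 - 0) powr (-\<epsilon>) / \<epsilon> - ((1 - (-T)) powr (-\<epsilon>) / \<epsilon>))) {-T..0}"
    using \<epsilon> T by (intro fundamental_theorem_of_calculus)
      (auto intro!: derivative_eq_intros simp: algebra_simps comm simp flip: has_real_derivative_iff_has_vector_derivative)
  then have L: "(?f has_integral (1 - (1 + T) powr (-\<epsilon>)) / \<epsilon>) {-T..0}"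
    by (rule has_integral_eq_rhs[OF has_integral_eq[rotated]]) (use \<epsilon> in \<open>auto simp: field_simps\<close>)
  have I: "(?f has_integral (1 - (1 + T) powr (-\<epsilon>)) / \<epsilon> + (1 - (1 + T) powr (-\<epsilon>)) / \<epsilon>) {-T..T}"
    using T by (intro has_integral_combine[OF _ _ L R]) auto
  then show "?f integrable_on {-T..T}"
    by (rule has_integral_integrable)
  have "(1 - (1 + T) powr (-\<epsilon>)) / \<epsilon> \<le> 1 / \<epsilon>"
    using \<epsilon> by (intro divide_right_mono) auto
  then show "integral {-T..T} ?f \<le> 2 / \<epsilon>"
    using integral_unique[OF I] \<epsilon> by (simp add: divide_right_mono)
qed

text \<open>\<open>A\<close> is holomorphic across the region between the two lines, so no residues
  occur and a primitive does the shifting. The growth bound is required only on the new line and for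
  |Im s| >= 1, because in the application the formula that controls \<open>A\<close> breaks down at
  removed poles on the real axis.\<close>

lemma perron_shift:
  fixes A :: "complex \<Rightarrow> complex" and \<sigma> c \<epsilon> K :: real
  assumes \<sigma>: "0 < \<sigma>" "\<sigma> < c" "\<sigma>1 < \<sigma>" and \<epsilon>: "0 < \<epsilon>" "2 * \<epsilon> \<le> 1" and N: "N \<ge> 1" and K: "K \<ge> 0"
    and hol: "A holomorphic_on {s. Re s > \<sigma>1}"
    and bound: "\<And>s. Re s = \<sigma> \<or> \<sigma> \<le> Re s \<and> Re s \<le> c \<and> \<bar>Im s\<bar> \<ge> 1 \<Longrightarrow> norm (A s) \<le> K * (1 + \<bar>Im s\<bar>) powr \<epsilon>"
    and lim: "((\<lambda>T. contour_integral (vline c T) (\<lambda>s. A s * perron_kernel N s)) \<longlongrightarrow> 2 * of_real pi * \<i> * S) at_top"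
  shows "norm S \<le> 4 / \<epsilon> * ((1 + \<sigma>) / \<sigma>) powr (1 + 2 * \<epsilon>) * K * real (Suc N) powr (\<sigma> + 2 * \<epsilon>)"
proof -
  define f where "f = (\<lambda>s. A s * perron_kernel N s)"
  define H where "H = {s. Re s > max \<sigma>1 0}"
  define C where "C = 4 / \<epsilon> * ((1 + \<sigma>) / \<sigma>) powr (1 + 2 * \<epsilon>) * K * real (Suc N) powr (\<sigma> + 2 * \<epsilon>)"
  define D where "D = 4 * K * real (Suc N) powr (c + 1) * (c - \<sigma>)"
  have H: "convex H" "open H"
    unfolding H_def by (rule convex_halfspace_Re_gt open_halfspace_Re_gt)+
  have "f holomorphic_on H"
    unfolding f_def using N
    by (intro holomorphic_intros holomorphic_on_subset[OF hol] holomorphic_perron_kernel) (auto simp: H_def)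
  from holomorphic_convex_primitive'[OF H this]
  obtain g where g: "\<And>x. x \<in> H \<Longrightarrow> (g has_field_derivative f x) (at x within H)"
    by blast
  have prim: "(f has_contour_integral (g q - g p)) (linepath p q)" if "p \<in> H" "q \<in> H" for p q
  proof -
    have "path_image (linepath p q) \<subseteq> H"
      using that H by (simp add: closed_segment_subset)
    from contour_integral_primitive[OF g _ this] show ?thesis by simp
  qed
  have inH: "Complex x t \<in> H" if "x \<ge> \<sigma>" for x t
    using that \<sigma> by (simp add: H_def)
  have hor: "norm (g (Complex c t) - g (Complex \<sigma> t)) \<le> D / T" if T: "T \<ge> 1" "\<bar>t\<bar> = T" for t T
  proof -
    have "norm (g (Complex c t) - g (Complex \<sigma> t)) \<le> (4 * K * real (Suc N) powr (c + 1) / T) * norm (Complex c t - Complex \<sigma> t)"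
    proof (rule has_contour_integral_bound_linepath[OF prim])
      show "0 \<le> 4 * K * real (Suc N) powr (c + 1) / T"
        using K T by simp
      fix s assume "s \<in> closed_segment (Complex \<sigma> t) (Complex c t)"
      then have s: "\<sigma> \<le> Re s" "Re s \<le> c" "\<bar>Im s\<bar> = T"
        using \<sigma> T by (auto simp: closed_segment_same_Im closed_segment_eq_real_ivl)
      have "norm (A s) \<le> K * (1 + T) powr \<epsilon>"
        using bound[of s] s T by auto
      also have "\<dots> \<le> K * (1 + T) powr 1"
        using K T \<epsilon> by (intro mult_left_mono powr_mono) auto
      also have "\<dots> \<le> K * (2 * T)"
        using K T by (intro mult_left_mono) auto
      finally have 1: "norm (A s) \<le> K * (2 * T)" .
      \<comment> \<open>Interpolation weight 1 on the horizontal sides: the decay T^(-2) beats a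
        growth linear in T, and the extra power of N is harmless because N is fixed while T tends to
        infinity.\<close>
      have "norm (perron_kernel N s) \<le> 2 * real (Suc N) powr (Re s + 1) * norm s powr (- (1 + 1))"
        using s \<sigma> by (intro norm_perron_kernel_le N) auto
      also have "\<dots> \<le> 2 * real (Suc N) powr (c + 1) * T powr (- (1 + 1))"
        using s T abs_Im_le_cmod[of s] by (intro mult_mono powr_mono powr_mono2') auto
      also have "T powr (- (1 + 1)) = 1 / T ^ 2"
        using T by (simp add: powr_minus divide_inverse)
      finally have 2: "norm (perron_kernel N s) \<le> 2 * real (Suc N) powr (c + 1) * (1 / T ^ 2)" .
      have "norm (f s) \<le> K * (2 * T) * (2 * real (Suc N) powr (c + 1) * (1 / T ^ 2))"
        unfolding f_def norm_mult using 1 2 K T by (intro mult_mono) auto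
      also have "\<dots> = 4 * K * real (Suc N) powr (c + 1) / T"
        using T by (simp add: power2_eq_square)
      finally show "norm (f s) \<le> 4 * K * real (Suc N) powr (c + 1) / T" .
    qed (use inH \<sigma> in auto)
    also have "norm (Complex c t - Complex \<sigma> t) = c - \<sigma>"
      using \<sigma> by (subst cmod_eq_Re) auto
    finally show ?thesis by (simp add: D_def)
  qed
  have ver: "norm (g (Complex \<sigma> T) - g (Complex \<sigma> (- T))) \<le> C" if T: "T \<ge> 1" for T
  proof -
    \<comment> \<open>The constant in |sigma + i x| >= r (1 + |x|), seen by comparing |x| with
      sigma. It produces the factor (1 + sigma) / sigma in the result.\<close>
    define r where "r = \<sigma> / (1 + \<sigma>)"
    define B where "B = 2 * K * real (Suc N) powr (\<sigma> + 2 * \<epsilon>) * r powr (- (1 + 2 * \<epsilon>))"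
    have r: "r > 0" using \<sigma> by (simp add: r_def)
    have bd: "norm (f (Complex \<sigma> x)) \<le> B * (1 + \<bar>x\<bar>) powr (- 1 - \<epsilon>)" for x
    proof -
      let ?s = "Complex \<sigma> x"
      have "(1 + \<bar>x\<bar>) * \<sigma> \<le> norm ?s * (1 + \<sigma>)"
      proof (cases "\<bar>x\<bar> \<le> \<sigma>")
        case True
        have "(1 + \<bar>x\<bar>) * \<sigma> \<le> (1 + \<sigma>) * \<sigma>"
          using True \<sigma> by (intro mult_right_mono) auto
        also have "\<dots> \<le> norm ?s * (1 + \<sigma>)"
          using abs_Re_le_cmod[of ?s] \<sigma> by (simp add: mult.commute)
        finally show ?thesis .
      next
        case False
        then have "(1 + \<bar>x\<bar>) * \<sigma> \<le> \<bar>x\<bar> * (1 + \<sigma>)"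
          by (simp add: algebra_simps)
        also have "\<dots> \<le> norm ?s * (1 + \<sigma>)"
          using abs_Im_le_cmod[of ?s] \<sigma> by (intro mult_right_mono) auto
        finally show ?thesis .
      qed
      then have ns: "norm ?s \<ge> (1 + \<bar>x\<bar>) * r"
        using \<sigma> by (simp add: r_def field_simps)
      \<comment> \<open>Interpolation weight 2 eps on the vertical side: the decay exponent 1 + 2
        eps absorbs the growth exponent eps and leaves 1 + eps, at the cost of N^(2 eps).\<close>
      have "norm (perron_kernel N ?s) \<le> 2 * real (Suc N) powr (Re ?s + 2 * \<epsilon>) * norm ?s powr (- (1 + 2 * \<epsilon>))"
        using \<sigma> \<epsilon> by (intro norm_perron_kernel_le N) auto
      also have "\<dots> \<le> 2 * real (Suc N) powr (\<sigma> + 2 * \<epsilon>) * ((1 + \<bar>x\<bar>) * r) powr (- (1 + 2 * \<epsilon>))"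
        using ns r \<epsilon> by (intro mult_mono powr_mono2') (auto intro!: mult_pos_pos)
      also have "\<dots> = 2 * real (Suc N) powr (\<sigma> + 2 * \<epsilon>) * ((1 + \<bar>x\<bar>) powr (- (1 + 2 * \<epsilon>)) * r powr (- (1 + 2 * \<epsilon>)))"
        using r by (subst powr_mult) auto
      finally have "norm (f ?s) \<le> (K * (1 + \<bar>x\<bar>) powr \<epsilon>) * (2 * real (Suc N) powr (\<sigma> + 2 * \<epsilon>) * ((1 + \<bar>x\<bar>) powr (- (1 + 2 * \<epsilon>)) * r powr (- (1 + 2 * \<epsilon>))))"
        unfolding f_def norm_mult using bound[of ?s] K by (intro mult_mono) auto
      also have "\<dots> = B * ((1 + \<bar>x\<bar>) powr \<epsilon> * (1 + \<bar>x\<bar>) powr (- (1 + 2 * \<epsilon>)))"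
        by (simp add: B_def mult_ac)
      also have "\<dots> = B * (1 + \<bar>x\<bar>) powr (- 1 - \<epsilon>)"
        by (simp add: algebra_simps flip: powr_add)
      finally show ?thesis .
    qed
    have pr: "(f has_contour_integral (g (Complex \<sigma> T) - g (Complex \<sigma> (- T)))) (vline \<sigma> T)"
      using inH by (intro prim) auto
    have "(f has_contour_integral (g (Complex \<sigma> T) - g (Complex \<sigma> (- T)))) (vline \<sigma> T) \<longleftrightarrow>
        ((\<lambda>x. f (Complex \<sigma> x)) has_integral (- \<i> * (g (Complex \<sigma> T) - g (Complex \<sigma> (- T))))) {-T..T}"
      using T by (intro has_contour_integral_linepath_same_Re_iff) auto
    with pr have hi: "((\<lambda>x. f (Complex \<sigma> x)) has_integral (- \<i> * (g (Complex \<sigma> T) - g (Complex \<sigma> (- T))))) {-T..T}"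
      by blast
    have T0: "T > 0" using T by simp
    note I = integral_one_plus_abs_powr_le[OF \<epsilon>(1) T0]
    have B0: "B \<ge> 0" using K by (simp add: B_def)
    have "norm (integral {-T..T} (\<lambda>x. f (Complex \<sigma> x))) \<le> integral {-T..T} (\<lambda>x. B * (1 + \<bar>x\<bar>) powr (- 1 - \<epsilon>))"
      using bd by (intro integral_norm_bound_integral has_integral_integrable[OF hi] integrable_on_mult_right I) auto
    also have "\<dots> \<le> B * (2 / \<epsilon>)"
      using I(2) B0 by (simp only: integral_mult_right) (intro mult_left_mono)
    also have "\<dots> = C"
    proof -
      have "r powr (- q) = ((1 + \<sigma>) / \<sigma>) powr q" for q
        using \<sigma> by (simp add: r_def powr_minus powr_divide)
      then show ?thesis
        unfolding B_def C_def by (simp only:) (simp add: mult_ac)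
    qed
    finally show ?thesis
      using integral_unique[OF hi] by (simp add: norm_mult)
  qed
  have main: "norm (contour_integral (vline c T) f) \<le> C + 2 * D / T" if T: "T \<ge> 1" for T
  proof -
    have "contour_integral (vline c T) f = g (Complex c T) - g (Complex c (- T))"
      using inH \<sigma> by (intro contour_integral_unique prim) auto
    also have "norm (g (Complex c T) - g (Complex c (- T))) \<le> norm (g (Complex c T) - g (Complex \<sigma> T))
        + norm (g (Complex \<sigma> T) - g (Complex \<sigma> (- T))) + norm (g (Complex c (-T)) - g (Complex \<sigma> (- T)))"
      by norm
    also have "\<dots> \<le> D / T + C + D / T"
      using T by (intro add_mono hor ver) auto
    finally show ?thesis by simp
  qed
  have "norm (2 * of_real pi * \<i> * S) \<le> C + 0"
  proof (rule tendsto_le[OF _ _ tendsto_norm[OF lim]])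
    show "\<forall>\<^sub>F T in at_top. norm (contour_integral (vline c T) (\<lambda>s. A s * perron_kernel N s)) \<le> C + 2 * D / T"
      using eventually_ge_at_top[of 1] by eventually_elim (use main in \<open>auto simp: f_def\<close>)
    show "((\<lambda>T. C + 2 * D / T) \<longlongrightarrow> C + 0) at_top"
      by (intro tendsto_intros tendsto_divide_0[OF tendsto_const] filterlim_at_top_imp_at_infinity filterlim_ident)
  qed auto
  moreover have "1 * norm S \<le> (2 * pi) * norm S"
    using pi_gt3 by (intro mult_right_mono) auto
  ultimately show ?thesis
    unfolding C_def[symmetric] by (simp add: norm_mult)
qed

section \<open>Tails of the Moebius Dirichlet series\<close>

lemma has_sum_imp_tendsto_atMost:
  fixes f :: "nat \<Rightarrow> complex"
  assumes "(f has_sum S) {1..}"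
  shows "(\<lambda>M. \<Sum>m\<in>{1..M}. f m) \<longlonglongrightarrow> S"
proof -
  define g where "g = (\<lambda>n. if n = 0 then 0 else f n)"
  have "(g has_sum S) UNIV"
    using assms by (subst has_sum_cong_neutral[of "{1..}" UNIV f g]) (auto simp: g_def)
  then have "g sums S"
    by (rule has_sum_imp_sums)
  then have "(\<lambda>M. \<Sum>m<Suc M. g m) \<longlonglongrightarrow> S"
    unfolding sums_def by (rule LIMSEQ_Suc)
  moreover have "(\<Sum>m<Suc M. g m) = (\<Sum>m\<in>{1..M}. f m)" for M
    by (rule sum.mono_neutral_cong_right) (auto simp: g_def)
  ultimately show ?thesis by simp
qed

lemma one_plus_abs_add_le: "1 + \<bar>x + y\<bar> \<le> (1 + \<bar>x\<bar>) * (1 + \<bar>y\<bar>)" for x y :: real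
proof -
  have "\<bar>x + y\<bar> \<le> \<bar>x\<bar> + \<bar>y\<bar> + \<bar>x\<bar> * \<bar>y\<bar>"
    using abs_triangle_ineq[of x y] by (simp add: add_increasing2)
  then show ?thesis by (simp add: algebra_simps)
qed

text \<open>Perron's formula for 1 / zeta(s + i t), shifted to just right of 1/2;
  \<open>zeta_inv\<close> has no pole there under RH. The twist by m^(-i t) is built in because its
  cost is then only (1 + |t|)^eps, whereas removing it later by partial summation would cost a
  factor of size |t|.\<close>

lemma mobius_twisted_sum_bound:
  assumes RH: riemann_hypothesis and \<delta>: "\<delta> \<le> 1" and \<epsilon>: "0 < \<epsilon>" "4 * \<epsilon> \<le> \<delta>"
  shows "\<exists>B>0. \<forall>N t. norm (\<Sum>m\<in>{1..N}. mobius m * of_nat m powr (- (\<i> * of_real t)))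
           \<le> B * (1 + \<bar>t\<bar>) powr \<epsilon> * real N powr (1 / 2 + \<delta>)"
proof -
  have \<delta>0: "\<delta> > 0" using \<epsilon> by simp
  obtain K where K: "K > 0" "\<And>s. Re s \<ge> 1 / 2 + \<delta> / 2 \<Longrightarrow> norm (zeta_inv s) \<le> K * (1 + \<bar>Im s\<bar>) powr \<epsilon>"
    using zeta_inv_bound[OF RH, of "\<delta> / 2" \<epsilon>] \<epsilon> \<delta>0 by auto
  \<comment> \<open>Half of \<open>\<delta>\<close> is spent on the distance to the critical line;
    the other half pays for the loss N^(2 eps) of the shift, as 4 eps <= delta.\<close>
  define \<sigma> where "\<sigma> = 1 / 2 + \<delta> / 2"
  define C where "C = 4 / \<epsilon> * ((1 + \<sigma>) / \<sigma>) powr (1 + 2 * \<epsilon>)"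
  have C0: "C > 0" using \<epsilon> \<delta>0 by (simp add: C_def \<sigma>_def)
  have "norm (\<Sum>m\<in>{1..N}. mobius m * of_nat m powr (- (\<i> * of_real t)))
           \<le> (C * K * 4) * (1 + \<bar>t\<bar>) powr \<epsilon> * real N powr (1 / 2 + \<delta>)" for N t
  proof (cases "N \<ge> 1")
    case False
    then have "N = 0" by simp
    then show ?thesis by simp
  next
    case N: True
    define cf where "cf = (\<lambda>m. mobius m * of_nat m powr (- (\<i> * of_real t)))"
    define A where "A = (\<lambda>s. zeta_inv (s + \<i> * of_real t))"
    have hs: "((\<lambda>m. cf m * of_nat m powr (- s)) has_sum A s) {1..}" if "Re s = 2" for s
    proof -
      let ?w = "s + \<i> * of_real t"
      have "((\<lambda>m. mobius m * of_nat m powr (- ?w)) has_sum 1 / zeta ?w) {1..}"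
        using that by (intro mobius_has_sum) simp
      moreover have "?w \<noteq> 1" using that by (auto simp: complex_eq_iff)
      moreover have "(of_nat m :: complex) powr (- ?w) = of_nat m powr (- (\<i> * of_real t)) * of_nat m powr (- s)" for m
        by (simp flip: powr_add add: algebra_simps)
      ultimately show ?thesis
        by (simp add: A_def cf_def zeta_inv_eq mult.assoc)
    qed
    have lim: "((\<lambda>T. contour_integral (vline 2 T) (\<lambda>s. A s * perron_kernel N s))
            \<longlongrightarrow> 2 * of_real pi * \<i> * (\<Sum>i\<in>{i\<in>{1..}. i \<le> N}. cf i)) at_top"
    proof (rule perron_dirichlet[where v = "\<lambda>i. i"])
      show "finite {i \<in> {1..}. i \<le> N}"
        by (rule finite_subset[of _ "{..N}"]) auto
    qed (use N hs in auto)
    have "norm (\<Sum>i\<in>{i\<in>{1..}. i \<le> N}. cf i) \<le> 4 / \<epsilon> * ((1 + \<sigma>) / \<sigma>) powr (1 + 2 * \<epsilon>) * (K * (1 + \<bar>t\<bar>) powr \<epsilon>) * real (Suc N) powr (\<sigma> + 2 * \<epsilon>)"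
    proof (rule perron_shift[OF _ _ _ _ _ N _ _ _ lim])
      show "0 < \<sigma>" "\<sigma> < 2" "1 / 2 < \<sigma>" "0 < \<epsilon>" "2 * \<epsilon> \<le> 1" "0 \<le> K * (1 + \<bar>t\<bar>) powr \<epsilon>"
        using \<epsilon> \<delta> \<delta>0 K by (auto simp: \<sigma>_def)
      have "(zeta_inv \<circ> (\<lambda>s. s + \<i> * of_real t)) holomorphic_on {s. Re s > 1 / 2}"
        by (rule holomorphic_on_compose_gen[OF _ holomorphic_zeta_inv_RH[OF RH]]) (auto intro!: holomorphic_intros)
      then show "A holomorphic_on {s. Re s > 1 / 2}"
        by (simp add: A_def o_def)
      fix s assume "Re s = \<sigma> \<or> \<sigma> \<le> Re s \<and> Re s \<le> 2 \<and> 1 \<le> \<bar>Im s\<bar>"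
      then have "norm (A s) \<le> K * (1 + \<bar>Im s + t\<bar>) powr \<epsilon>"
        using K(2)[of "s + \<i> * of_real t"] by (auto simp: A_def \<sigma>_def)
      also have "\<dots> \<le> K * ((1 + \<bar>Im s\<bar>) * (1 + \<bar>t\<bar>)) powr \<epsilon>"
        using K(1) \<epsilon> one_plus_abs_add_le[of "Im s" t] by (intro mult_left_mono powr_mono2) auto
      also have "\<dots> = K * (1 + \<bar>t\<bar>) powr \<epsilon> * (1 + \<bar>Im s\<bar>) powr \<epsilon>"
        by (subst powr_mult) auto
      finally show "norm (A s) \<le> K * (1 + \<bar>t\<bar>) powr \<epsilon> * (1 + \<bar>Im s\<bar>) powr \<epsilon>" .
    qed
    then have "norm (\<Sum>i\<in>{i\<in>{1..}. i \<le> N}. cf i) \<le> C * (K * (1 + \<bar>t\<bar>) powr \<epsilon>) * real (Suc N) powr (\<sigma> + 2 * \<epsilon>)"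
      unfolding C_def .
    also have "\<dots> \<le> C * (K * (1 + \<bar>t\<bar>) powr \<epsilon>) * (4 * real N powr (1 / 2 + \<delta>))"
    proof (rule mult_left_mono)
      have "real (Suc N) powr (\<sigma> + 2 * \<epsilon>) \<le> (2 * real N) powr (\<sigma> + 2 * \<epsilon>)"
        using N \<epsilon> \<delta>0 by (intro powr_mono2) (auto simp: \<sigma>_def)
      also have "\<dots> \<le> (2 * real N) powr (1 / 2 + \<delta>)"
        using N \<epsilon> \<delta>0 by (intro powr_mono) (auto simp: \<sigma>_def)
      also have "\<dots> = 2 powr (1 / 2 + \<delta>) * real N powr (1 / 2 + \<delta>)"
        by (subst powr_mult) auto
      also have "2 powr (1 / 2 + \<delta>) \<le> (2::real) powr 2"
        using \<delta> by (intro powr_mono) auto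
      also have "(2::real) powr 2 = 4"
        by simp
      finally show "real (Suc N) powr (\<sigma> + 2 * \<epsilon>) \<le> 4 * real N powr (1 / 2 + \<delta>)"
        by (simp add: mult_right_mono)
      show "0 \<le> C * (K * (1 + \<bar>t\<bar>) powr \<epsilon>)"
        using K C0 by simp
    qed
    finally have "norm (\<Sum>i\<in>{i\<in>{1..}. i \<le> N}. cf i) \<le> C * (K * (1 + \<bar>t\<bar>) powr \<epsilon>) * (4 * real N powr (1 / 2 + \<delta>))" .
    moreover have "{i\<in>{1..}. i \<le> N} = {1..N}" by auto
    ultimately show ?thesis
      by (simp add: cf_def mult_ac)
  qed
  moreover have "C * K * 4 > 0" using C0 K by simp
  ultimately show ?thesis by blast
qed

section \<open>Partial summation and the tail of 1 / zeta\<close>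

text \<open>For u >= m one has m^p sigma u^(-sigma-1) <= sigma u^(p-sigma-1). Integrating over
  [m, m+1] gives the claim; the monotone function \<open>\<phi>\<close> performs this without
  integrals. The right side telescopes when summed over m.\<close>

lemma powr_step_le:
  fixes p \<sigma> :: real
  assumes m: "m \<ge> (1::nat)" and p: "0 \<le> p" "p < \<sigma>"
  shows "real m powr p * (real m powr (- \<sigma>) - real (Suc m) powr (- \<sigma>))
     \<le> \<sigma> / (\<sigma> - p) * (real m powr (p - \<sigma>) - real (Suc m) powr (p - \<sigma>))"
proof -
  define \<phi> where "\<phi> = (\<lambda>u. \<sigma> / (\<sigma> - p) * u powr (p - \<sigma>) - real m powr p * u powr (- \<sigma>))"
  have "\<phi> (real (Suc m)) \<le> \<phi> (real m)"
  proof (rule DERIV_nonpos_imp_nonincreasing[where f = \<phi>])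
    fix u assume u: "real m \<le> u" "u \<le> real (Suc m)"
    then have u0: "u > 0" using m by simp
    have "(\<phi> has_real_derivative (\<sigma> / (\<sigma> - p) * ((p - \<sigma>) * u powr (p - \<sigma> - 1)) - real m powr p * (- \<sigma> * u powr (- \<sigma> - 1)))) (at u)"
      unfolding \<phi>_def using u0 p by (auto intro!: derivative_eq_intros)
    moreover have "\<sigma> / (\<sigma> - p) * ((p - \<sigma>) * u powr (p - \<sigma> - 1)) - real m powr p * (- \<sigma> * u powr (- \<sigma> - 1)) \<le> 0"
    proof -
      have "\<sigma> / (\<sigma> - p) * ((p - \<sigma>) * u powr (p - \<sigma> - 1)) = - \<sigma> * u powr (p - \<sigma> - 1)"
      proof -
        have "\<sigma> / (\<sigma> - p) * (p - \<sigma>) = - \<sigma>"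
          using p by (simp add: field_simps)
        then show ?thesis by (simp only: mult.assoc[symmetric])
      qed
      moreover have "u powr (p - \<sigma> - 1) = u powr p * u powr (- \<sigma> - 1)"
        by (simp flip: powr_add add: algebra_simps)
      moreover have "real m powr p * (\<sigma> * u powr (- \<sigma> - 1)) \<le> u powr p * (\<sigma> * u powr (- \<sigma> - 1))"
        using u p by (intro mult_right_mono powr_mono2) auto
      ultimately show ?thesis by (simp add: algebra_simps)
    qed
    ultimately show "\<exists>y. (\<phi> has_real_derivative y) (at u) \<and> y \<le> 0"
      by blast
  qed simp
  moreover have "real m powr p * real m powr (- \<sigma>) = real m powr (p - \<sigma>)"
    by (simp flip: powr_add)
  ultimately show ?thesis
    by (simp add: \<phi>_def algebra_simps)
qed

text \<open>Abel summation. The two boundary terms account for the 2 and the telescoping bound of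
  the inner sum for sigma / (sigma - p). The result does not depend on \<open>M\<close>, so
  \<open>M\<close> may tend to infinity.\<close>

lemma partial_summation_bound:
  fixes a :: "nat \<Rightarrow> complex" and p \<sigma> D :: real
  assumes S: "\<And>N. norm (\<Sum>m\<in>{1..N}. a m) \<le> D * real N powr p" and p: "0 \<le> p" "p < \<sigma>"
    and Y: "1 \<le> Y" "Y \<le> M"
  shows "norm (\<Sum>m\<in>{Y<..M}. a m * of_real (real m powr (- \<sigma>))) \<le> D * (2 + \<sigma> / (\<sigma> - p)) * real Y powr (p - \<sigma>)"
proof -
  define s where "s = (\<lambda>N. \<Sum>m\<in>{1..N}. a m)"
  define c where "c = (\<lambda>m. complex_of_real (real m powr (- \<sigma>)))"
  have D0: "D \<ge> 0"
    using S[of 1] by (simp add: order_trans[OF norm_ge_zero])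
  have eq: "(\<Sum>m\<in>{Y<..M}. a m * c m) = s M * c M - s Y * c Y + (\<Sum>m\<in>{Y..<M}. s m * (c m - c (Suc m)))"
    using Y(2)
  proof (induction M rule: dec_induct)
    case (step n)
    have "{Y<..Suc n} = insert (Suc n) {Y<..n}"
      using step by auto
    moreover have "s (Suc n) = s n + a (Suc n)"
      by (simp add: s_def)
    moreover have "{Y..<Suc n} = insert n {Y..<n}"
      using step by auto
    ultimately show ?case
      using step by (simp add: algebra_simps)
  qed simp
  have nc: "norm (s m * c m) \<le> D * real m powr (p - \<sigma>)" for m
  proof -
    have "norm (s m * c m) \<le> (D * real m powr p) * real m powr (- \<sigma>)"
      unfolding norm_mult c_def using S[of m] by (intro mult_mono) (auto simp: s_def D0)
    also have "\<dots> = D * real m powr (p - \<sigma>)"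
      by (simp flip: powr_add add: mult.assoc)
    finally show ?thesis .
  qed
  have nd: "norm (s m * (c m - c (Suc m))) \<le> D * (\<sigma> / (\<sigma> - p)) * (real m powr (p - \<sigma>) - real (Suc m) powr (p - \<sigma>))" if "m \<ge> 1" for m
  proof -
    have "real (Suc m) powr (- \<sigma>) \<le> real m powr (- \<sigma>)"
      using that p by (intro powr_mono2') auto
    then have "norm (c m - c (Suc m)) = real m powr (- \<sigma>) - real (Suc m) powr (- \<sigma>)"
      unfolding c_def of_real_diff[symmetric] norm_of_real by simp
    then have "norm (s m * (c m - c (Suc m))) \<le> (D * real m powr p) * (real m powr (- \<sigma>) - real (Suc m) powr (- \<sigma>))"
      unfolding norm_mult using S[of m] \<open>real (Suc m) powr (- \<sigma>) \<le> _\<close> by (intro mult_mono) (auto simp: s_def D0)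
    also have "\<dots> = D * (real m powr p * (real m powr (- \<sigma>) - real (Suc m) powr (- \<sigma>)))"
      by (simp only: mult.assoc)
    also have "\<dots> \<le> D * (\<sigma> / (\<sigma> - p) * (real m powr (p - \<sigma>) - real (Suc m) powr (p - \<sigma>)))"
      by (intro mult_left_mono powr_step_le that p D0)
    finally show ?thesis by (simp only: mult.assoc)
  qed
  have "(\<Sum>m\<in>{Y..<M}. real m powr (p - \<sigma>) - real (Suc m) powr (p - \<sigma>)) = real Y powr (p - \<sigma>) - real M powr (p - \<sigma>)"
    using Y(2) by (induction M rule: dec_induct) auto
  also have "\<dots> \<le> real Y powr (p - \<sigma>)"
    by simp
  finally have tele: "(\<Sum>m\<in>{Y..<M}. real m powr (p - \<sigma>) - real (Suc m) powr (p - \<sigma>)) \<le> real Y powr (p - \<sigma>)" .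
  have "norm (\<Sum>m\<in>{Y<..M}. a m * c m) \<le> norm (s M * c M) + norm (s Y * c Y) + norm (\<Sum>m\<in>{Y..<M}. s m * (c m - c (Suc m)))"
  proof -
    have tri: "norm (u - v + w) \<le> norm u + norm v + norm w" for u v w :: complex
      by norm
    show ?thesis
      unfolding eq by (rule tri)
  qed
  also have "norm (\<Sum>m\<in>{Y..<M}. s m * (c m - c (Suc m))) \<le> (\<Sum>m\<in>{Y..<M}. D * (\<sigma> / (\<sigma> - p)) * (real m powr (p - \<sigma>) - real (Suc m) powr (p - \<sigma>)))"
    using Y by (intro order_trans[OF norm_sum] sum_mono nd) auto
  also have "\<dots> \<le> D * (\<sigma> / (\<sigma> - p)) * real Y powr (p - \<sigma>)"
    unfolding sum_distrib_left[symmetric] using p D0 tele by (intro mult_left_mono) auto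
  also have "norm (s M * c M) \<le> D * real Y powr (p - \<sigma>)"
    using Y p D0 by (intro order_trans[OF nc] mult_left_mono powr_mono2') auto
  also have "norm (s Y * c Y) \<le> D * real Y powr (p - \<sigma>)"
    by (rule nc)
  finally show ?thesis
    unfolding c_def by (simp add: algebra_simps)
qed

text \<open>Given by 1 / zeta and a finite sum rather than by the series over m > Y, which converges
  absolutely only for Re w > 1. In this form it is holomorphic for Re w > 1/2 under RH, which leaves
  room to the left of the shifted line.\<close>

definition mobius_tail :: "nat \<Rightarrow> complex \<Rightarrow> complex" where
  "mobius_tail Y w = zeta_inv w - (\<Sum>m\<in>{1..Y}. mobius m * of_nat m powr (- w))"

lemma holomorphic_mobius_tail:
  assumes riemann_hypothesis
  shows "mobius_tail Y holomorphic_on {s. Re s > 1 / 2}"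
  unfolding mobius_tail_def
  by (intro holomorphic_intros holomorphic_zeta_inv_RH assms) auto

lemma mobius_tail_has_sum:
  assumes "Re w > 1"
  shows "((\<lambda>m. mobius m * of_nat m powr (- w)) has_sum mobius_tail Y w) {Y<..}"
proof -
  have "w \<noteq> 1" using assms by auto
  have "((\<lambda>m. mobius m * of_nat m powr (- w)) has_sum
      1 / zeta w - (\<Sum>m\<in>{1..Y}. mobius m * of_nat m powr (- w))) ({1..} - {1..Y})"
    by (rule has_sum_Diff[OF mobius_has_sum(1)[OF assms] has_sum_finite]) auto
  moreover have "{1..} - {1..Y} = {Y<..}"
    by auto
  ultimately show ?thesis
    using \<open>w \<noteq> 1\<close> by (simp add: mobius_tail_def zeta_inv_eq)
qed

text \<open>Partial summation with t = Im w and p = 1/2 + delta <= 3/4. For Re w > 1 the quotient Re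
  w / (Re w - p) is at most 4, which gives 2 + 4 = 6 uniformly up to the line Re w = 1.\<close>

lemma mobius_tail_bound:
  assumes RH: riemann_hypothesis and \<delta>: "\<delta> \<le> 1 / 4" and \<epsilon>: "0 < \<epsilon>" "4 * \<epsilon> \<le> \<delta>"
  shows "\<exists>B>0. \<forall>Y\<ge>1. \<forall>w. Re w > 1 \<longrightarrow>
           norm (mobius_tail Y w) \<le> B * (1 + \<bar>Im w\<bar>) powr \<epsilon> * real Y powr (\<delta> - 1 / 2)"
proof -
  obtain B where B: "B > 0" "\<And>N t. norm (\<Sum>m\<in>{1..N}. mobius m * of_nat m powr (- (\<i> * of_real t)))
           \<le> B * (1 + \<bar>t\<bar>) powr \<epsilon> * real N powr (1 / 2 + \<delta>)"
    using mobius_twisted_sum_bound[OF RH _ \<epsilon>] \<delta> by auto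
  have "norm (mobius_tail Y w) \<le> (6 * B) * (1 + \<bar>Im w\<bar>) powr \<epsilon> * real Y powr (\<delta> - 1 / 2)"
    if Y: "Y \<ge> 1" and w: "Re w > 1" for Y w
  proof -
    define D where "D = B * (1 + \<bar>Im w\<bar>) powr \<epsilon>"
    define p where "p = 1 / 2 + \<delta>"
    define a where "a = (\<lambda>m. mobius m * of_nat m powr (- (\<i> * of_real (Im w))))"
    let ?f = "\<lambda>m. mobius m * of_nat m powr (- w)"
    have p: "0 \<le> p" "p \<le> 3 / 4" using \<delta> \<epsilon> by (auto simp: p_def)
    have D0: "D \<ge> 0" using B by (simp add: D_def)
    have f: "?f m = a m * of_real (real m powr (- Re w))" for m
    proof -
      have "(of_real (real m) :: complex) powr of_real (- Re w) = of_real (real m powr (- Re w))"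
        by (rule powr_of_real) auto
      moreover have "- w = - (\<i> * of_real (Im w)) + of_real (- Re w)"
        by (simp add: complex_eq_iff)
      then have "(of_nat m :: complex) powr (- w) = of_nat m powr (- (\<i> * of_real (Im w))) * of_nat m powr of_real (- Re w)"
        by (simp only: powr_add)
      ultimately show ?thesis
        by (simp add: a_def)
    qed
    have fin: "norm ((\<Sum>m\<in>{1..M}. ?f m) - (\<Sum>m\<in>{1..Y}. ?f m)) \<le> 6 * D * real Y powr (\<delta> - 1 / 2)" if M: "M \<ge> Y" for M
    proof -
      have "{1..M} = {1..Y} \<union> {Y<..M}"
        using M Y by auto
      then have "(\<Sum>m\<in>{1..M}. ?f m) = (\<Sum>m\<in>{1..Y}. ?f m) + (\<Sum>m\<in>{Y<..M}. ?f m)"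
        by (simp only:) (rule sum.union_disjoint; auto)
      then have "(\<Sum>m\<in>{1..M}. ?f m) - (\<Sum>m\<in>{1..Y}. ?f m) = (\<Sum>m\<in>{Y<..M}. a m * of_real (real m powr (- Re w)))"
        unfolding f by simp
      also have "norm \<dots> \<le> D * (2 + Re w / (Re w - p)) * real Y powr (p - Re w)"
        using B(2) p w by (intro partial_summation_bound Y M) (auto simp: a_def D_def p_def)
      also have "\<dots> \<le> D * 6 * real Y powr (\<delta> - 1 / 2)"
      proof (intro mult_mono powr_mono)
        show "2 + Re w / (Re w - p) \<le> 6"
          using w p by (simp add: field_simps)
        show "p - Re w \<le> \<delta> - 1 / 2"
          using w by (simp add: p_def)
      qed (use D0 Y w p in \<open>auto intro!: mult_nonneg_nonneg add_nonneg_nonneg divide_nonneg_nonneg\<close>)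
      finally show ?thesis by (simp add: mult.commute)
    qed
    have "w \<noteq> 1" using w by auto
    then have "(\<lambda>M. (\<Sum>m\<in>{1..M}. ?f m) - (\<Sum>m\<in>{1..Y}. ?f m)) \<longlonglongrightarrow> mobius_tail Y w"
      unfolding mobius_tail_def zeta_inv_eq[OF \<open>w \<noteq> 1\<close>]
      by (intro tendsto_intros has_sum_imp_tendsto_atMost mobius_has_sum w)
    moreover have "\<forall>\<^sub>F M in sequentially. norm ((\<Sum>m\<in>{1..M}. ?f m) - (\<Sum>m\<in>{1..Y}. ?f m)) \<le> 6 * D * real Y powr (\<delta> - 1 / 2)"
      using eventually_ge_at_top[of Y] by eventually_elim (rule fin)
    ultimately have "norm (mobius_tail Y w) \<le> 6 * D * real Y powr (\<delta> - 1 / 2)"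
      by (intro tendsto_upperbound[OF tendsto_norm]) auto
    then show ?thesis
      by (simp add: D_def mult.assoc)
  qed
  moreover have "6 * B > 0" using B by simp
  ultimately show ?thesis by blast
qed

section \<open>The error term\<close>

lemma zeta_scaled_perron:
  assumes k: "k \<ge> 1" and N: "N \<ge> 1"
  shows "((\<lambda>T. contour_integral (vline 2 T) (\<lambda>s. zeta (of_nat k * s) * perron_kernel N s))
            \<longlongrightarrow> 2 * of_real pi * \<i> * of_nat (card {j. 0 < j \<and> j ^ k \<le> N})) at_top"
    and "Re s > 1 \<Longrightarrow> ((\<lambda>j. of_nat (j ^ k) powr (- s)) has_sum zeta (of_nat k * s)) {1..}"
proof -
  show hs: "((\<lambda>j. of_nat (j ^ k) powr (- s)) has_sum zeta (of_nat k * s)) {1..}" if s: "Re s > 1" for s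
  proof -
    have "1 * Re s \<le> real k * Re s"
      using k s by (intro mult_right_mono) auto
    then have "1 < real k * Re s"
      using s by linarith
    then have "Re (of_nat k * s) > 1"
      by simp
    from zeta_has_sum[OF this] show ?thesis
      by (rule has_sum_cong[THEN iffD1, rotated]) (simp add: of_nat_power_powr del: of_nat_power)
  qed
  have sub: "{j \<in> {1..}. j ^ k \<le> N} \<subseteq> {..N}"
  proof
    fix j assume "j \<in> {j \<in> {1..}. j ^ k \<le> N}"
    then show "j \<in> {..N}"
      using self_le_power[of j k] k by auto
  qed
  have "((\<lambda>T. contour_integral (vline 2 T) (\<lambda>s. zeta (of_nat k * s) * perron_kernel N s))
            \<longlongrightarrow> 2 * of_real pi * \<i> * (\<Sum>i\<in>{j\<in>{1..}. j ^ k \<le> N}. 1)) at_top"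
    by (rule perron_dirichlet) (use N hs finite_subset[OF sub] in auto)
  moreover have "{j\<in>{1..}. j ^ k \<le> N} = {j. 0 < j \<and> j ^ k \<le> N}"
    by auto
  ultimately show "((\<lambda>T. contour_integral (vline 2 T) (\<lambda>s. zeta (of_nat k * s) * perron_kernel N s))
            \<longlongrightarrow> 2 * of_real pi * \<i> * of_nat (card {j. 0 < j \<and> j ^ k \<le> N})) at_top"
    by simp
qed

text \<open>On Re s = 2 the three series converge absolutely, so their product is a series over
  triples. The factor m^(-2 b s) is (m^(2b))^(-s), which puts all three coordinates into one integer
  value.\<close>

lemma triple_perron:
  assumes ab: "a \<ge> 1" "b \<ge> 1" and N: "N \<ge> 1"
  shows "((\<lambda>T. contour_integral (vline 2 T)
             (\<lambda>s. zeta (of_nat a * s) * (zeta (of_nat b * s) * mobius_tail Y (of_nat (2 * b) * s)) * perron_kernel N s))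
            \<longlongrightarrow> 2 * of_real pi * \<i> * (\<Sum>(i, j, m) | 0 < i \<and> 0 < j \<and> Y < m \<and> i ^ a * j ^ b * m ^ (2 * b) \<le> N. mobius m)) at_top"
proof -
  let ?A = "\<lambda>s. zeta (of_nat a * s) * (zeta (of_nat b * s) * mobius_tail Y (of_nat (2 * b) * s))"
  let ?I = "{1::nat..} \<times> ({1::nat..} \<times> {Y<..})"
  let ?v = "\<lambda>(i::nat, j::nat, m::nat). i ^ a * j ^ b * m ^ (2 * b)"
  let ?c = "\<lambda>(i::nat, j::nat, m). mobius m"
  have set: "{p \<in> ?I. ?v p \<le> N} = {(i, j, m). 0 < i \<and> 0 < j \<and> Y < m \<and> i ^ a * j ^ b * m ^ (2 * b) \<le> N}"
    by auto
  have fin: "finite {p \<in> ?I. ?v p \<le> N}"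
    unfolding set
  proof (rule finite_subset[OF _ finite_power_triples[of a b "real N"]])
    show "{(i, j, m). 0 < i \<and> 0 < j \<and> Y < m \<and> i ^ a * j ^ b * m ^ (2 * b) \<le> N}
      \<subseteq> {(i, j, m). 0 < i \<and> 0 < j \<and> 0 < m \<and> real (i ^ a * j ^ b * m ^ (2 * b)) \<le> real N}"
      by (auto simp only: of_nat_le_iff)
  qed (use ab in auto)
  have hs: "((\<lambda>p. ?c p * of_nat (?v p) powr (- s)) has_sum
      ?A s) ?I" if s: "Re s = 2" for s
  proof -
    have "1 * Re s \<le> real (2 * b) * Re s"
      using ab s by (intro mult_right_mono) auto
    then have "1 < real (2 * b) * Re s"
      using s by linarith
    then have "Re (of_nat (2 * b) * s) > 1"
      by simp
    note T = mobius_tail_has_sum[OF this, of Y]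
    have s1: "Re s > 1" using s by simp
    have "((\<lambda>(i, p). of_nat (i ^ a) powr (- s) * (case p of (j, m) \<Rightarrow> of_nat (j ^ b) powr (- s) * (mobius m * of_nat m powr (- (of_nat (2 * b) * s)))))
      has_sum ?A s) ?I"
      by (intro has_sum_mult_Times T zeta_scaled_perron(2)[OF _ N s1] ab)
    then show ?thesis
    proof (rule has_sum_cong[THEN iffD1, rotated])
      fix p assume "p \<in> ?I"
      then obtain i j m where p: "p = (i, j, m)" "m > 0"
        by auto
      have "(of_nat (m ^ (2 * b)) :: complex) powr (- s) = of_nat m powr (- (of_nat (2 * b) * s))"
        using of_nat_power_powr[OF p(2), of "2 * b" "- s"] by simp
      then show "(case p of (i, p) \<Rightarrow> of_nat (i ^ a) powr (- s) * (case p of (j, m) \<Rightarrow> of_nat (j ^ b) powr (- s) * (mobius m * of_nat m powr (- (of_nat (2 * b) * s)))))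
        = ?c p * of_nat (?v p) powr (- s)"
        unfolding p(1) prod.case of_nat_mult_powr by (simp only: mult_ac)
    qed
  qed
  have "((\<lambda>T. contour_integral (vline 2 T)
             (\<lambda>s. ?A s * perron_kernel N s))
            \<longlongrightarrow> 2 * of_real pi * \<i> * (\<Sum>p\<in>{p \<in> ?I. ?v p \<le> N}. ?c p)) at_top"
  proof (rule perron_dirichlet[OF _ N _ fin hs])
    fix p assume "p \<in> ?I"
    then obtain i j m where p: "p = (i, j, m)" "i > 0" "j > 0" "m > 0"
      by auto
    then have "?v p > 0" by simp
    then show "?v p \<ge> 1" by simp
  qed simp
  then show ?thesis
    unfolding set .
qed

text \<open>
  The generating function \<open>\<zeta>(a s) \<zeta>(b s) g(2 b s)\<close>, with \<open>g\<close> the tail of \<open>1 / \<zeta>\<close>, has simple poles at \<open>1/a\<close>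
  and \<open>1/b\<close>. Subtracting multiples of \<open>\<zeta>(b s)\<close> and \<open>\<zeta>(a s)\<close> removes them without computing residues, and
  what is subtracted counts perfect powers.
\<close>

lemma large_mobius_sum_bound:
  fixes a b :: nat and \<delta> :: real
  assumes RH: riemann_hypothesis and ab: "0 < b" "b < a" "a < 2 * b" and \<delta>: "0 < \<delta>" "\<delta> \<le> 1 / 4"
  defines "r1 \<equiv> \<lambda>Y. zeta (of_nat a / of_nat b) * mobius_tail Y 2"
    and "r2 \<equiv> \<lambda>Y. zeta (of_nat b / of_nat a) * mobius_tail Y (2 * of_nat b / of_nat a)"
  shows "\<exists>C>0. \<forall>Y\<ge>1. \<forall>N\<ge>1. norm ((\<Sum>(i, j, m) | 0 < i \<and> 0 < j \<and> Y < m \<and> i ^ a * j ^ b * m ^ (2 * b) \<le> N. mobius m)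
      - r1 Y * of_nat (card {j. 0 < j \<and> j ^ b \<le> N}) - r2 Y * of_nat (card {i. 0 < i \<and> i ^ a \<le> N}))
     \<le> C * real Y powr (\<delta> - 1 / 2) * real N powr (1 / (2 * real b) + \<delta>)"
proof -
  \<comment> \<open>The distance of the new line from 1/(2b). It has to stay below the gap between
    1/(2b) and 1/a, which is positive because a < 2b, so that both poles remain on the right;
    delta/2 respects the target exponent.\<close>
  define \<eta> where "\<eta> = min (\<delta> / 2) ((1 / real a - 1 / (2 * real b)) / 2)"
  define \<sigma> where "\<sigma> = 1 / (2 * real b) + \<eta>"
  \<comment> \<open>On Re s = sigma both a s and b s keep at least this distance from the pole of
    zeta at 1, because b sigma <= a sigma < 1.\<close>
  define \<rho> where "\<rho> = 1 - real a * \<sigma>"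
  \<comment> \<open>Three factors grow like |t|^eps, so the shift is made with 3 eps and loses N^(6
    eps). Here 6 eps = delta/8 fits beside \<open>\<eta>\<close>, which is at most delta/2.\<close>
  define \<epsilon> where "\<epsilon> = \<delta> / 48"
  define Q where "Q = 2 * real b"
  have gap: "1 / real a - 1 / (2 * real b) > 0"
  proof -
    have "1 / (2 * real b) < 1 / real a"
      using ab by (intro divide_strict_left_mono mult_pos_pos) auto
    then show ?thesis by simp
  qed
  have \<eta>: "\<eta> > 0" "\<eta> \<le> \<delta> / 2" "\<eta> < 1 / real a - 1 / (2 * real b)"
    using gap \<delta> by (auto simp: \<eta>_def min_def)
  have \<epsilon>: "\<epsilon> > 0" "4 * \<epsilon> \<le> \<delta>" "\<epsilon> \<le> 1"
    using \<delta> by (auto simp: \<epsilon>_def)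
  have Q: "Q \<ge> 1" "real a \<le> Q" "real b \<le> Q"
    using ab by (auto simp: Q_def)
  have \<sigma>0: "\<sigma> > 1 / (4 * real b)" "\<sigma> > 0" "\<sigma> < 2"
  proof -
    have "1 / (4 * real b) \<le> 1 / (2 * real b)"
      using ab by (intro divide_left_mono) auto
    then show "\<sigma> > 1 / (4 * real b)"
      using \<eta> by (simp add: \<sigma>_def)
    have "1 / (2 * real b) \<ge> 0" "1 / (2 * real b) \<le> 1 / 1"
      using ab by (simp, intro divide_left_mono) auto
    then show "\<sigma> > 0" "\<sigma> < 2"
      using \<eta> \<delta> unfolding \<sigma>_def by linarith+
  qed
  have a\<sigma>: "real a * \<sigma> \<ge> 1 / 2 + \<eta>" "real b * \<sigma> \<ge> 1 / 2 + \<eta>" "real (2 * b) * \<sigma> > 1" "real a * \<sigma> < 1" "real b * \<sigma> \<le> real a * \<sigma>"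
  proof -
    have b\<sigma>: "real b * \<sigma> = 1 / 2 + real b * \<eta>"
      using ab by (simp add: \<sigma>_def field_simps)
    have "1 * \<eta> \<le> real b * \<eta>"
      using ab \<eta> by (intro mult_right_mono) auto
    then show "real b * \<sigma> \<ge> 1 / 2 + \<eta>"
      unfolding b\<sigma> by simp
    moreover show le: "real b * \<sigma> \<le> real a * \<sigma>"
      using ab \<sigma>0 by (intro mult_right_mono) auto
    ultimately show "real a * \<sigma> \<ge> 1 / 2 + \<eta>"
      by linarith
    have "real b * \<eta> > 0" using ab \<eta> by simp
    then show "real (2 * b) * \<sigma> > 1"
      using b\<sigma> by simp
    have "\<sigma> < 1 / real a"
      using \<eta> by (simp add: \<sigma>_def)
    then show "real a * \<sigma> < 1"
      using ab by (simp add: field_simps)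
  qed
  have \<rho>: "\<rho> > 0" "\<rho> \<le> 1"
    using a\<sigma> \<sigma>0 by (auto simp: \<rho>_def)
  obtain K where K: "K > 0" "\<And>s. Re s \<ge> 1 / 2 + \<eta> \<Longrightarrow> norm (s - 1) \<ge> \<rho> \<Longrightarrow> norm (zeta s) \<le> K * (1 + \<bar>Im s\<bar>) powr \<epsilon>"
    using zeta_Lindelof[OF RH \<eta>(1) \<rho>(1) \<epsilon>(1)] by blast
  obtain B where B: "B > 0" "\<And>Y w. Y \<ge> 1 \<Longrightarrow> Re w > 1 \<Longrightarrow> norm (mobius_tail Y w) \<le> B * (1 + \<bar>Im w\<bar>) powr \<epsilon> * real Y powr (\<delta> - 1 / 2)"
    using mobius_tail_bound[OF RH \<delta>(2) \<epsilon>(1,2)] by blast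
  define z1 z2 where "z1 = norm (zeta (of_nat a / of_nat b))" and "z2 = norm (zeta (of_nat b / of_nat a))"
  define K0 where "K0 = K * Q * (K * Q * (B * Q)) + z1 * B * (K * Q) + z2 * B * (K * Q)"
  have K0: "K0 > 0"
    unfolding K0_def using K(1) B(1) Q(1) by (intro add_pos_nonneg mult_pos_pos mult_nonneg_nonneg) (auto simp: z1_def z2_def)
  define C where "C = 4 / (3 * \<epsilon>) * ((1 + \<sigma>) / \<sigma>) powr (1 + 2 * (3 * \<epsilon>)) * K0 * 4"
  have C: "C > 0"
    unfolding C_def using \<epsilon> \<sigma>0 K0 by (intro mult_pos_pos) auto
  have "norm ((\<Sum>(i, j, m) | 0 < i \<and> 0 < j \<and> Y < m \<and> i ^ a * j ^ b * m ^ (2 * b) \<le> N. mobius m)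
      - r1 Y * of_nat (card {j. 0 < j \<and> j ^ b \<le> N}) - r2 Y * of_nat (card {i. 0 < i \<and> i ^ a \<le> N}))
     \<le> C * real Y powr (\<delta> - 1 / 2) * real N powr (1 / (2 * real b) + \<delta>)" (is "norm ?S \<le> _")
    if Y: "Y \<ge> 1" and N: "N \<ge> 1" for Y N
  proof -
    let ?g = "mobius_tail Y"
    let ?a = "of_nat a :: complex" and ?b = "of_nat b :: complex" and ?d = "of_nat (2 * b) :: complex"
    define y where "y = real Y powr (\<delta> - 1 / 2)"
    have y0: "y \<ge> 0" by (simp add: y_def)
    \<comment> \<open>The half plane extends left of the new line, and on it 2 b s still has real
      part above 1/2, where \<open>mobius_tail\<close> is holomorphic.\<close>
    define D where "D = {s. Re s > 1 / (4 * real b)}"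
    have openD: "open D"
      unfolding D_def by (rule open_halfspace_Re_gt)
    have D4: "Re s > 0" "Re (?a * s) > 0" "Re (?b * s) > 0" "Re (?d * s) > 1 / 2" if "s \<in> D" for s
    proof -
      have s: "Re s > 1 / (4 * real b)" using that by (simp add: D_def)
      have "1 / (4 * real b) > 0" using ab by simp
      then show s0: "Re s > 0" using s by linarith
      then show "Re (?a * s) > 0" "Re (?b * s) > 0"
        using ab by simp_all
      have "real (2 * b) * (1 / (4 * real b)) < real (2 * b) * Re s"
        using s ab by (intro mult_strict_left_mono) auto
      then show "Re (?d * s) > 1 / 2"
        using ab by simp
    qed
    \<comment> \<open>The corrected generating function times (a s - 1)(b s - 1). At s = 1/b the
      last term vanishes, and \<open>r1\<close> is chosen so that the first two cancel; at s = 1/a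
      the same is done by \<open>r2\<close>.\<close>
    define Nm where "Nm = (\<lambda>s. zeta_reg (?a * s) * zeta_reg (?b * s) * ?g (?d * s)
        - r1 Y * zeta_reg (?b * s) * (?a * s - 1) - r2 Y * zeta_reg (?a * s) * (?b * s - 1))"
    have hz: "(\<lambda>s. zeta_reg (of_nat k * s)) holomorphic_on D" if "k \<in> {a, b}" for k
    proof -
      have "(zeta_reg \<circ> (\<lambda>s. of_nat k * s)) holomorphic_on D"
        using that D4 by (intro holomorphic_on_compose_gen[OF _ holomorphic_zeta_reg] holomorphic_intros) auto
      then show ?thesis by (simp add: o_def)
    qed
    have hg: "(\<lambda>s. ?g (?d * s)) holomorphic_on D"
    proof -
      have "(?g \<circ> (\<lambda>s. ?d * s)) holomorphic_on D"
        using D4(4) by (intro holomorphic_on_compose_gen[OF _ holomorphic_mobius_tail[OF RH]] holomorphic_intros) auto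
      then show ?thesis by (simp add: o_def)
    qed
    have hNm: "Nm holomorphic_on D"
      unfolding Nm_def by (intro holomorphic_intros hz hg) auto
    have ne: "?a \<noteq> 0" "?b \<noteq> 0" "1 / ?a \<noteq> 1 / ?b" "?a / ?b \<noteq> 1" "?b / ?a \<noteq> 1"
      using ab by auto
    have N1: "Nm (1 / ?b) = 0"
      using ne by (simp add: Nm_def zeta_reg_def r1_def r2_def)
    have N2: "Nm (1 / ?a) = 0"
      using ne by (simp add: Nm_def zeta_reg_def r1_def r2_def)
    txt \<open>Clearing denominators and dividing out the zeros at \<open>1/a\<close> and \<open>1/b\<close> extends \<open>A_eq\<close> across the poles.\<close>
    define E1 where "E1 = (\<lambda>z. if z = 1 / ?a then deriv Nm (1 / ?a) else (Nm z - Nm (1 / ?a)) / (z - 1 / ?a))"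
    have hE1: "E1 holomorphic_on D"
      unfolding E1_def by (rule pole_lemma_open[OF hNm openD])
    define E2 where "E2 = (\<lambda>z. if z = 1 / ?b then deriv E1 (1 / ?b) else (E1 z - E1 (1 / ?b)) / (z - 1 / ?b))"
    have hE2: "E2 holomorphic_on D"
      unfolding E2_def by (rule pole_lemma_open[OF hE1 openD])
    define A where "A = (\<lambda>s. E2 s / (?a * ?b))"
    have hA: "A holomorphic_on D"
      unfolding A_def using ne by (intro holomorphic_intros hE2) auto
    have A_eq: "A s = zeta (?a * s) * (zeta (?b * s) * ?g (?d * s)) - r1 Y * zeta (?b * s) - r2 Y * zeta (?a * s)"
      if s: "?a * s \<noteq> 1" "?b * s \<noteq> 1" for s
    proof -
      have s': "s \<noteq> 1 / ?a" "s \<noteq> 1 / ?b"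
        using s ne by auto
      have E10: "E1 (1 / ?b) = 0"
        using ne N1 N2 by (simp add: E1_def)
      have d: "(s - 1 / ?a) * (s - 1 / ?b) * (?a * ?b) = (?a * s - 1) * (?b * s - 1)"
        using ne by (simp add: field_simps)
      have "A s = Nm s / ((s - 1 / ?a) * (s - 1 / ?b) * (?a * ?b))"
        using s' E10 N2 by (simp add: A_def E2_def E1_def)
      also have "\<dots> = Nm s / ((?a * s - 1) * (?b * s - 1))"
        unfolding d ..
      also have "Nm s = ((?a * s - 1) * (?b * s - 1)) *
          (zeta (?a * s) * (zeta (?b * s) * ?g (?d * s)) - r1 Y * zeta (?b * s) - r2 Y * zeta (?a * s))"
        using s by (simp add: Nm_def zeta_reg_def algebra_simps)
      finally show ?thesis
        using s by simp
    qed
    have bound: "norm (A s) \<le> K0 * y * (1 + \<bar>Im s\<bar>) powr (3 * \<epsilon>)"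
      if s: "Re s = \<sigma> \<or> \<sigma> \<le> Re s \<and> Re s \<le> 2 \<and> \<bar>Im s\<bar> \<ge> 1" for s
    proof -
      define \<tau> where "\<tau> = (1 + \<bar>Im s\<bar>) powr \<epsilon>"
      have \<tau>: "\<tau> \<ge> 1"
        unfolding \<tau>_def by (rule one_le_powr_one_plus_abs[OF \<epsilon>(1)])
      have sc: "(1 + \<bar>Im (of_nat k * s)\<bar>) powr \<epsilon> \<le> Q * \<tau>" if k: "real k \<le> Q" for k
      proof -
        have "\<bar>Im (of_nat k * s)\<bar> \<le> Q * \<bar>Im s\<bar>"
          using k by (simp add: abs_mult mult_right_mono)
        then have "1 + \<bar>Im (of_nat k * s)\<bar> \<le> Q * (1 + \<bar>Im s\<bar>)"
          using Q(1) by (simp add: algebra_simps)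
        then have "(1 + \<bar>Im (of_nat k * s)\<bar>) powr \<epsilon> \<le> (Q * (1 + \<bar>Im s\<bar>)) powr \<epsilon>"
          using \<epsilon> by (intro powr_mono2) auto
        also have "\<dots> = Q powr \<epsilon> * \<tau>"
          using Q(1) by (simp add: \<tau>_def powr_mult)
        also have "\<dots> \<le> Q powr 1 * \<tau>"
          using Q(1) \<epsilon> \<tau> by (intro mult_right_mono powr_mono) auto
        finally show ?thesis using Q(1) by simp
      qed
      have z: "norm (zeta (of_nat k * s)) \<le> K * Q * \<tau>" "of_nat k * s \<noteq> 1" if k: "k = a \<or> k = b" for k
      proof -
        have "real k * Re s \<ge> real k * \<sigma>"
          using s by (intro mult_left_mono) auto
        then have re: "Re (of_nat k * s) \<ge> 1 / 2 + \<eta>"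
          using k a\<sigma> by auto
        have "\<rho> \<le> norm (of_nat k * s - 1)"
          using s
        proof
          assume "Re s = \<sigma>"
          then have "\<bar>Re (of_nat k * s - 1)\<bar> \<ge> \<rho>"
            using k a\<sigma> by (auto simp: \<rho>_def)
          then show ?thesis
            using abs_Re_le_cmod[of "of_nat k * s - 1"] by linarith
        next
          assume "\<sigma> \<le> Re s \<and> Re s \<le> 2 \<and> 1 \<le> \<bar>Im s\<bar>"
          then have "1 * 1 \<le> real k * \<bar>Im s\<bar>"
            using k ab by (intro mult_mono) auto
          then have "\<bar>Im (of_nat k * s - 1)\<bar> \<ge> 1"
            by (simp add: abs_mult)
          then show ?thesis
            using abs_Im_le_cmod[of "of_nat k * s - 1"] \<rho> by linarith
        qed
        note rho = this
        then show "of_nat k * s \<noteq> 1"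
          using \<rho> by auto
        have "norm (zeta (of_nat k * s)) \<le> K * (1 + \<bar>Im (of_nat k * s)\<bar>) powr \<epsilon>"
          by (rule K(2)[OF re rho])
        also have "\<dots> \<le> K * (Q * \<tau>)"
          using K(1) k Q by (intro mult_left_mono sc) auto
        finally show "norm (zeta (of_nat k * s)) \<le> K * Q * \<tau>"
          by (simp only: mult.assoc)
      qed
      have "real (2 * b) * Re s \<ge> real (2 * b) * \<sigma>"
        using s by (intro mult_left_mono) auto
      then have "Re (?d * s) > 1"
        using a\<sigma>(3) by simp
      from B(2)[OF Y this] have "norm (?g (?d * s)) \<le> B * (1 + \<bar>Im (?d * s)\<bar>) powr \<epsilon> * y"
        by (simp only: y_def)
      also have "\<dots> \<le> B * (Q * \<tau>) * y"
        using B(1) y0 by (intro mult_left_mono mult_right_mono sc) (auto simp: Q_def)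
      finally have g: "norm (?g (?d * s)) \<le> B * Q * \<tau> * y"
        by (simp only: mult.assoc)
      have "norm (?g 2) \<le> B * y"
        using B(2)[OF Y, of 2] by (simp add: y_def)
      then have r1: "norm (r1 Y) \<le> z1 * (B * y)"
        by (simp add: r1_def z1_def norm_mult mult_left_mono)
      have "Re (2 * ?b / ?a) > 1" "Im (2 * ?b / ?a) = 0"
      proof -
        have e: "2 * ?b / ?a = of_real (2 * real b / real a)" by simp
        show "Re (2 * ?b / ?a) > 1" unfolding e using ab by (simp del: of_real_divide)
        show "Im (2 * ?b / ?a) = 0" unfolding e by (simp del: of_real_divide)
      qed
      then have "norm (?g (2 * ?b / ?a)) \<le> B * y"
        using B(2)[OF Y, of "2 * ?b / ?a"] by (simp add: y_def)
      then have r2: "norm (r2 Y) \<le> z2 * (B * y)"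
        by (simp add: r2_def z2_def norm_mult mult_left_mono)
      have "norm (A s) = norm (zeta (?a * s) * (zeta (?b * s) * ?g (?d * s)) - r1 Y * zeta (?b * s) - r2 Y * zeta (?a * s))"
        by (subst A_eq) (use z in auto)
      also have "\<dots> \<le> norm (zeta (?a * s) * (zeta (?b * s) * ?g (?d * s))) + norm (r1 Y * zeta (?b * s)) + norm (r2 Y * zeta (?a * s))"
        by norm
      also have "\<dots> \<le> (K * Q * \<tau>) * ((K * Q * \<tau>) * (B * Q * \<tau> * y)) + (z1 * (B * y)) * (K * Q * \<tau>) + (z2 * (B * y)) * (K * Q * \<tau>)"
        unfolding norm_mult using z(1) g r1 r2 K(1) B(1) Q(1) \<tau> y0
        by (intro add_mono mult_mono) (auto simp: z1_def z2_def intro!: mult_nonneg_nonneg)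
      also have "\<dots> = K * Q * (K * Q * (B * Q)) * y * \<tau> ^ 3 + (z1 * B * (K * Q) + z2 * B * (K * Q)) * y * \<tau>"
        by (simp add: algebra_simps power3_eq_cube)
      also have "\<dots> \<le> K * Q * (K * Q * (B * Q)) * y * \<tau> ^ 3 + (z1 * B * (K * Q) + z2 * B * (K * Q)) * y * \<tau> ^ 3"
        using \<tau> self_le_power[of \<tau> 3] K(1) B(1) Q(1) y0
        by (intro add_left_mono mult_left_mono mult_nonneg_nonneg add_nonneg_nonneg) (auto simp: z1_def z2_def)
      also have "\<dots> = K0 * y * \<tau> ^ 3"
        by (simp add: K0_def algebra_simps)
      also have "\<tau> ^ 3 = (1 + \<bar>Im s\<bar>) powr (3 * \<epsilon>)"
        using powr_powr[of "1 + \<bar>Im s\<bar>" \<epsilon> 3] \<tau> by (simp add: \<tau>_def mult.commute)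
      finally show ?thesis .
    qed
    let ?cb = "of_nat (card {j. 0 < j \<and> j ^ b \<le> N}) :: complex"
    let ?ca = "of_nat (card {i. 0 < i \<and> i ^ a \<le> N}) :: complex"
    let ?M = "\<Sum>(i, j, m) | 0 < i \<and> 0 < j \<and> Y < m \<and> i ^ a * j ^ b * m ^ (2 * b) \<le> N. mobius m"
    let ?k = "perron_kernel N"
    let ?f1 = "\<lambda>s. zeta (?a * s) * (zeta (?b * s) * ?g (?d * s)) * ?k s"
    let ?f2 = "\<lambda>s. zeta (?b * s) * ?k s"
    let ?f3 = "\<lambda>s. zeta (?a * s) * ?k s"
    have ab1: "a \<ge> 1" "b \<ge> 1" using ab by auto
    let ?I = "\<lambda>T. contour_integral (vline 2 T)"
    \<comment> \<open>On Re s = 2 neither a s nor b s equals 1, so \<open>A\<close> splits into its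
      three summands there and each has its own Perron formula.\<close>
    have CI: "?I T (\<lambda>s. A s * ?k s) =
       ?I T ?f1 - r1 Y * ?I T ?f2 - r2 Y * ?I T ?f3" for T
    proof -
      let ?P = "closed_segment (Complex 2 (- T)) (Complex 2 T)"
      have re: "Re s = 2" if "s \<in> ?P" for s
        by (rule Re_closed_segment_vline[OF that])
      have ne1: "of_nat k * s \<noteq> 1" if "s \<in> ?P" "k \<ge> 1" for s and k :: nat
      proof
        assume "of_nat k * s = 1"
        then have "real k * Re s = 1"
          by (metis Re_complex_of_real of_real_of_nat_eq mult_zero_left Im_complex_of_real diff_zero one_complex.sel(1) times_complex.sel(1))
        then show False
          using re[OF that(1)] that(2) by simp
      qed
      have ck: "continuous_on ?P ?k"
        using re by (intro continuous_on_perron_kernel N) auto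
      have cz: "continuous_on ?P (\<lambda>s. zeta (of_nat k * s))" if "k \<ge> 1" for k
      proof -
        have "continuous_on (- {1}) zeta"
          by (rule holomorphic_on_imp_continuous_on[OF holomorphic_zeta])
        then show ?thesis
          by (rule continuous_on_compose2) (use ne1 that in \<open>auto intro!: continuous_intros\<close>)
      qed
      have PD: "?P \<subseteq> D"
      proof
        fix s assume "s \<in> ?P"
        then show "s \<in> D"
          using re[of s] \<sigma>0 by (simp add: D_def)
      qed
      have cg: "continuous_on ?P (\<lambda>s. ?g (?d * s))"
        by (rule continuous_on_subset[OF holomorphic_on_imp_continuous_on[OF hg] PD])
      have i1: "?f1 contour_integrable_on vline 2 T"
        by (intro contour_integrable_continuous_linepath continuous_intros cz cg ck ab1)
      have i2: "?f2 contour_integrable_on vline 2 T"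
        by (intro contour_integrable_continuous_linepath continuous_intros cz ck ab1)
      have i3: "?f3 contour_integrable_on vline 2 T"
        by (intro contour_integrable_continuous_linepath continuous_intros cz ck ab1)
      have "?I T (\<lambda>s. A s * ?k s) = ?I T (\<lambda>s. ?f1 s - r1 Y * ?f2 s - r2 Y * ?f3 s)"
      proof (rule contour_integral_eq)
        fix s assume "s \<in> path_image (vline 2 T)"
        then have "s \<in> ?P" by simp
        then have "?a * s \<noteq> 1" "?b * s \<noteq> 1"
          by (intro ne1 ab1; assumption)+
        then show "A s * ?k s = ?f1 s - r1 Y * ?f2 s - r2 Y * ?f3 s"
          by (simp add: A_eq algebra_simps)
      qed
      also have "\<dots> = ?I T (\<lambda>s. ?f1 s - r1 Y * ?f2 s) - ?I T (\<lambda>s. r2 Y * ?f3 s)"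
        by (intro contour_integral_diff contour_integrable_diff contour_integrable_lmul i1 i2 i3)
      also have "?I T (\<lambda>s. ?f1 s - r1 Y * ?f2 s) = ?I T ?f1 - ?I T (\<lambda>s. r1 Y * ?f2 s)"
        by (intro contour_integral_diff contour_integrable_lmul i1 i2)
      also have "?I T (\<lambda>s. r1 Y * ?f2 s) = r1 Y * ?I T ?f2"
        by (rule contour_integral_lmul[OF i2])
      also have "?I T (\<lambda>s. r2 Y * ?f3 s) = r2 Y * ?I T ?f3"
        by (rule contour_integral_lmul[OF i3])
      finally show ?thesis .
    qed
    have "((\<lambda>T. ?I T (\<lambda>s. A s * ?k s)) \<longlongrightarrow>
        2 * of_real pi * \<i> * ?M - r1 Y * (2 * of_real pi * \<i> * ?cb) - r2 Y * (2 * of_real pi * \<i> * ?ca)) at_top"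
      unfolding CI by (intro tendsto_intros triple_perron zeta_scaled_perron ab1 N)
    also have "2 * of_real pi * \<i> * ?M - r1 Y * (2 * of_real pi * \<i> * ?cb) - r2 Y * (2 * of_real pi * \<i> * ?ca) = 2 * of_real pi * \<i> * ?S"
      by (simp add: algebra_simps)
    finally have lim: "((\<lambda>T. ?I T (\<lambda>s. A s * ?k s)) \<longlongrightarrow> 2 * of_real pi * \<i> * ?S) at_top" .
    have "norm ?S \<le> 4 / (3 * \<epsilon>) * ((1 + \<sigma>) / \<sigma>) powr (1 + 2 * (3 * \<epsilon>)) * (K0 * y) * real (Suc N) powr (\<sigma> + 2 * (3 * \<epsilon>))"
    proof (rule perron_shift[OF \<sigma>0(2,3,1) _ _ N _ _ _ lim])
      show "A holomorphic_on {s. 1 / (4 * real b) < Re s}"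
        using hA by (simp add: D_def)
    qed (use \<epsilon> \<delta> K0 y0 bound in \<open>auto simp: \<epsilon>_def\<close>)
    also have "\<dots> \<le> 4 / (3 * \<epsilon>) * ((1 + \<sigma>) / \<sigma>) powr (1 + 2 * (3 * \<epsilon>)) * (K0 * y) * (4 * real N powr (1 / (2 * real b) + \<delta>))"
    proof (rule mult_left_mono)
      have e: "1 / (2 * real b) + \<delta> \<le> 2" "0 \<le> \<sigma> + 2 * (3 * \<epsilon>)" "\<sigma> + 2 * (3 * \<epsilon>) \<le> 1 / (2 * real b) + \<delta>"
      proof -
        have "1 / (2 * real b) \<le> 1 / 1"
          using ab by (intro divide_left_mono) auto
        then show "1 / (2 * real b) + \<delta> \<le> 2" using \<delta> by simp
        show "0 \<le> \<sigma> + 2 * (3 * \<epsilon>)" using \<sigma>0 \<epsilon> by simp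
        show "\<sigma> + 2 * (3 * \<epsilon>) \<le> 1 / (2 * real b) + \<delta>"
          using \<eta>(2) \<delta> by (simp add: \<sigma>_def \<epsilon>_def)
      qed
      have "real (Suc N) powr (\<sigma> + 2 * (3 * \<epsilon>)) \<le> (2 * real N) powr (\<sigma> + 2 * (3 * \<epsilon>))"
        using N e by (intro powr_mono2) auto
      also have "\<dots> \<le> (2 * real N) powr (1 / (2 * real b) + \<delta>)"
        using N e by (intro powr_mono) auto
      also have "\<dots> = 2 powr (1 / (2 * real b) + \<delta>) * real N powr (1 / (2 * real b) + \<delta>)"
        by (subst powr_mult) auto
      also have "\<dots> \<le> 2 powr 2 * real N powr (1 / (2 * real b) + \<delta>)"
        using e by (intro mult_right_mono powr_mono) auto
      finally show "real (Suc N) powr (\<sigma> + 2 * (3 * \<epsilon>)) \<le> 4 * real N powr (1 / (2 * real b) + \<delta>)"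
        by simp
      show "0 \<le> 4 / (3 * \<epsilon>) * ((1 + \<sigma>) / \<sigma>) powr (1 + 2 * (3 * \<epsilon>)) * (K0 * y)"
        using \<epsilon> K0 y0 by (intro mult_nonneg_nonneg) auto
    qed
    also have "\<dots> = C * real Y powr (\<delta> - 1 / 2) * real N powr (1 / (2 * real b) + \<delta>)"
      by (simp add: C_def y_def)
    finally show ?thesis .
  qed
  with C show ?thesis by blast
qed

section \<open>The part m <= Y and the divisor problem\<close>

text \<open>Comparison with the integral of u^(-q), one unit interval at a time. The interval
  starting at 0 is treated separately because the derivative is singular there.\<close>

lemma sum_powr_le:
  fixes q :: real
  assumes q: "0 < q" "q < 1"
  shows "(\<Sum>m\<in>{1..Y}. real m powr (- q)) \<le> real Y powr (1 - q) / (1 - q)"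
proof (induction Y)
  case (Suc n)
  have "real (Suc n) powr (- q) \<le> real (Suc n) powr (1 - q) / (1 - q) - real n powr (1 - q) / (1 - q)"
  proof (cases "n = 0")
    case True
    then show ?thesis using q by (simp add: field_simps)
  next
    case False
    define \<phi> where "\<phi> = (\<lambda>u. u powr (1 - q) / (1 - q) - u * real (Suc n) powr (- q))"
    have "\<phi> (real n) \<le> \<phi> (real (Suc n))"
    proof (rule DERIV_nonneg_imp_nondecreasing[where f = \<phi>])
      fix u assume u: "real n \<le> u" "u \<le> real (Suc n)"
      then have u0: "u > 0" using False by simp
      have "(\<phi> has_real_derivative (u powr (- q) - real (Suc n) powr (- q))) (at u)"
        unfolding \<phi>_def using u0 q by (auto intro!: derivative_eq_intros)
      moreover have "real (Suc n) powr (- q) \<le> u powr (- q)"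
        using u u0 q by (intro powr_mono2') auto
      ultimately show "\<exists>y. (\<phi> has_real_derivative y) (at u) \<and> 0 \<le> y"
        by (intro exI[of _ "u powr (- q) - real (Suc n) powr (- q)"]) auto
    qed simp
    then show ?thesis
      by (simp add: \<phi>_def algebra_simps)
  qed
  with Suc show ?case by simp
qed simp

text \<open>The count is the floor of x^(1/b). It allows the terms \<open>r1\<close> and
  \<open>r2\<close>, which come with counts of perfect powers, to be matched with main terms that
  come with real powers of x.\<close>

lemma card_powers_le:
  assumes "b > 0" "x > 0"
  shows "\<bar>real (card {j::nat. 0 < j \<and> j ^ b \<le> nat \<lfloor>x\<rfloor>}) - x powr (1 / real b)\<bar> \<le> 1"
proof -
  let ?y = "x powr (1 / real b)"
  have "j ^ b \<le> nat \<lfloor>x\<rfloor> \<longleftrightarrow> j \<le> nat \<lfloor>?y\<rfloor>" if j: "j > 0" for j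
  proof -
    have "j ^ b \<le> nat \<lfloor>x\<rfloor> \<longleftrightarrow> real j ^ b \<le> x"
      using assms by (simp add: le_nat_iff le_floor_iff)
    also have "real j ^ b = real j powr real b"
      using j by (simp add: powr_realpow)
    also have "real j powr real b \<le> x \<longleftrightarrow> real j \<le> ?y"
    proof
      assume "real j powr real b \<le> x"
      then have "(real j powr real b) powr (1 / real b) \<le> ?y"
        by (intro powr_mono2) auto
      then show "real j \<le> ?y"
        using assms j by (simp add: powr_powr)
    next
      assume "real j \<le> ?y"
      then have "real j powr real b \<le> ?y powr real b"
        by (intro powr_mono2) auto
      then show "real j powr real b \<le> x"
        using assms by (simp add: powr_powr)
    qed
    also have "\<dots> \<longleftrightarrow> j \<le> nat \<lfloor>?y\<rfloor>"
      by (simp add: le_nat_iff le_floor_iff)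
    finally show ?thesis .
  qed
  then have "{j::nat. 0 < j \<and> j ^ b \<le> nat \<lfloor>x\<rfloor>} = {1..nat \<lfloor>?y\<rfloor>}"
    by auto
  then have "real (card {j::nat. 0 < j \<and> j ^ b \<le> nat \<lfloor>x\<rfloor>}) = of_int \<lfloor>?y\<rfloor>"
    by simp
  then show ?thesis by linarith
qed

text \<open>The hypothesis holds only for large arguments, while the error is needed at x / m^(2b),
  which may be close to 1. Below the threshold the counting function and the powers in the main term
  are monotone, hence bounded by their values at \<open>u0\<close>.\<close>

lemma divisor_error_le:
  assumes ab: "a > 0" "b > 0" and \<beta>: "\<beta> > 0"
    and O: "divisor_error a b \<in> O(\<lambda>x. of_real (x powr \<beta>))"
  shows "\<exists>C>0. \<forall>u\<ge>1. norm (divisor_error a b u) \<le> C * u powr \<beta>"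
proof -
  obtain c where c: "c > 0" "\<forall>\<^sub>F x in at_top. norm (divisor_error a b x) \<le> c * norm (complex_of_real (x powr \<beta>))"
    using O by (rule landau_o.bigE)
  then obtain u0 where u0: "\<And>u. u \<ge> u0 \<Longrightarrow> norm (divisor_error a b u) \<le> c * u powr \<beta>"
    unfolding eventually_at_top_linorder by auto
  define z1 z2 where "z1 = norm (zeta (of_nat b / of_nat a))" and "z2 = norm (zeta (of_nat a / of_nat b))"
  define M where "M = real (\<Sum>n | 0 < n \<and> real n \<le> u0. gen_divisor a b n) + (z1 * \<bar>u0\<bar> powr (1 / real a) + z2 * \<bar>u0\<bar> powr (1 / real b))"
  have M0: "M \<ge> 0" unfolding M_def by (intro add_nonneg_nonneg mult_nonneg_nonneg) (auto simp: z1_def z2_def intro!: sum_nonneg)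
  have "norm (divisor_error a b u) \<le> (c + M) * u powr \<beta>" if u: "u \<ge> 1" for u
  proof (cases "u \<ge> u0")
    case True
    then have "norm (divisor_error a b u) \<le> c * u powr \<beta>" by (rule u0)
    also have "\<dots> \<le> (c + M) * u powr \<beta>"
      using M0 by (intro mult_right_mono) auto
    finally show ?thesis .
  next
    case False
    let ?D = "\<lambda>u. \<Sum>n | 0 < n \<and> real n \<le> u. gen_divisor a b n"
    have "?D u \<le> ?D u0"
    proof (rule sum_mono2)
      show "finite {n. 0 < n \<and> real n \<le> u0}"
        by (rule finite_subset[of _ "{..nat \<lfloor>u0\<rfloor>}"]) (auto simp: le_nat_floor)
    qed (use False in auto)
    then have D: "real (?D u) \<le> real (?D u0)"
      by (rule of_nat_mono)
    have "norm (divisor_error a b u) \<le> norm (of_nat (?D u) :: complex) + (norm (zeta (of_nat b / of_nat a) * of_real (u powr (1 / real a)))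
        + norm (zeta (of_nat a / of_nat b) * of_real (u powr (1 / real b))))"
      unfolding divisor_error_def by (intro order_trans[OF norm_triangle_ineq4] add_left_mono norm_triangle_ineq)
    also have "\<dots> = real (?D u) + (z1 * u powr (1 / real a) + z2 * u powr (1 / real b))"
      by (simp only: norm_of_nat norm_mult norm_of_real z1_def z2_def) simp
    also have "\<dots> \<le> M"
      unfolding M_def using False u by (intro add_mono D mult_left_mono powr_mono2) (auto simp: z1_def z2_def)
    also have "\<dots> \<le> (c + M) * 1"
      using c by simp
    also have "\<dots> \<le> (c + M) * u powr \<beta>"
      using c M0 u \<beta> by (intro mult_left_mono ge_one_powr_ge_zero) auto
    finally show ?thesis .
  qed
  moreover have "c + M > 0" using c M0 by simp
  ultimately show ?thesis by blast
qed

text \<open>For fixed \<open>m\<close> the pairs are counted by the divisor problem at x / m^(2b).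
  Its two main terms turn into partial sums of 1 / zeta at 2 and at 2b/a, which are written as full
  value minus tail to prepare the cancellation with the part m > Y.\<close>

lemma small_mobius_sum:
  fixes a b Y :: nat and x :: real
  assumes ab: "0 < b" "0 < a" and x: "x > 0" and Y: "real Y ^ (2 * b) \<le> x"
  shows "(\<Sum>(i, j, m) | 0 < i \<and> 0 < j \<and> 0 < m \<and> m \<le> Y \<and> real (i ^ a * j ^ b * m ^ (2 * b)) \<le> x. mobius m)
     = zeta (of_nat a / of_nat b) * (zeta_inv 2 - mobius_tail Y 2) * of_real (x powr (1 / real b))
       + zeta (of_nat b / of_nat a) * (zeta_inv (2 * of_nat b / of_nat a) - mobius_tail Y (2 * of_nat b / of_nat a)) * of_real (x powr (1 / real a))
       + (\<Sum>m\<in>{1..Y}. mobius m * divisor_error a b (x / real m ^ (2 * b)))"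
proof -
  let ?P = "\<lambda>u. {(i, j). 0 < i \<and> 0 < j \<and> real (i ^ a * j ^ b) \<le> u}"
  let ?T = "{(i, j, m). 0 < i \<and> 0 < j \<and> 0 < m \<and> m \<le> Y \<and> real (i ^ a * j ^ b * m ^ (2 * b)) \<le> x}"
  define J :: "nat \<times> nat \<times> nat \<Rightarrow> nat \<times> nat \<times> nat" where "J = (\<lambda>(i, j, m). (m, i, j))"
  define J' :: "nat \<times> nat \<times> nat \<Rightarrow> nat \<times> nat \<times> nat" where "J' = (\<lambda>(m, i, j). (i, j, m))"
  have le: "real (i ^ a * j ^ b * m ^ (2 * b)) \<le> x \<longleftrightarrow> real (i ^ a * j ^ b) \<le> x / real m ^ (2 * b)" if "m > 0" for i j m :: nat
    using that by (simp add: pos_le_divide_eq)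
  have "(\<Sum>(i, j, m)\<in>?T. mobius m) = (\<Sum>(m, p)\<in>(SIGMA m:{1..Y}. ?P (x / real m ^ (2 * b))). mobius m)"
  proof (rule sum.reindex_bij_witness[of _ J' J])
    fix t assume t: "t \<in> ?T"
    then obtain i j m where tt: "t = (i, j, m)" "m > 0"
      by auto
    show "J' (J t) = t"
      by (simp add: J_def J'_def tt)
    show "J t \<in> (SIGMA m:{1..Y}. ?P (x / real m ^ (2 * b)))"
      using t le[OF tt(2), of i j] unfolding tt by (simp add: J_def)
    show "(case J t of (m, p) \<Rightarrow> mobius m) = (case t of (i, j, m) \<Rightarrow> mobius m)"
      by (simp add: J_def tt)
  next
    fix q assume q: "q \<in> (SIGMA m:{1..Y}. ?P (x / real m ^ (2 * b)))"
    then obtain i j m where qq: "q = (m, i, j)" "m > 0"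
      by auto
    show "J (J' q) = q"
      by (simp add: J_def J'_def qq)
    show "J' q \<in> ?T"
      using q le[OF qq(2), of i j] unfolding qq by (simp add: J'_def)
  qed
  also have "\<dots> = (\<Sum>m\<in>{1..Y}. \<Sum>p\<in>?P (x / real m ^ (2 * b)). mobius m)"
    using ab by (intro sum.Sigma[symmetric] ballI finite_power_pairs) auto
  also have "\<dots> = (\<Sum>m\<in>{1..Y}. mobius m * of_nat (card (?P (x / real m ^ (2 * b)))))"
    by (simp add: mult.commute)
  also have "\<dots> = (\<Sum>m\<in>{1..Y}. zeta (of_nat a / of_nat b) * of_real (x powr (1 / real b)) * (mobius m * of_nat m powr (- 2))
       + zeta (of_nat b / of_nat a) * of_real (x powr (1 / real a)) * (mobius m * of_nat m powr (- (2 * of_nat b / of_nat a)))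
       + mobius m * divisor_error a b (x / real m ^ (2 * b)))"
  proof (rule sum.cong)
    fix m assume "m \<in> {1..Y}"
    then have m: "m > 0" by simp
    have pw: "complex_of_real ((x / real m ^ (2 * b)) powr (1 / real k)) = of_real (x powr (1 / real k)) * of_nat m powr (- (2 * of_nat b / of_nat k))" for k
    proof -
      have "(x / real m ^ (2 * b)) powr (1 / real k) = x powr (1 / real k) * real m powr (- (2 * real b / real k))"
      proof -
        have "real m ^ (2 * b) = real m powr (2 * real b)"
          using m by (simp flip: powr_realpow)
        then show ?thesis
          using m x by (simp add: powr_divide powr_powr powr_minus_divide)
      qed
      moreover have "complex_of_real (real m powr (- (2 * real b / real k))) = of_real (real m) powr of_real (- (2 * real b / real k))"
        by (rule powr_of_real[symmetric]) auto
      ultimately show ?thesis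
        by simp
    qed
    have "of_nat (card (?P (x / real m ^ (2 * b)))) = divisor_error a b (x / real m ^ (2 * b))
        + (zeta (of_nat b / of_nat a) * of_real ((x / real m ^ (2 * b)) powr (1 / real a))
        + zeta (of_nat a / of_nat b) * of_real ((x / real m ^ (2 * b)) powr (1 / real b)))"
      unfolding divisor_error_def sum_gen_divisor[OF ab(2,1)] by simp
    also have "\<dots> = divisor_error a b (x / real m ^ (2 * b))
        + (zeta (of_nat b / of_nat a) * (of_real (x powr (1 / real a)) * of_nat m powr (- (2 * of_nat b / of_nat a)))
        + zeta (of_nat a / of_nat b) * (of_real (x powr (1 / real b)) * of_nat m powr (- 2)))"
      unfolding pw using ab by simp
    finally show "mobius m * of_nat (card (?P (x / real m ^ (2 * b)))) = zeta (of_nat a / of_nat b) * of_real (x powr (1 / real b)) * (mobius m * of_nat m powr (- 2))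
       + zeta (of_nat b / of_nat a) * of_real (x powr (1 / real a)) * (mobius m * of_nat m powr (- (2 * of_nat b / of_nat a)))
       + mobius m * divisor_error a b (x / real m ^ (2 * b))"
      by (simp add: algebra_simps)
  qed simp
  also have "\<dots> = zeta (of_nat a / of_nat b) * of_real (x powr (1 / real b)) * (\<Sum>m\<in>{1..Y}. mobius m * of_nat m powr (- 2))
       + zeta (of_nat b / of_nat a) * of_real (x powr (1 / real a)) * (\<Sum>m\<in>{1..Y}. mobius m * of_nat m powr (- (2 * of_nat b / of_nat a)))
       + (\<Sum>m\<in>{1..Y}. mobius m * divisor_error a b (x / real m ^ (2 * b)))"
    unfolding sum.distrib sum_distrib_left ..
  finally show ?thesis
    by (simp add: mobius_tail_def mult_ac)
qed

text \<open>Y^(2b) <= x keeps every argument at least 1. Because 2 b alpha < 1, the sum of m^(-2 b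
  alpha) is of order Y^(1 - 2 b alpha); the additional factor m^(-2 b eps) is estimated by
  1.\<close>

lemma small_error_bound:
  fixes a b Y :: nat and x \<alpha> \<epsilon> C :: real
  assumes b: "0 < b" and x: "x > 0" and Y: "real Y ^ (2 * b) \<le> x"
    and \<alpha>: "0 < \<alpha>" "2 * real b * \<alpha> < 1" and \<epsilon>: "\<epsilon> > 0" and C0: "C > 0"
    and C: "\<And>u. u \<ge> 1 \<Longrightarrow> norm (divisor_error a b u) \<le> C * u powr (\<alpha> + \<epsilon>)"
  shows "norm (\<Sum>m\<in>{1..Y}. mobius m * divisor_error a b (x / real m ^ (2 * b)))
     \<le> C / (1 - 2 * real b * \<alpha>) * x powr (\<alpha> + \<epsilon>) * real Y powr (1 - 2 * real b * \<alpha>)"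
proof -
  let ?q = "2 * real b * \<alpha>"
  have "norm (mobius m * divisor_error a b (x / real m ^ (2 * b))) \<le> C * x powr (\<alpha> + \<epsilon>) * real m powr (- ?q)"
    if m: "m \<in> {1..Y}" for m
  proof -
    have m1: "m \<ge> 1" using m by simp
    have "real m ^ (2 * b) \<le> real Y ^ (2 * b)"
      using m by (intro power_mono) auto
    then have u: "x / real m ^ (2 * b) \<ge> 1"
      using m1 Y by (simp add: le_divide_eq)
    have "norm (mobius m * divisor_error a b (x / real m ^ (2 * b))) \<le> 1 * (C * (x / real m ^ (2 * b)) powr (\<alpha> + \<epsilon>))"
      unfolding norm_mult using C0 by (intro mult_mono norm_mobius_le C u) auto
    also have "(x / real m ^ (2 * b)) powr (\<alpha> + \<epsilon>) = x powr (\<alpha> + \<epsilon>) * real m powr (- (2 * real b * (\<alpha> + \<epsilon>)))"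
    proof -
      have "real m ^ (2 * b) = real m powr (2 * real b)"
        using m1 by (simp flip: powr_realpow)
      then show ?thesis
        using m1 x by (simp add: powr_divide powr_powr powr_minus_divide)
    qed
    also have "1 * (C * (x powr (\<alpha> + \<epsilon>) * real m powr (- (2 * real b * (\<alpha> + \<epsilon>))))) \<le> 1 * (C * (x powr (\<alpha> + \<epsilon>) * real m powr (- ?q)))"
      using m1 b \<epsilon> C0 by (intro mult_left_mono powr_mono) (auto simp: algebra_simps)
    finally show ?thesis by (simp add: mult.assoc)
  qed
  then have "norm (\<Sum>m\<in>{1..Y}. mobius m * divisor_error a b (x / real m ^ (2 * b))) \<le> (\<Sum>m\<in>{1..Y}. C * x powr (\<alpha> + \<epsilon>) * real m powr (- ?q))"
    by (intro order_trans[OF norm_sum] sum_mono)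
  also have "\<dots> = C * x powr (\<alpha> + \<epsilon>) * (\<Sum>m\<in>{1..Y}. real m powr (- ?q))"
    by (simp only: sum_distrib_left)
  also have "\<dots> \<le> C * x powr (\<alpha> + \<epsilon>) * (real Y powr (1 - ?q) / (1 - ?q))"
    using \<alpha> b C0 by (intro mult_left_mono sum_powr_le) auto
  finally show ?thesis by (simp add: field_simps)
qed

section \<open>Choice of the cut and the final estimate\<close>

text \<open>With Y = x^theta the error exponents are alpha + theta (1 - 2 b alpha) and 1/(2b) -
  theta/2. Equating them is linear in theta, with solution (1/(2b) - alpha) / (3/2 - 2 b alpha), and
  \<open>\<beta>\<close> is the common value. The bound theta < 1/(2b) amounts to 2 < 3 and yields
  Y^(2b) <= x.\<close>

lemma exponent_balance:
  fixes b \<alpha> :: real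
  assumes b: "b > 0" and \<alpha>: "0 < \<alpha>" "2 * b * \<alpha> < 1"
  defines "\<theta> \<equiv> (1 - 2 * b * \<alpha>) / (b * (3 - 4 * b * \<alpha>))"
    and "\<beta> \<equiv> (1 - b * \<alpha>) / (3 * b - 4 * b ^ 2 * \<alpha>)"
  shows "\<theta> > 0" "\<theta> < 1 / (2 * b)" "\<beta> > 0" "\<alpha> + \<theta> * (1 - 2 * b * \<alpha>) = \<beta>" "1 / (2 * b) - \<theta> / 2 = \<beta>"
proof -
  have d: "3 - 4 * b * \<alpha> > 0" using \<alpha> by linarith
  have \<beta>: "\<beta> = (1 - b * \<alpha>) / (b * (3 - 4 * b * \<alpha>))"
    by (simp add: \<beta>_def algebra_simps power2_eq_square)
  show "\<theta> > 0"
    unfolding \<theta>_def using b \<alpha> d by (intro divide_pos_pos mult_pos_pos) auto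
  have "b * \<alpha> < 1 / 2" using \<alpha> by simp
  then show "\<beta> > 0"
    unfolding \<beta> using b d by (intro divide_pos_pos mult_pos_pos) auto
  show "\<theta> < 1 / (2 * b)"
    unfolding \<theta>_def using b d by (simp add: divide_simps)
  show "\<alpha> + \<theta> * (1 - 2 * b * \<alpha>) = \<beta>"
    unfolding \<theta>_def \<beta> using b d by (simp add: divide_simps) (simp add: algebra_simps)
  show "1 / (2 * b) - \<theta> / 2 = \<beta>"
    unfolding \<theta>_def \<beta> using b d by (simp add: divide_simps)
qed

theorem mainTheorem14:
  fixes a b :: nat and \<alpha> :: real
  assumes RH: riemann_hypothesis
    and ab: "0 < b" "b < a" "a < 2 * b"
    and \<alpha>_pos: "0 < \<alpha>" and \<alpha>_less: "\<alpha> < 1 / real (a + b)"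
    and \<Delta>_bound: "\<forall>\<epsilon>>0. divisor_error a b \<in> O(\<lambda>x. of_real (x powr (\<alpha> + \<epsilon>)))"
    and \<alpha>_less': "\<alpha> < 1 / (2 * real b)"
  shows "\<forall>\<epsilon>>0.
    (\<lambda>x. (\<Sum>n | 0 < n \<and> real n \<le> x. indicator (gen_squarefull a b) n)
       - (zeta (of_nat a / of_nat b) / zeta 2 * of_real (x powr (1 / real b))
        + zeta (of_nat b / of_nat a) / zeta (2 * of_nat b / of_nat a) * of_real (x powr (1 / real a))))
    \<in> O(\<lambda>x. of_real (x powr ((1 - real b * \<alpha>) / (3 * real b - 4 * real b ^ 2 * \<alpha>) + \<epsilon>)))"
proof (intro allI impI)
  fix \<epsilon> :: real assume \<epsilon>: "\<epsilon> > 0"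
  define \<theta> where "\<theta> = (1 - 2 * real b * \<alpha>) / (real b * (3 - 4 * real b * \<alpha>))"
  define \<beta> where "\<beta> = (1 - real b * \<alpha>) / (3 * real b - 4 * real b ^ 2 * \<alpha>)"
  \<comment> \<open>1/4 is the largest value that the tail estimates admit. The exponent of x loses
    at most theta delta + delta <= 2 delta, which must not exceed eps.\<close>
  define \<delta> where "\<delta> = min (1 / 4) (\<epsilon> / 2)"
  have b0: "real b > 0" using ab by simp
  have ba: "2 * real b * \<alpha> < 1"
    using \<alpha>_less' b0 by (simp add: field_simps)
  note bal = exponent_balance[OF b0 \<alpha>_pos ba, folded \<theta>_def \<beta>_def]
  have \<delta>: "0 < \<delta>" "\<delta> \<le> 1 / 4" "2 * \<delta> \<le> \<epsilon>"
    using \<epsilon> by (auto simp: \<delta>_def)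
  define z1 z2 where "z1 = zeta (of_nat a / of_nat b)" and "z2 = zeta (of_nat b / of_nat a)"
  let ?w = "2 * of_nat b / of_nat a :: complex"
  have w: "?w = of_real (2 * real b / real a)" by simp
  have Rew: "Re ?w > 1" "Im ?w = 0" "?w \<noteq> 1"
  proof -
    show *: "Re ?w > 1" unfolding w using ab by (simp del: of_real_divide)
    show "Im ?w = 0" unfolding w by (simp del: of_real_divide)
    from * show "?w \<noteq> 1" by (metis one_complex.sel(1) less_irrefl)
  qed
  obtain C1 where C1: "C1 > 0" "\<And>u. u \<ge> 1 \<Longrightarrow> norm (divisor_error a b u) \<le> C1 * u powr (\<alpha> + \<epsilon>)"
    using divisor_error_le[of a b "\<alpha> + \<epsilon>"] \<Delta>_bound ab \<alpha>_pos \<epsilon> by auto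
  let ?r1 = "\<lambda>Y. z1 * mobius_tail Y 2" and ?r2 = "\<lambda>Y. z2 * mobius_tail Y ?w"
  let ?big = "\<lambda>Y N. \<Sum>(i, j, m) | 0 < i \<and> 0 < j \<and> Y < m \<and> i ^ a * j ^ b * m ^ (2 * b) \<le> N. mobius m"
  let ?cb = "\<lambda>N. card {j. 0 < j \<and> j ^ b \<le> N}" and ?ca = "\<lambda>N. card {i. 0 < i \<and> i ^ a \<le> N}"
  obtain C2 where C2: "C2 > 0" "\<And>Y N. Y \<ge> 1 \<Longrightarrow> N \<ge> 1 \<Longrightarrow>
      norm (?big Y N - ?r1 Y * of_nat (?cb N) - ?r2 Y * of_nat (?ca N)) \<le> C2 * real Y powr (\<delta> - 1 / 2) * real N powr (1 / (2 * real b) + \<delta>)"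
    using large_mobius_sum_bound[OF RH ab \<delta>(1,2)] unfolding z1_def z2_def by blast
  obtain B where B: "B > 0" "\<And>Y v. Y \<ge> 1 \<Longrightarrow> Re v > 1 \<Longrightarrow> norm (mobius_tail Y v) \<le> B * (1 + \<bar>Im v\<bar>) powr (\<delta> / 4) * real Y powr (\<delta> - 1 / 2)"
    using mobius_tail_bound[OF RH \<delta>(2), of "\<delta> / 4"] \<delta>(1) by auto
  define C where "C = C1 / (1 - 2 * real b * \<alpha>) + 2 * C2 + (norm z1 * B + norm z2 * B)"
  let ?F = "\<lambda>x. (\<Sum>n | 0 < n \<and> real n \<le> x. indicator (gen_squarefull a b) n) :: complex"
  let ?M = "\<lambda>x. z1 / zeta 2 * of_real (x powr (1 / real b)) + z2 / zeta ?w * of_real (x powr (1 / real a))"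
  have main: "norm (?F x - ?M x)
     \<le> C * x powr (\<beta> + \<epsilon>)" if x: "x \<ge> 1" for x
  proof -
    define Y where "Y = nat \<lfloor>x powr \<theta>\<rfloor>"
    define N where "N = nat \<lfloor>x\<rfloor>"
    have xt: "x powr \<theta> \<ge> 1"
      using x bal(1) by (intro ge_one_powr_ge_zero) auto
    have Y1: "Y \<ge> 1"
      using xt by (simp add: Y_def le_nat_iff le_floor_iff)
    have Yle: "real Y \<le> x powr \<theta>"
      unfolding Y_def using xt by (intro of_nat_floor) auto
    \<comment> \<open>A lower bound for the floor is needed as well, because \<open>Y\<close> enters
      the second error with the negative exponent delta - 1/2.\<close>
    have Yge: "x powr \<theta> / 2 \<le> real Y"
    proof -
      have "x powr \<theta> < real Y + 1"
        unfolding Y_def using xt by linarith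
      moreover have "real Y \<ge> 1" using Y1 by simp
      ultimately show ?thesis by simp
    qed
    have N1: "N \<ge> 1" using x by (simp add: N_def le_nat_iff le_floor_iff)
    have Nle: "real N \<le> x" unfolding N_def using x by (intro of_nat_floor) auto
    have Nx: "real v \<le> x \<longleftrightarrow> v \<le> N" for v
      using x by (simp add: N_def le_nat_iff le_floor_iff)
    have Y2: "real Y ^ (2 * b) \<le> x"
    proof -
      have "real Y ^ (2 * b) = real Y powr (2 * real b)"
        using Y1 by (simp flip: powr_realpow)
      also have "\<dots> \<le> (x powr \<theta>) powr (2 * real b)"
        using Yle by (intro powr_mono2) auto
      also have "\<dots> = x powr (\<theta> * (2 * real b))"
        by (rule powr_powr)
      also have "\<dots> \<le> x powr 1"
        using x bal(2) b0 by (intro powr_mono) (auto simp: field_simps)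
      finally show ?thesis using x by simp
    qed
    let ?T = "{(i, j, m). 0 < i \<and> 0 < j \<and> 0 < m \<and> real (i ^ a * j ^ b * m ^ (2 * b)) \<le> x}"
    let ?T1 = "{(i, j, m). 0 < i \<and> 0 < j \<and> 0 < m \<and> m \<le> Y \<and> real (i ^ a * j ^ b * m ^ (2 * b)) \<le> x}"
    let ?T2 = "{(i, j, m). 0 < i \<and> 0 < j \<and> Y < m \<and> i ^ a * j ^ b * m ^ (2 * b) \<le> N}"
    define E1 where "E1 = (\<Sum>m\<in>{1..Y}. mobius m * divisor_error a b (x / real m ^ (2 * b)))"
    define E2 where "E2 = ?big Y N - ?r1 Y * of_nat (?cb N) - ?r2 Y * of_nat (?ca N)"
    have T: "?T = ?T1 \<union> ?T2" "?T1 \<inter> ?T2 = {}"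
      unfolding Nx by auto
    have fin: "finite ?T"
      using ab by (intro finite_power_triples) auto
    have "?F x = (\<Sum>(i, j, m)\<in>?T. mobius m)"
      by (rule sum_indicator_gen_squarefull[OF ab(1,2)])
    also have "\<dots> = (\<Sum>(i, j, m)\<in>?T1. mobius m) + ?big Y N"
      using fin unfolding T(1) by (intro sum.union_disjoint T(2)) auto
    also have "(\<Sum>(i, j, m)\<in>?T1. mobius m) = z1 * (zeta_inv 2 - mobius_tail Y 2) * of_real (x powr (1 / real b))
       + z2 * (zeta_inv ?w - mobius_tail Y ?w) * of_real (x powr (1 / real a)) + E1"
      unfolding z1_def z2_def E1_def using ab x Y2 by (intro small_mobius_sum) auto
    also have "?big Y N = E2 + ?r1 Y * of_nat (?cb N) + ?r2 Y * of_nat (?ca N)"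
      by (simp add: E2_def)
    finally have F: "?F x = z1 * (zeta_inv 2 - mobius_tail Y 2) * of_real (x powr (1 / real b))
       + z2 * (zeta_inv ?w - mobius_tail Y ?w) * of_real (x powr (1 / real a)) + E1
       + (E2 + ?r1 Y * of_nat (?cb N) + ?r2 Y * of_nat (?ca N))" .
    have zi: "zeta_inv 2 = 1 / zeta 2" "zeta_inv ?w = 1 / zeta ?w"
      using Rew by (auto intro!: zeta_inv_eq)
    \<comment> \<open>The tails missing from the sum over m <= Y meet the terms \<open>r1\<close>
      and \<open>r2\<close> subtracted in the sum over m > Y. Only the tails times the bounded
      difference between a count of powers and a power of x survive.\<close>
    have diff: "?F x - ?M x
       = E1 + E2 + ?r1 Y * of_real (real (?cb N) - x powr (1 / real b)) + ?r2 Y * of_real (real (?ca N) - x powr (1 / real a))"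
      unfolding F zi by (simp add: algebra_simps)
    have tri: "norm (e1 + e2 + e3 + e4) \<le> norm e1 + norm e2 + norm e3 + norm e4" for e1 e2 e3 e4 :: complex
      by norm
    have "norm (?F x - ?M x)
      \<le> norm E1 + norm E2 + norm (?r1 Y * of_real (real (?cb N) - x powr (1 / real b)))
       + norm (?r2 Y * of_real (real (?ca N) - x powr (1 / real a)))"
      unfolding diff by (rule tri)
    also have "\<dots> \<le> C1 / (1 - 2 * real b * \<alpha>) * x powr (\<beta> + \<epsilon>) + 2 * C2 * x powr (\<beta> + \<epsilon>)
       + norm z1 * B * x powr (\<beta> + \<epsilon>) + norm z2 * B * x powr (\<beta> + \<epsilon>)"
    proof (intro add_mono)
      have "norm E1 \<le> C1 / (1 - 2 * real b * \<alpha>) * x powr (\<alpha> + \<epsilon>) * real Y powr (1 - 2 * real b * \<alpha>)"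
        unfolding E1_def using ab x by (intro small_error_bound Y2 \<alpha>_pos ba \<epsilon> C1) auto
      also have "\<dots> \<le> C1 / (1 - 2 * real b * \<alpha>) * x powr (\<alpha> + \<epsilon>) * (x powr \<theta>) powr (1 - 2 * real b * \<alpha>)"
        using C1 ba Yle by (intro mult_left_mono powr_mono2) auto
      also have "\<dots> = C1 / (1 - 2 * real b * \<alpha>) * x powr (\<alpha> + \<epsilon> + \<theta> * (1 - 2 * real b * \<alpha>))"
        by (simp only: powr_powr powr_add mult.assoc)
      also have "\<alpha> + \<epsilon> + \<theta> * (1 - 2 * real b * \<alpha>) = \<beta> + \<epsilon>"
        using bal(4) by linarith
      finally show "norm E1 \<le> C1 / (1 - 2 * real b * \<alpha>) * x powr (\<beta> + \<epsilon>)" .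
    next
      have "norm E2 \<le> C2 * real Y powr (\<delta> - 1 / 2) * real N powr (1 / (2 * real b) + \<delta>)"
        unfolding E2_def by (rule C2(2)[OF Y1 N1])
      also have "\<dots> \<le> C2 * (x powr \<theta> / 2) powr (\<delta> - 1 / 2) * x powr (1 / (2 * real b) + \<delta>)"
        using C2(1) Yge Nle \<delta> xt b0 by (intro mult_mono mult_left_mono powr_mono2 powr_mono2') auto
      also have "(x powr \<theta> / 2) powr (\<delta> - 1 / 2) = x powr (\<theta> * (\<delta> - 1 / 2)) * 2 powr (1 / 2 - \<delta>)"
      proof -
        have "(x powr \<theta> / 2) powr p = x powr (\<theta> * p) * 2 powr (- p)" for p
          using x by (simp add: powr_divide powr_powr powr_minus_divide)
        from this[of "\<delta> - 1 / 2"] show ?thesis by simp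
      qed
      also have "C2 * (x powr (\<theta> * (\<delta> - 1 / 2)) * 2 powr (1 / 2 - \<delta>)) * x powr (1 / (2 * real b) + \<delta>)
          = C2 * 2 powr (1 / 2 - \<delta>) * x powr (\<theta> * (\<delta> - 1 / 2) + (1 / (2 * real b) + \<delta>))"
        by (simp only: powr_add mult_ac)
      also have "\<dots> \<le> C2 * 2 powr 1 * x powr (\<beta> + \<epsilon>)"
      proof (intro mult_mono mult_left_mono powr_mono)
        have "1 / (2 * real b) \<le> 1 / 1"
          using ab by (intro divide_left_mono) auto
        \<comment> \<open>theta <= 1 limits the loss from Y^delta to x^delta; together with the
          x^delta lost in the shift this stays within eps.\<close>
        then have "\<theta> \<le> 1" using bal(2) by simp
        then have "\<theta> * \<delta> \<le> 1 * \<delta>"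
          using \<delta> by (intro mult_right_mono) auto
        then show "\<theta> * (\<delta> - 1 / 2) + (1 / (2 * real b) + \<delta>) \<le> \<beta> + \<epsilon>"
          using bal(5) \<delta>(3) by (simp add: algebra_simps)
      qed (use C2 \<delta> x in auto)
      finally show "norm E2 \<le> 2 * C2 * x powr (\<beta> + \<epsilon>)"
        by (simp add: mult.commute)
    next
      have xb: "1 \<le> x powr (\<beta> + \<epsilon>)"
        using x bal(3) \<epsilon> by (intro ge_one_powr_ge_zero) auto
      have tail: "norm (mobius_tail Y v) \<le> B" if "Re v > 1" "Im v = 0" for v
      proof -
        have "norm (mobius_tail Y v) \<le> B * real Y powr (\<delta> - 1 / 2)"
          using B(2)[OF Y1 that(1)] that(2) by simp
        also have "\<dots> \<le> B * real Y powr 0"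
          using B(1) Y1 \<delta> by (intro mult_left_mono powr_mono) auto
        finally show ?thesis using Y1 by simp
      qed
      have gen: "norm (z * mobius_tail Y v * of_real d) \<le> norm z * B * x powr (\<beta> + \<epsilon>)"
        if "Re v > 1" "Im v = 0" "\<bar>d\<bar> \<le> 1" for z v d
      proof -
        have "norm (z * mobius_tail Y v * of_real d) \<le> norm z * B * 1"
          unfolding norm_mult norm_of_real using tail[OF that(1,2)] that(3) B(1) by (intro mult_mono) auto
        also have "\<dots> \<le> norm z * B * x powr (\<beta> + \<epsilon>)"
          using xb B(1) by (intro mult_left_mono) auto
        finally show ?thesis .
      qed
      show "norm (?r1 Y * of_real (real (?cb N) - x powr (1 / real b))) \<le> norm z1 * B * x powr (\<beta> + \<epsilon>)"
        unfolding N_def using ab x by (intro gen card_powers_le) auto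
      show "norm (?r2 Y * of_real (real (?ca N) - x powr (1 / real a))) \<le> norm z2 * B * x powr (\<beta> + \<epsilon>)"
        unfolding N_def using ab x Rew by (intro gen card_powers_le) auto
    qed
    also have "\<dots> = C * x powr (\<beta> + \<epsilon>)"
      by (simp add: C_def algebra_simps)
    finally show ?thesis .
  qed
  show "(\<lambda>x. ?F x
       - (zeta (of_nat a / of_nat b) / zeta 2 * of_real (x powr (1 / real b))
        + zeta (of_nat b / of_nat a) / zeta ?w * of_real (x powr (1 / real a))))
    \<in> O(\<lambda>x. of_real (x powr ((1 - real b * \<alpha>) / (3 * real b - 4 * real b ^ 2 * \<alpha>) + \<epsilon>)))"
  proof (rule landau_o.bigI)
    show "\<forall>\<^sub>F x in at_top. norm (?F x
       - (zeta (of_nat a / of_nat b) / zeta 2 * of_real (x powr (1 / real b))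
        + zeta (of_nat b / of_nat a) / zeta ?w * of_real (x powr (1 / real a))))
      \<le> C * norm (complex_of_real (x powr ((1 - real b * \<alpha>) / (3 * real b - 4 * real b ^ 2 * \<alpha>) + \<epsilon>)))"
      using eventually_ge_at_top[of 1]
      by eventually_elim (use main in \<open>simp add: z1_def z2_def \<beta>_def\<close>)
    show "C > 0"
      unfolding C_def using C1 C2 B ba by (intro add_pos_nonneg add_pos_pos divide_pos_pos add_nonneg_nonneg) auto
  qed
qed

end
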